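(* Let $L$ be a Lie algebra or a $3$-Lie algebra over a field $\mathbb{k}$, and let $X=\mathbb{k}\oplus L$, $\Delta$, $T$, $R$, $\theta$ be as in the context. For each $n$, let $\Phi_n$ send the generators of the framed braid group $\mathbb{FB}_n$ to endomorphisms of $X^{\otimes 2n}$ by $$\sigma_i\mapsto \mathbf 1^{\otimes(2i-2)}\otimes R\otimes\mathbf 1^{\otimes(2n-2i-2)}\quad(1\le i\le n-1),\qquad t_i\mapsto \mathbf 1^{\otimes(2i-2)}\otimes\theta\otimes\mathbf 1^{\otimes(2n-2i)}\quad(1\le i\le n),$$ where $\mathbf 1$ is the identity of $X$. Then the $\Phi_n$ define a representation $\Phi_\infty:\mathbb{FB}_\infty\to\varinjlim_n\mathrm{Aut}(X^{\otimes 2n})$ of the infinite framed braid group; that is, each assignment $\Phi_n$ takes values in automorphisms and extends to a group homomorphism $\mathbb{FB}_n\to\mathrm{Aut}(X^{\otimes 2n})$, and these homomorphisms are compatible with the colimit maps and induce a group homomorphism $\Phi_\infty$.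
   Context: A $3$-Lie algebra over $\mathbb{k}$ is a $\mathbb{k}$-vector space $L$ with a trilinear map $[\cdot,\cdot,\cdot]$ such that $[x_1,x_2,x_3]=\mathrm{sgn}(\sigma)[x_{\sigma(1)},x_{\sigma(2)},x_{\sigma(3)}]$ for every permutation $\sigma$ of $\{1,2,3\}$, and $[[x_1,x_2,x_3],x_4,x_5]=[[x_1,x_4,x_5],x_2,x_3]+[x_1,[x_2,x_4,x_5],x_3]+[x_1,x_2,[x_3,x_4,x_5]]$. Elements of $X=\mathbb{k}\oplus L$ are pairs $(a,x)$; tensor products are over $\mathbb{k}$. $\Delta(a,x)=(a,x)\otimes(1,0)+(1,0)\otimes(0,x)$, and Sweedler notation $(\mathbf 1\otimes\Delta)\Delta(x)=x^{(1)}\otimes x^{(2)}\otimes x^{(3)}$ is used. The linear map $T:X^{\otimes 3}\to X$ is $$T((a,x)\otimes(b,y)\otimes(c,z))=(abc,\ bcx+c[x,y]+b[x,z]+[[x,y],z])\quad\text{if } L \text{ is a Lie algebra},$$ $$T((a,x)\otimes(b,y)\otimes(c,z))=(abc,\ bcx+[x,y,z])\quad\text{if } L\text{ is a }3\text{-Lie algebra}.$$ The linear maps $R:X^{\otimes 2}\otimes X^{\otimes 2}\to X^{\otimes 2}\otimes X^{\otimes 2}$ and $\theta:X^{\otimes 2}\to X^{\otimes 2}$ are $$R(x\otimes y\otimes z\otimes w)= z^{(1)}\otimes w^{(1)}\otimes T(x\otimes z^{(2)}\otimes w^{(2)})\otimes T(y\otimes z^{(3)}\otimes w^{(3)}),$$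 $$\theta(x\otimes y)=T(x^{(1)}\otimes x^{(2)}\otimes y^{(2)})\otimes T(y^{(1)}\otimes x^{(3)}\otimes y^{(3)}).$$ The framed braid group $\mathbb{FB}_n=\mathbb{Z}^n\rtimes\mathbb{B}_n$ is presented by generators $\sigma_1,\dots,\sigma_{n-1},t_1,\dots,t_n$ with relations $\sigma_i\sigma_j=\sigma_j\sigma_i$ for $|i-j|\ge 2$, $\sigma_i\sigma_{i+1}\sigma_i=\sigma_{i+1}\sigma_i\sigma_{i+1}$, $t_it_j=t_jt_i$, and $\sigma_jt_i=t_{\tau_j(i)}\sigma_j$, where $\tau_j$ is the transposition $(j\ j+1)$. $\mathbb{FB}_\infty=\varinjlim_n\mathbb{FB}_n$ along the natural inclusions $\mathbb{FB}_n\hookrightarrow\mathbb{FB}_{n+1}$ ($\sigma_i\mapsto\sigma_i$, $t_i\mapsto t_i$), and $\mathrm{Aut}(X^{\otimes 2n})\hookrightarrow\mathrm{Aut}(X^{\otimes 2(n+1)})$ is tensoring on the right with $\mathbf 1^{\otimes 2}$. *)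

theory Defs
  imports
    Complex_Main
    "HOL-Library.Poly_Mapping"
    "HOL-Library.Product_Plus"
    "HOL-Combinatorics.Permutations"
    "HOL-Algebra.Bij"
begin

section \<open>Tensor powers of a vector space\<close>

text \<open>
  The vector space is the type \<^typ>\<open>'x\<close> with scalar multiplication \<^term>\<open>s\<close>.  All tensor powers
  live in one type: the finitely supported functions on lists form the free vector space on all
  lists over \<^typ>\<open>'x\<close>, and a tensor is a coset of the subspace spanned by the multilinearity
  relations.  These relations are homogeneous in the length of the lists, so the cosets
  represented by combinations of lists of length \<^term>\<open>m\<close> form the usual quotient construction
  of the \<^term>\<open>m\<close>-th tensor power (the degree \<^term>\<open>m\<close> part of the tensor algebra).
\<close>

type_synonym ('x, 'k) formal_tensor = "'x list \<Rightarrow>\<^sub>0 'k"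
type_synonym ('x, 'k) tensor = "('x, 'k) formal_tensor set"

definition formal_scale :: "'k::field \<Rightarrow> ('x, 'k) formal_tensor \<Rightarrow> ('x, 'k) formal_tensor" where
  "formal_scale c f = Poly_Mapping.map ((*) c) f"

definition formal_mult ::
  "('x, 'k::field) formal_tensor \<Rightarrow> ('x, 'k) formal_tensor \<Rightarrow> ('x, 'k) formal_tensor" where
  "formal_mult f g = (\<Sum>xs\<in>Poly_Mapping.keys f. \<Sum>ys\<in>Poly_Mapping.keys g.
     Poly_Mapping.single (xs @ ys) (Poly_Mapping.lookup f xs * Poly_Mapping.lookup g ys))"

context
  fixes s :: "'k::field \<Rightarrow> 'x::ab_group_add \<Rightarrow> 'x"
begin

definition multilinearity_relations :: "('x, 'k) formal_tensor set" where
  "multilinearity_relations =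
     {Poly_Mapping.single (us @ [x + y] @ vs) 1
        - Poly_Mapping.single (us @ [x] @ vs) 1 - Poly_Mapping.single (us @ [y] @ vs) 1
      | us x y vs. True} \<union>
     {Poly_Mapping.single (us @ [s c x] @ vs) 1 - Poly_Mapping.single (us @ [x] @ vs) c
      | us c x vs. True}"

definition null_tensors :: "('x, 'k) formal_tensor set" where
  "null_tensors = module.span formal_scale multilinearity_relations"

definition tensor_class :: "('x, 'k) formal_tensor \<Rightarrow> ('x, 'k) tensor" where
  "tensor_class f = {g. g - f \<in> null_tensors}"

definition tensor_power :: "nat \<Rightarrow> ('x, 'k) tensor set" where
  "tensor_power m =
     tensor_class ` {f. Poly_Mapping.keys f \<subseteq> {xs. length xs = m}}"

text \<open>\<open>pure [x\<^sub>1, \<dots>, x\<^sub>m]\<close> is the tensor \<open>x\<^sub>1 \<otimes> \<dots> \<otimes> x\<^sub>m\<close>.\<close>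

definition pure :: "'x list \<Rightarrow> ('x, 'k) tensor" where
  "pure xs = tensor_class (Poly_Mapping.single xs 1)"

definition tensor_add :: "('x, 'k) tensor \<Rightarrow> ('x, 'k) tensor \<Rightarrow> ('x, 'k) tensor" where
  "tensor_add A B = (\<Union>f\<in>A. \<Union>g\<in>B. tensor_class (f + g))"

definition tensor_scale :: "'k \<Rightarrow> ('x, 'k) tensor \<Rightarrow> ('x, 'k) tensor" where
  "tensor_scale c A = (\<Union>f\<in>A. tensor_class (formal_scale c f))"

text \<open>The canonical pairing of the \<open>m\<close>-th and the \<open>n\<close>-th tensor power into the \<open>(m + n)\<close>-th.\<close>

definition tensor_mult :: "('x, 'k) tensor \<Rightarrow> ('x, 'k) tensor \<Rightarrow> ('x, 'k) tensor" where
  "tensor_mult A B = (\<Union>f\<in>A. \<Union>g\<in>B. tensor_class (formal_mult f g))"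

definition tensor_linear :: "nat \<Rightarrow> (('x, 'k) tensor \<Rightarrow> ('x, 'k) tensor) \<Rightarrow> bool" where
  "tensor_linear m f \<longleftrightarrow>
     (\<forall>u\<in>tensor_power m. \<forall>v\<in>tensor_power m. f (tensor_add u v) = tensor_add (f u) (f v)) \<and>
     (\<forall>c. \<forall>u\<in>tensor_power m. f (tensor_scale c u) = tensor_scale c (f u))"

text \<open>
  The linear map on the \<open>m\<close>-th tensor power with \<open>x\<^sub>1 \<otimes> \<dots> \<otimes> x\<^sub>m \<mapsto> \<phi> [x\<^sub>1, \<dots>, x\<^sub>m]\<close>.  It exists
  and is unique for multilinear \<^term>\<open>\<phi>\<close>, see \<open>tensor_lift_pure\<close> and \<open>tensor_lift_unique\<close> below.
\<close>

definition tensor_lift ::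
  "nat \<Rightarrow> ('x list \<Rightarrow> ('x, 'k) tensor) \<Rightarrow> ('x, 'k) tensor \<Rightarrow> ('x, 'k) tensor" where
  "tensor_lift m \<phi> = (THE f. f \<in> extensional (tensor_power m) \<and> tensor_linear m f \<and>
     (\<forall>xs. length xs = m \<longrightarrow> f (pure xs) = \<phi> xs))"

text \<open>\<open>f \<otimes> g\<close> for linear maps \<open>f\<close>, \<open>g\<close> on the \<open>m\<close>-th and on the \<open>n\<close>-th tensor power.\<close>

definition tensor_map ::
  "nat \<Rightarrow> nat \<Rightarrow> (('x, 'k) tensor \<Rightarrow> ('x, 'k) tensor) \<Rightarrow> (('x, 'k) tensor \<Rightarrow> ('x, 'k) tensor)
    \<Rightarrow> ('x, 'k) tensor \<Rightarrow> ('x, 'k) tensor" where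
  "tensor_map m n f g =
     tensor_lift (m + n) (\<lambda>xs. tensor_mult (f (pure (take m xs))) (g (pure (drop m xs))))"

text \<open>\<open>1\<^sup>\<otimes>\<^sup>a \<otimes> f \<otimes> 1\<^sup>\<otimes>\<^sup>b\<close> for a linear map \<open>f\<close> on the \<open>m\<close>-th tensor power.\<close>

definition tensor_pad ::
  "nat \<Rightarrow> nat \<Rightarrow> (('x, 'k) tensor \<Rightarrow> ('x, 'k) tensor) \<Rightarrow> nat
    \<Rightarrow> ('x, 'k) tensor \<Rightarrow> ('x, 'k) tensor" where
  "tensor_pad a m f b = tensor_map (a + m) b (tensor_map a m id f) id"

definition tensor_Aut :: "nat \<Rightarrow> (('x, 'k) tensor \<Rightarrow> ('x, 'k) tensor) monoid" where
  "tensor_Aut m = BijGroup (tensor_power m)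
     \<lparr>carrier := {f \<in> Bij (tensor_power m). tensor_linear m f}\<rparr>"

end

subsection \<open>Existence and uniqueness of the induced linear maps\<close>

lemma lookup_formal_scale: "Poly_Mapping.lookup (formal_scale c f) xs = c * Poly_Mapping.lookup f xs"
  by (simp add: formal_scale_def Poly_Mapping.map.rep_eq when_def)

lemma vector_space_formal_scale: "vector_space formal_scale"
  by unfold_locales
    (auto intro!: poly_mapping_eqI simp: lookup_formal_scale lookup_add algebra_simps)

lemma formal_tensor_expand:
  assumes "finite S" "Poly_Mapping.keys f \<subseteq> S"
  shows "f = (\<Sum>xs\<in>S. formal_scale (Poly_Mapping.lookup f xs) (Poly_Mapping.single xs 1))"
proof (rule poly_mapping_eqI)
  fix ys
  have "Poly_Mapping.lookup (\<Sum>xs\<in>S. formal_scale (Poly_Mapping.lookup f xs) (Poly_Mapping.single xs 1)) ys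
    = (\<Sum>xs\<in>S. if xs = ys then Poly_Mapping.lookup f ys else 0)"
    by (simp add: lookup_sum lookup_formal_scale lookup_single when_def if_distrib cong: if_cong) 
  also have "\<dots> = Poly_Mapping.lookup f ys"
    using assms by (auto simp: in_keys_iff)
  finally show "Poly_Mapping.lookup f ys = Poly_Mapping.lookup
      (\<Sum>xs\<in>S. formal_scale (Poly_Mapping.lookup f xs) (Poly_Mapping.single xs 1)) ys"
    by simp
qed

definition formal_extend ::
  "('x list \<Rightarrow> ('y, 'k::field) formal_tensor) \<Rightarrow> ('x, 'k) formal_tensor \<Rightarrow> ('y, 'k) formal_tensor" where
  "formal_extend \<rho> f =
     (\<Sum>xs\<in>Poly_Mapping.keys f. formal_scale (Poly_Mapping.lookup f xs) (\<rho> xs))"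

lemma formal_extend_superset:
  assumes "finite S" "Poly_Mapping.keys f \<subseteq> S"
  shows "formal_extend \<rho> f = (\<Sum>xs\<in>S. formal_scale (Poly_Mapping.lookup f xs) (\<rho> xs))"
  unfolding formal_extend_def
  by (rule sum.mono_neutral_left)
    (use assms in \<open>auto simp: in_keys_iff lookup_formal_scale intro!: poly_mapping_eqI\<close>)

lemma linear_formal_extend:
  fixes \<rho> :: "'x list \<Rightarrow> ('y, 'k::field) formal_tensor"
  shows "Vector_Spaces.linear formal_scale formal_scale (formal_extend \<rho>)"
proof -
  interpret X: vector_space "formal_scale :: 'k \<Rightarrow> ('x, 'k) formal_tensor \<Rightarrow> _"
    by (rule vector_space_formal_scale)
  interpret formal: vector_space "formal_scale :: 'k \<Rightarrow> ('y, 'k) formal_tensor \<Rightarrow> _"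
    by (rule vector_space_formal_scale)
  show ?thesis
  proof (unfold_locales)
    fix f g :: "('x, 'k) formal_tensor" and c :: 'k
    let ?S = "Poly_Mapping.keys f \<union> Poly_Mapping.keys g"
    have "Poly_Mapping.keys (f + g) \<subseteq> ?S" by (rule keys_add)
    then show "formal_extend \<rho> (f + g) = formal_extend \<rho> f + formal_extend \<rho> g"
      by (simp add: formal_extend_superset[of ?S] lookup_add formal.scale_left_distrib sum.distrib)
    have "Poly_Mapping.keys (formal_scale c f) \<subseteq> Poly_Mapping.keys f"
      by (auto simp: in_keys_iff lookup_formal_scale)
    then show "formal_extend \<rho> (formal_scale c f) = formal_scale c (formal_extend \<rho> f)"
      by (simp add: formal_extend_superset[of "Poly_Mapping.keys f"] lookup_formal_scale
          formal.scale_sum_right)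
  qed
qed

lemma formal_extend_single: "formal_extend \<rho> (Poly_Mapping.single xs c) = formal_scale c (\<rho> xs)"
  by (subst formal_extend_superset[of "{xs}"]) auto

context
  fixes s :: "'k::field \<Rightarrow> 'x::ab_group_add \<Rightarrow> 'x"
begin

interpretation formal: vector_space "formal_scale :: 'k \<Rightarrow> ('x, 'k) formal_tensor \<Rightarrow> _"
  by (rule vector_space_formal_scale)

lemma null_add: "f \<in> null_tensors s \<Longrightarrow> g \<in> null_tensors s \<Longrightarrow> f + g \<in> null_tensors s"
  unfolding null_tensors_def by (rule formal.span_add)

lemma null_diff: "f \<in> null_tensors s \<Longrightarrow> g \<in> null_tensors s \<Longrightarrow> f - g \<in> null_tensors s"
  unfolding null_tensors_def by (rule formal.span_diff)

lemma null_scale: "f \<in> null_tensors s \<Longrightarrow> formal_scale c f \<in> null_tensors s"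
  unfolding null_tensors_def by (rule formal.span_scale)

lemma null_zero: "0 \<in> null_tensors s"
  unfolding null_tensors_def by (rule formal.span_zero)

lemma tensor_class_eq_iff: "tensor_class s f = tensor_class s g \<longleftrightarrow> f - g \<in> null_tensors s"
proof
  assume *: "tensor_class s f = tensor_class s g"
  have "f \<in> tensor_class s f" by (simp add: tensor_class_def null_zero)
  then have "f \<in> tensor_class s g" by (simp only: *)
  then show "f - g \<in> null_tensors s" by (simp add: tensor_class_def)
next
  assume *: "f - g \<in> null_tensors s"
  have "h - f \<in> null_tensors s \<longleftrightarrow> h - g \<in> null_tensors s" for h
  proof
    show "h - g \<in> null_tensors s" if "h - f \<in> null_tensors s"
      using null_add[OF that *] by simp
    show "h - f \<in> null_tensors s" if "h - g \<in> null_tensors s"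
      using null_diff[OF that *] by simp
  qed
  then show "tensor_class s f = tensor_class s g" by (simp add: tensor_class_def)
qed

lemma tensor_class_self: "f \<in> tensor_class s f"
  by (simp add: tensor_class_def null_zero)

lemma tensor_class_of_mem: "g \<in> tensor_class s f \<Longrightarrow> tensor_class s g = tensor_class s f"
  by (simp add: tensor_class_eq_iff) (simp add: tensor_class_def)

lemma tensor_add_class: "tensor_add s (tensor_class s f) (tensor_class s g) = tensor_class s (f + g)"
proof -
  have "tensor_class s (f' + g') = tensor_class s (f + g)"
    if "f' \<in> tensor_class s f" "g' \<in> tensor_class s g" for f' g'
    using null_add[of "f' - f" "g' - g"] that
    by (simp add: tensor_class_eq_iff) (simp add: tensor_class_def algebra_simps)
  then have "tensor_add s (tensor_class s f) (tensor_class s g)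
      = (\<Union>f'\<in>tensor_class s f. \<Union>g'\<in>tensor_class s g. tensor_class s (f + g))"
    unfolding tensor_add_def by (intro SUP_cong HOL.refl)
  then show ?thesis using tensor_class_self[of f] tensor_class_self[of g] by auto
qed

lemma tensor_scale_class: "tensor_scale s c (tensor_class s f) = tensor_class s (formal_scale c f)"
proof -
  have "tensor_class s (formal_scale c f') = tensor_class s (formal_scale c f)"
    if "f' \<in> tensor_class s f" for f'
    using null_scale[of "f' - f" c] that
    by (simp add: tensor_class_eq_iff) (simp add: tensor_class_def formal.scale_right_diff_distrib)
  then have "tensor_scale s c (tensor_class s f)
      = (\<Union>f'\<in>tensor_class s f. tensor_class s (formal_scale c f))"
    unfolding tensor_scale_def by (intro SUP_cong HOL.refl)
  then show ?thesis using tensor_class_self[of f] by auto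
qed

definition multilinear :: "nat \<Rightarrow> ('x list \<Rightarrow> ('x, 'k) tensor) \<Rightarrow> bool" where
  "multilinear m \<phi> \<longleftrightarrow>
     (\<forall>us vs x y. length us + length vs + 1 = m \<longrightarrow>
        \<phi> (us @ [x + y] @ vs) = tensor_add s (\<phi> (us @ [x] @ vs)) (\<phi> (us @ [y] @ vs))) \<and>
     (\<forall>us vs c x. length us + length vs + 1 = m \<longrightarrow>
        \<phi> (us @ [s c x] @ vs) = tensor_scale s c (\<phi> (us @ [x] @ vs)))"

lemma tensor_power_induct [consumes 1, case_names zero step]:
  assumes "u \<in> tensor_power s m"
    and "P (tensor_class s 0)"
    and "\<And>c xs u. length xs = m \<Longrightarrow> u \<in> tensor_power s m \<Longrightarrow> P u \<Longrightarrow>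
      P (tensor_add s (tensor_scale s c (pure s xs)) u)"
  shows "P u"
proof -
  obtain f where u: "u = tensor_class s f" and f: "Poly_Mapping.keys f \<subseteq> {xs. length xs = m}"
    using assms(1) by (auto simp: tensor_power_def)
  have sub: "Poly_Mapping.keys
      (\<Sum>xs\<in>S. formal_scale (Poly_Mapping.lookup f xs) (Poly_Mapping.single xs 1)) \<subseteq> S"
    if "finite S" for S
  proof
    fix ys assume "ys \<in> Poly_Mapping.keys
      (\<Sum>xs\<in>S. formal_scale (Poly_Mapping.lookup f xs) (Poly_Mapping.single xs 1))"
    then have "(\<Sum>xs\<in>S. Poly_Mapping.lookup f xs * (1 when xs = ys)) \<noteq> 0"
      by (simp add: in_keys_iff lookup_sum lookup_formal_scale lookup_single)
    then obtain xs where "xs \<in> S" "Poly_Mapping.lookup f xs * (1 when xs = ys) \<noteq> 0"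
      by (rule sum.not_neutral_contains_not_neutral)
    then show "ys \<in> S" by (cases "xs = ys") auto
  qed
  have "P (tensor_class s (\<Sum>xs\<in>S. formal_scale (Poly_Mapping.lookup f xs) (Poly_Mapping.single xs 1)))"
    if "finite S" "S \<subseteq> {xs. length xs = m}" for S
    using that
  proof (induction S)
    case empty
    then show ?case using assms(2) by simp
  next
    case (insert xs S)
    then have "tensor_class s (\<Sum>xs\<in>S. formal_scale (Poly_Mapping.lookup f xs) (Poly_Mapping.single xs 1))
      \<in> tensor_power s m"
      unfolding tensor_power_def using sub[of S] by blast
    from assms(3)[OF _ this] insert show ?case
      by (simp add: pure_def tensor_scale_class tensor_add_class)
  qed
  from this[of "Poly_Mapping.keys f"] f show ?thesis
    unfolding u using formal_tensor_expand[of "Poly_Mapping.keys f" f] by simp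
qed

lemma pure_in_tensor_power: "length xs = m \<Longrightarrow> pure s xs \<in> tensor_power s m"
  unfolding pure_def tensor_power_def by (intro imageI) auto

lemma tensor_add_in: 
  assumes "u \<in> tensor_power s m" "v \<in> tensor_power s m"
  shows "tensor_add s u v \<in> tensor_power s m"
proof -
  obtain f g where "u = tensor_class s f" "v = tensor_class s g" "Poly_Mapping.keys f \<subseteq> {xs. length xs = m}"
      "Poly_Mapping.keys g \<subseteq> {xs. length xs = m}"
    using assms by (auto simp: tensor_power_def)
  then show ?thesis
    using keys_add[of f g] by (auto simp: tensor_add_class tensor_power_def intro!: imageI)
qed

lemma tensor_scale_in: 
  assumes "u \<in> tensor_power s m"
  shows "tensor_scale s c u \<in> tensor_power s m"
proof -
  obtain f where "u = tensor_class s f" "Poly_Mapping.keys f \<subseteq> {xs. length xs = m}"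
    using assms by (auto simp: tensor_power_def)
  then show ?thesis
    by (auto simp: tensor_scale_class tensor_power_def in_keys_iff lookup_formal_scale intro!: imageI)
qed

lemma tensor_linear_zero:
  assumes "tensor_linear s m f"
  shows "f (tensor_class s 0) = tensor_scale s 0 (f (pure s (replicate m 0)))"
proof -
  have "tensor_class s 0 = tensor_scale s 0 (pure s (replicate m 0))"
    by (simp add: pure_def tensor_scale_class)
  then show ?thesis
    using assms pure_in_tensor_power[of "replicate m 0" m] by (simp add: tensor_linear_def)
qed

lemma tensor_lift_unique:
  assumes f: "tensor_linear s m f" and g: "tensor_linear s m g"
    and pure: "\<And>xs. length xs = m \<Longrightarrow> f (pure s xs) = g (pure s xs)"
    and u: "u \<in> tensor_power s m"
  shows "f u = g u"
  using u
proof (induction rule: tensor_power_induct)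
  case zero
  show ?case using pure by (simp add: tensor_linear_zero[OF f] tensor_linear_zero[OF g])
next
  case (step c xs u)
  have p: "pure s xs \<in> tensor_power s m" by (rule pure_in_tensor_power[OF step(1)])
  have q: "tensor_scale s c (pure s xs) \<in> tensor_power s m" by (rule tensor_scale_in[OF p])
  from f g p q step pure show ?case
    by (simp add: tensor_linear_def)
qed

lemma tensor_lift_exists:
  assumes \<phi>: "multilinear m \<phi>" and range: "\<And>xs. length xs = m \<Longrightarrow> \<phi> xs \<in> range (tensor_class s)"
  shows "\<exists>f. f \<in> extensional (tensor_power s m) \<and> tensor_linear s m f \<and>
     (\<forall>xs. length xs = m \<longrightarrow> f (pure s xs) = \<phi> xs)"
proof -
  define \<rho> where "\<rho> xs = (if length xs = m then (SOME f. \<phi> xs = tensor_class s f) else 0)" for xs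
  have \<rho>: "\<phi> xs = tensor_class s (\<rho> xs)" if "length xs = m" for xs
    using someI_ex[of "\<lambda>f. \<phi> xs = tensor_class s f"] range[OF that] that by (auto simp: \<rho>_def)
  have \<rho>0: "\<rho> xs = 0" if "length xs \<noteq> m" for xs using that by (simp add: \<rho>_def)
  interpret ext: Vector_Spaces.linear formal_scale formal_scale "formal_extend \<rho>"
    by (rule linear_formal_extend)
  have null: "formal_extend \<rho> h \<in> null_tensors s" if "h \<in> null_tensors s" for h
    using that unfolding null_tensors_def[of s]
  proof (induction rule: formal.span_induct_alt)
    case base
    then show ?case by (simp add: formal.span_zero)
  next
    case (step c r h)
    have "formal_extend \<rho> r \<in> null_tensors s"
      using step(1) unfolding multilinearity_relations_def
    proof (elim UnE CollectE exE conjE)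
      fix us vs :: "'x list" and x y :: 'x
      assume r: "r = Poly_Mapping.single (us @ [x + y] @ vs) 1
        - Poly_Mapping.single (us @ [x] @ vs) 1 - Poly_Mapping.single (us @ [y] @ vs) 1"
      have e: "formal_extend \<rho> r = \<rho> (us @ [x + y] @ vs) - (\<rho> (us @ [x] @ vs) + \<rho> (us @ [y] @ vs))"
        unfolding r by (simp only: ext.diff formal_extend_single formal.scale_one) simp
      show ?thesis
      proof (cases "length us + length vs + 1 = m")
        case True
        then have "\<phi> (us @ [x + y] @ vs) = tensor_add s (\<phi> (us @ [x] @ vs)) (\<phi> (us @ [y] @ vs))"
          using \<phi> unfolding multilinear_def by blast
        then show ?thesis using True unfolding e
          by (simp add: \<rho> tensor_add_class tensor_class_eq_iff)
      next
        case False
        then show ?thesis unfolding e by (simp add: \<rho>0 null_zero)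
      qed
    next
      fix us vs :: "'x list" and c :: 'k and x :: 'x
      assume r: "r = Poly_Mapping.single (us @ [s c x] @ vs) 1 - Poly_Mapping.single (us @ [x] @ vs) c"
      have e: "formal_extend \<rho> r = \<rho> (us @ [s c x] @ vs) - formal_scale c (\<rho> (us @ [x] @ vs))"
        unfolding r by (simp only: ext.diff formal_extend_single formal.scale_one)
      show ?thesis
      proof (cases "length us + length vs + 1 = m")
        case True
        then have "\<phi> (us @ [s c x] @ vs) = tensor_scale s c (\<phi> (us @ [x] @ vs))"
          using \<phi> unfolding multilinear_def by blast
        then show ?thesis using True unfolding e
          by (simp add: \<rho> tensor_scale_class tensor_class_eq_iff)
      next
        case False
        then show ?thesis unfolding e by (simp add: \<rho>0 null_zero)
      qed
    qed
    then show ?case using step(2)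
      by (simp add: ext.add ext.scale null_tensors_def formal.span_add formal.span_scale)
  qed
  define F where "F u = tensor_class s (formal_extend \<rho> (SOME f. u = tensor_class s f))" for u
  have F: "F (tensor_class s f) = tensor_class s (formal_extend \<rho> f)" for f
  proof -
    have "tensor_class s f = tensor_class s (SOME g. tensor_class s f = tensor_class s g)"
      by (rule someI_ex[where P = "\<lambda>g. tensor_class s f = tensor_class s g"]) blast
    then have "formal_extend \<rho> ((SOME g. tensor_class s f = tensor_class s g) - f) \<in> null_tensors s"
      by (metis null tensor_class_eq_iff)
    then show ?thesis by (simp add: F_def tensor_class_eq_iff ext.diff)
  qed
  have "tensor_linear s m (restrict F (tensor_power s m))"
    unfolding tensor_linear_def
  proof (intro conjI ballI allI)
    fix u v c assume u: "u \<in> tensor_power s m"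
    obtain f where f: "u = tensor_class s f" using u by (auto simp: tensor_power_def)
    show "restrict F (tensor_power s m) (tensor_scale s c u)
        = tensor_scale s c (restrict F (tensor_power s m) u)"
      using u tensor_scale_in[OF u, of c] by (simp add: f tensor_scale_class F ext.scale)
    assume v: "v \<in> tensor_power s m"
    obtain g where g: "v = tensor_class s g" using v by (auto simp: tensor_power_def)
    show "restrict F (tensor_power s m) (tensor_add s u v)
        = tensor_add s (restrict F (tensor_power s m) u) (restrict F (tensor_power s m) v)"
      using u v tensor_add_in[OF u v] by (simp add: f g tensor_add_class F ext.add)
  qed
  moreover have "restrict F (tensor_power s m) (pure s xs) = \<phi> xs" if "length xs = m" for xs
    using that pure_in_tensor_power[OF that] \<rho>[OF that]
    by (simp add: pure_def F formal_extend_single)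
  ultimately show ?thesis by (intro exI[of _ "restrict F (tensor_power s m)"]) auto
qed

lemma
  assumes \<phi>: "multilinear m \<phi>" and range: "\<And>xs. length xs = m \<Longrightarrow> \<phi> xs \<in> range (tensor_class s)"
  shows tensor_lift_extensional: "tensor_lift s m \<phi> \<in> extensional (tensor_power s m)"
    and tensor_lift_linear: "tensor_linear s m (tensor_lift s m \<phi>)"
    and tensor_lift_pure: "length xs = m \<Longrightarrow> tensor_lift s m \<phi> (pure s xs) = \<phi> xs"
proof -
  let ?P = "\<lambda>f. f \<in> extensional (tensor_power s m) \<and> tensor_linear s m f \<and>
     (\<forall>xs. length xs = m \<longrightarrow> f (pure s xs) = \<phi> xs)"
  obtain f where f: "?P f" using tensor_lift_exists[OF assms] by blast
  have "g = f" if g: "?P g" for g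
  proof (rule extensionalityI[of _ "tensor_power s m"])
    show "g u = f u" if "u \<in> tensor_power s m" for u
      by (rule tensor_lift_unique[OF _ _ _ that]) (use f g in auto)
  qed (use f g in auto)
  then have "?P (tensor_lift s m \<phi>)"
    unfolding tensor_lift_def using f theI[of ?P f] by blast
  then show "tensor_lift s m \<phi> \<in> extensional (tensor_power s m)"
    and "tensor_linear s m (tensor_lift s m \<phi>)"
    and "length xs = m \<Longrightarrow> tensor_lift s m \<phi> (pure s xs) = \<phi> xs"
    by blast+
qed

end

section \<open>The coalgebra X and the maps T, R, \<open>\<theta>\<close>\<close>

locale lie_algebra = vector_space scale
  for scale :: "'k::field \<Rightarrow> 'l::ab_group_add \<Rightarrow> 'l" +
  fixes bracket :: "'l \<Rightarrow> 'l \<Rightarrow> 'l"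
  assumes linear_1: "Vector_Spaces.linear scale scale (\<lambda>x. bracket x y)"
    and linear_2: "Vector_Spaces.linear scale scale (\<lambda>y. bracket x y)"
    and alternating: "bracket x x = 0"
    and jacobi: "bracket x (bracket y z) + bracket y (bracket z x) + bracket z (bracket x y) = 0"

locale three_lie_algebra = vector_space scale
  for scale :: "'k::field \<Rightarrow> 'l::ab_group_add \<Rightarrow> 'l" +
  fixes bracket :: "'l \<Rightarrow> 'l \<Rightarrow> 'l \<Rightarrow> 'l"
  assumes linear_1: "Vector_Spaces.linear scale scale (\<lambda>x. bracket x y z)"
    and linear_2: "Vector_Spaces.linear scale scale (\<lambda>y. bracket x y z)"
    and linear_3: "Vector_Spaces.linear scale scale (\<lambda>z. bracket x y z)"
    and skew: "\<sigma> permutes {1, 2, 3 :: nat} \<Longrightarrow>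
      bracket (v 1) (v 2) (v 3)
        = scale (of_int (sign \<sigma>)) (bracket (v (\<sigma> 1)) (v (\<sigma> 2)) (v (\<sigma> 3)))"
    and fundamental_identity:
      "bracket (bracket x1 x2 x3) x4 x5
        = bracket (bracket x1 x4 x5) x2 x3 + bracket x1 (bracket x2 x4 x5) x3
          + bracket x1 x2 (bracket x3 x4 x5)"

text \<open>
  A linear map from the third tensor power of X to X is given as the trilinear map
  \<open>(x, y, z) \<mapsto> T (x \<otimes> y \<otimes> z)\<close>.
\<close>

type_synonym ('k, 'l) trilinear = "'k \<times> 'l \<Rightarrow> 'k \<times> 'l \<Rightarrow> 'k \<times> 'l \<Rightarrow> 'k \<times> 'l"

context
  fixes scale :: "'k::field \<Rightarrow> 'l::ab_group_add \<Rightarrow> 'l"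
begin

definition X_scale :: "'k \<Rightarrow> 'k \<times> 'l \<Rightarrow> 'k \<times> 'l" where
  "X_scale c = (\<lambda>(a, x). (c * a, scale c x))"

definition T_lie :: "('l \<Rightarrow> 'l \<Rightarrow> 'l) \<Rightarrow> ('k, 'l) trilinear" where
  "T_lie br = (\<lambda>(a, x) (b, y) (c, z).
     (a * b * c, scale (b * c) x + scale c (br x y) + scale b (br x z) + br (br x y) z))"

definition T_three_lie :: "('l \<Rightarrow> 'l \<Rightarrow> 'l \<Rightarrow> 'l) \<Rightarrow> ('k, 'l) trilinear" where
  "T_three_lie br = (\<lambda>(a, x) (b, y) (c, z). (a * b * c, scale (b * c) x + br x y z))"

definition comult :: "'k \<times> 'l \<Rightarrow> ('k \<times> 'l, 'k) tensor" where
  "comult = (\<lambda>(a, x). tensor_add X_scale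
     (pure X_scale [(a, x), (1, 0)]) (pure X_scale [(1, 0), (0, x)]))"

definition comult2 :: "'k \<times> 'l \<Rightarrow> ('k \<times> 'l, 'k) tensor" where
  "comult2 x = tensor_lift X_scale 2
     (\<lambda>xs. tensor_mult X_scale (pure X_scale [xs ! 0]) (comult (xs ! 1))) (comult x)"

text \<open>
  \<open>sweedler x \<phi>\<close> is \<open>\<phi> x\<^sup>(\<^sup>1\<^sup>) x\<^sup>(\<^sup>2\<^sup>) x\<^sup>(\<^sup>3\<^sup>)\<close> in Sweedler notation, i.e. the linear map induced by the
  trilinear \<open>\<phi>\<close> applied to \<open>(1 \<otimes> \<Delta>) (\<Delta> x)\<close>.
\<close>

definition sweedler ::
  "'k \<times> 'l \<Rightarrow> ('k \<times> 'l \<Rightarrow> 'k \<times> 'l \<Rightarrow> 'k \<times> 'l \<Rightarrow> ('k \<times> 'l, 'k) tensor) \<Rightarrow> ('k \<times> 'l, 'k) tensor"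
  where
  "sweedler x \<phi> = tensor_lift X_scale 3 (\<lambda>xs. \<phi> (xs ! 0) (xs ! 1) (xs ! 2)) (comult2 x)"

definition R_map ::
  "('k, 'l) trilinear \<Rightarrow> ('k \<times> 'l, 'k) tensor \<Rightarrow> ('k \<times> 'l, 'k) tensor" where
  "R_map T = tensor_lift X_scale 4 (\<lambda>xs.
     let x = xs ! 0; y = xs ! 1; z = xs ! 2; w = xs ! 3 in
       sweedler z (\<lambda>z1 z2 z3. sweedler w (\<lambda>w1 w2 w3.
         pure X_scale [z1, w1, T x z2 w2, T y z3 w3])))"

definition theta_map ::
  "('k, 'l) trilinear \<Rightarrow> ('k \<times> 'l, 'k) tensor \<Rightarrow> ('k \<times> 'l, 'k) tensor" where
  "theta_map T = tensor_lift X_scale 2 (\<lambda>xs.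
     let x = xs ! 0; y = xs ! 1 in
       sweedler x (\<lambda>x1 x2 x3. sweedler y (\<lambda>y1 y2 y3.
         pure X_scale [T x1 x2 y2, T y1 x3 y3])))"

definition Aut_X :: "nat \<Rightarrow> (('k \<times> 'l, 'k) tensor \<Rightarrow> ('k \<times> 'l, 'k) tensor) monoid" where
  "Aut_X n = tensor_Aut X_scale (2 * n)"

text \<open>The proposed images of the generators and the map \<open>f \<mapsto> f \<otimes> 1\<^sup>\<otimes>\<^sup>2\<close>.\<close>

definition sigma_image ::
  "('k, 'l) trilinear \<Rightarrow> nat \<Rightarrow> nat \<Rightarrow> ('k \<times> 'l, 'k) tensor \<Rightarrow> ('k \<times> 'l, 'k) tensor" where
  "sigma_image T n i = tensor_pad X_scale (2 * i - 2) 4 (R_map T) (2 * n - 2 * i - 2)"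

definition twist_image ::
  "('k, 'l) trilinear \<Rightarrow> nat \<Rightarrow> nat \<Rightarrow> ('k \<times> 'l, 'k) tensor \<Rightarrow> ('k \<times> 'l, 'k) tensor" where
  "twist_image T n i = tensor_pad X_scale (2 * i - 2) 2 (theta_map T) (2 * n - 2 * i)"

definition Aut_incl ::
  "nat \<Rightarrow> (('k \<times> 'l, 'k) tensor \<Rightarrow> ('k \<times> 'l, 'k) tensor)
    \<Rightarrow> ('k \<times> 'l, 'k) tensor \<Rightarrow> ('k \<times> 'l, 'k) tensor" where
  "Aut_incl n f = tensor_map X_scale (2 * n) 2 f id"

end

section \<open>Group presentations\<close>

text \<open>
  A word is a list of letters \<open>(e, g)\<close>, where \<open>(True, g)\<close> stands for the generator \<open>g\<close> and
  \<open>(False, g)\<close> for its formal inverse.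
\<close>

type_synonym 'g word = "(bool \<times> 'g) list"

definition words :: "'g set \<Rightarrow> 'g word set" where
  "words S = lists (UNIV \<times> S)"

inductive_set word_rel :: "'g set \<Rightarrow> ('g word \<times> 'g word) set \<Rightarrow> ('g word \<times> 'g word) set"
  for S :: "'g set" and Q :: "('g word \<times> 'g word) set" where
  refl: "u \<in> words S \<Longrightarrow> (u, u) \<in> word_rel S Q"
| sym: "(u, v) \<in> word_rel S Q \<Longrightarrow> (v, u) \<in> word_rel S Q"
| trans: "(u, v) \<in> word_rel S Q \<Longrightarrow> (v, w) \<in> word_rel S Q \<Longrightarrow> (u, w) \<in> word_rel S Q"
| congr: "(u, v) \<in> word_rel S Q \<Longrightarrow> p \<in> words S \<Longrightarrow> q \<in> words S
    \<Longrightarrow> (p @ u @ q, p @ v @ q) \<in> word_rel S Q"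
| cancel: "g \<in> S \<Longrightarrow> ([(e, g), (\<not> e, g)], []) \<in> word_rel S Q"
| relation: "(u, v) \<in> Q \<Longrightarrow> u \<in> words S \<Longrightarrow> v \<in> words S \<Longrightarrow> (u, v) \<in> word_rel S Q"

definition presented_group :: "'g set \<Rightarrow> ('g word \<times> 'g word) set \<Rightarrow> 'g word set monoid" where
  "presented_group S Q =
     \<lparr>carrier = words S // word_rel S Q,
      mult = (\<lambda>A B. \<Union>u\<in>A. \<Union>v\<in>B. word_rel S Q `` {u @ v}),
      one = word_rel S Q `` {[]}\<rparr>"

section \<open>Sequential colimits of groups\<close>

fun transition :: "(nat \<Rightarrow> 'a \<Rightarrow> 'a) \<Rightarrow> nat \<Rightarrow> nat \<Rightarrow> 'a \<Rightarrow> 'a" where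
  "transition \<iota> m 0 x = x"
| "transition \<iota> m (Suc d) x = \<iota> (m + d) (transition \<iota> m d x)"

text \<open>Here \<open>\<iota> n\<close> maps \<open>G n\<close> to \<open>G (Suc n)\<close>, so \<open>transition \<iota> m d\<close> maps \<open>G m\<close> to \<open>G (m + d)\<close>.\<close>

definition colimit_rel ::
  "(nat \<Rightarrow> 'a monoid) \<Rightarrow> (nat \<Rightarrow> 'a \<Rightarrow> 'a) \<Rightarrow> ((nat \<times> 'a) \<times> (nat \<times> 'a)) set" where
  "colimit_rel G \<iota> = {((m, x), (n, y)). x \<in> carrier (G m) \<and> y \<in> carrier (G n) \<and>
     (\<exists>k. m \<le> k \<and> n \<le> k \<and> transition \<iota> m (k - m) x = transition \<iota> n (k - n) y)}"

definition colimit_in ::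
  "(nat \<Rightarrow> 'a monoid) \<Rightarrow> (nat \<Rightarrow> 'a \<Rightarrow> 'a) \<Rightarrow> nat \<Rightarrow> 'a \<Rightarrow> (nat \<times> 'a) set" where
  "colimit_in G \<iota> n x = colimit_rel G \<iota> `` {(n, x)}"

definition colimit_group ::
  "(nat \<Rightarrow> 'a monoid) \<Rightarrow> (nat \<Rightarrow> 'a \<Rightarrow> 'a) \<Rightarrow> (nat \<times> 'a) set monoid" where
  "colimit_group G \<iota> =
     \<lparr>carrier = (SIGMA n:UNIV. carrier (G n)) // colimit_rel G \<iota>,
      mult = (\<lambda>A B. \<Union>(m, x)\<in>A. \<Union>(n, y)\<in>B.
        colimit_in G \<iota> (max m n)
          (transition \<iota> m (max m n - m) x \<otimes>\<^bsub>G (max m n)\<^esub> transition \<iota> n (max m n - n) y)),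
      one = colimit_in G \<iota> 0 \<one>\<^bsub>G 0\<^esub>\<rparr>"

section \<open>Framed braid groups\<close>

datatype fb_gen = Sigma nat | Twist nat

definition fb_gens :: "nat \<Rightarrow> fb_gen set" where
  "fb_gens n = Sigma ` {1..<n} \<union> Twist ` {1..n}"

abbreviation sigma_word :: "nat \<Rightarrow> fb_gen word" where
  "sigma_word i \<equiv> [(True, Sigma i)]"

abbreviation twist_word :: "nat \<Rightarrow> fb_gen word" where
  "twist_word i \<equiv> [(True, Twist i)]"

definition fb_relations :: "nat \<Rightarrow> (fb_gen word \<times> fb_gen word) set" where
  "fb_relations n =
     {(sigma_word i @ sigma_word j, sigma_word j @ sigma_word i)
       | i j. i \<in> {1..<n} \<and> j \<in> {1..<n} \<and> \<bar>int i - int j\<bar> \<ge> 2} \<union>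
     {(sigma_word i @ sigma_word (i + 1) @ sigma_word i,
       sigma_word (i + 1) @ sigma_word i @ sigma_word (i + 1))
       | i. i \<in> {1..<n} \<and> i + 1 \<in> {1..<n}} \<union>
     {(twist_word i @ twist_word j, twist_word j @ twist_word i)
       | i j. i \<in> {1..n} \<and> j \<in> {1..n}} \<union>
     {(sigma_word j @ twist_word i, twist_word (transpose j (j + 1) i) @ sigma_word j)
       | i j. i \<in> {1..n} \<and> j \<in> {1..<n}}"

definition FB :: "nat \<Rightarrow> fb_gen word set monoid" where
  "FB n = presented_group (fb_gens n) (fb_relations n)"

definition fb_class :: "nat \<Rightarrow> fb_gen word \<Rightarrow> fb_gen word set" where
  "fb_class n w = word_rel (fb_gens n) (fb_relations n) `` {w}"

definition FB_incl :: "nat \<Rightarrow> fb_gen word set \<Rightarrow> fb_gen word set" where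
  "FB_incl n A = (\<Union>w\<in>A. fb_class (Suc n) w)"

definition FB_infinity :: "(nat \<times> fb_gen word set) set monoid" where
  "FB_infinity = colimit_group FB FB_incl"

end

(*
Let e = (1, 0). The comultiplication makes e group-like and the elements of L primitive, so on pure
tensors R and theta become explicit sums of nine terms.

Suppose V carries a bilinear operation * with (a*b)*c = (a*c)*b + a*(b*c) (a right Leibniz algebra)
and an element E with E*v = v*E = 0. Then r(a (x) b) = b (x) a + E (x) (a*b) is invertible, with inverse
a (x) b |-> b (x) a - (b*a) (x) E, and satisfies the braid relation.

If L is a 3-Lie algebra, this applies to V = X (x) X, E = e (x) e, with (z (x) w) acting on x (x) y as the
derivation [-, z, w]; the Leibniz rule is the fundamental identity. Here R = r and theta = 1.

If L is a Lie algebra, it applies to V = X, E = e, with x*y the bracket of the L-components. Since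
T(x, z, w) = (x <| z) <| w, where x <| z = T(x, z, e) is the rack operation behind r, R is the 2-cabling r_2 r_1 r_3 r_2 of r
and theta is the full twist r^2. The local relations then hold already in the braid group.

Tensoring with identities transports the local relations to all X^(2n); the remaining relations say that
maps acting on disjoint tensor factors commute.
*)
theory Submission
  imports Defs
begin

text \<open>One construction serves both cases, with strands of width \<open>k\<close>: a single
  tensor factor for Lie algebras, two for 3-Lie algebras. The common abstraction is a Leibniz
  product and not a Lie bracket because the product on X (x) X, an action of z (x) w on x (x) y, is
  in general not skew. In the Lie case R on X (x) X does not have the two-term form; it has nine
  terms, and multiplying out its braid relation on six factors would be unwieldy. Recognising the
  cabling confines multilinear computation to the braid relation of r on three factors and one
  comparison of R with a product of four crossings; everything else is algebra with braid words.
  Because cosets of all degrees share one type, associativity and the unit law of the tensor product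
  are equalities, and nested paddings merge without associators. The price is that many laws hold
  only for genuine cosets, hence the recurring condition \<open>range (tensor_class s)\<close>. Maps
  are kept extensional, so that they can be compared on pure tensors alone.\<close>

section \<open>Presented groups\<close>

lemma word_rel_subset: "word_rel S Q \<subseteq> words S \<times> words S"
proof -
  have "u \<in> words S \<and> v \<in> words S" if "(u, v) \<in> word_rel S Q" for u v
    using that by induction (auto simp: words_def)
  then show ?thesis by auto
qed

lemma equiv_word_rel: "equiv (words S) (word_rel S Q)"
  using word_rel_subset[of S Q]
  by (intro equivI refl_onI symI transI) (auto intro: word_rel.intros)

lemma word_rel_mono:
  assumes "S \<subseteq> S'" "Q \<subseteq> Q'"
  shows "word_rel S Q \<subseteq> word_rel S' Q'"
proof -
  have W: "words S \<subseteq> words S'" using assms(1) unfolding words_def by (intro lists_mono) auto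
  have "(u, v) \<in> word_rel S' Q'" if "(u, v) \<in> word_rel S Q" for u v
    using that by induction (use W assms in \<open>auto intro: word_rel.intros\<close>)
  then show ?thesis by auto
qed

lemma words_append [simp]: "u @ v \<in> words S \<longleftrightarrow> u \<in> words S \<and> v \<in> words S"
  by (auto simp: words_def)

lemma words_Nil [simp]: "[] \<in> words S"
  by (simp add: words_def)

lemma words_Cons [simp]: "(e, g) # w \<in> words S \<longleftrightarrow> g \<in> S \<and> w \<in> words S"
  by (auto simp: words_def)

lemma word_rel_append:
  assumes "(u, u') \<in> word_rel S Q" "(v, v') \<in> word_rel S Q"
  shows "(u @ v, u' @ v') \<in> word_rel S Q"
proof -
  have w: "u' \<in> words S" "v \<in> words S"
    using assms word_rel_subset by blast+
  have "([] @ u @ v, [] @ u' @ v) \<in> word_rel S Q"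
    by (rule word_rel.congr) (use assms w in auto)
  moreover have "(u' @ v @ [], u' @ v' @ []) \<in> word_rel S Q"
    by (rule word_rel.congr) (use assms w in auto)
  ultimately show ?thesis using word_rel.trans by fastforce
qed

lemma word_class_eq_iff:
  assumes "u \<in> words S" "v \<in> words S"
  shows "word_rel S Q `` {u} = word_rel S Q `` {v} \<longleftrightarrow> (u, v) \<in> word_rel S Q"
  using eq_equiv_class_iff[OF equiv_word_rel assms] .

lemma presented_group_mult:
  assumes "u \<in> words S" "v \<in> words S"
  shows "word_rel S Q `` {u} \<otimes>\<^bsub>presented_group S Q\<^esub> word_rel S Q `` {v} = word_rel S Q `` {u @ v}"
proof -
  have "word_rel S Q `` {u' @ v'} = word_rel S Q `` {u @ v}"
    if "u' \<in> word_rel S Q `` {u}" "v' \<in> word_rel S Q `` {v}" for u' v'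
    using equiv_class_eq[OF equiv_word_rel word_rel_append] that by fastforce
  then have "(\<Union>u'\<in>word_rel S Q `` {u}. \<Union>v'\<in>word_rel S Q `` {v}. word_rel S Q `` {u' @ v'})
      = (\<Union>u'\<in>word_rel S Q `` {u}. \<Union>v'\<in>word_rel S Q `` {v}. word_rel S Q `` {u @ v})"
    by (intro SUP_cong HOL.refl)
  moreover have "u \<in> word_rel S Q `` {u}" "v \<in> word_rel S Q `` {v}"
    using assms by (auto intro: word_rel.refl)
  ultimately show ?thesis unfolding presented_group_def by auto
qed

lemma presented_group_carrier:
  "A \<in> carrier (presented_group S Q) \<longleftrightarrow> (\<exists>w\<in>words S. A = word_rel S Q `` {w})"
  unfolding presented_group_def by (auto simp: quotient_def)

lemma presented_group_one: "\<one>\<^bsub>presented_group S Q\<^esub> = word_rel S Q `` {[]}"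
  by (simp add: presented_group_def)

text \<open>The inverse is the reversed word with all signs flipped: the induction removes the first
  letter of \<open>w\<close> and puts its inverse at the end of \<open>v\<close>. The left inverse
  is the form that \<open>groupI\<close> asks for.\<close>

lemma word_inverse:
  assumes "w \<in> words S"
  shows "\<exists>v\<in>words S. (v @ w, []) \<in> word_rel S Q"
  using assms
proof (induction w)
  case Nil
  then show ?case by (intro bexI[of _ "[]"]) (auto intro: word_rel.refl)
next
  case (Cons a w)
  obtain e g where a: "a = (e, g)" by fastforce
  with Cons obtain v where v: "v \<in> words S" "(v @ w, []) \<in> word_rel S Q" and g: "g \<in> S" "w \<in> words S"
    by auto
  have "([(\<not> e, g), (\<not> \<not> e, g)], []) \<in> word_rel S Q"
    by (rule word_rel.cancel[OF g(1)])
  from word_rel.congr[OF this v(1) g(2)] word_rel.trans[OF _ v(2)]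
  have "((v @ [(\<not> e, g)]) @ a # w, []) \<in> word_rel S Q" by (simp add: a)
  with v(1) g show ?case by (intro bexI[of _ "v @ [(\<not> e, g)]"]) auto
qed

lemma group_presented_group: "group (presented_group S Q)"
proof (rule groupI)
  fix A assume "A \<in> carrier (presented_group S Q)"
  then obtain w where w: "w \<in> words S" "A = word_rel S Q `` {w}"
    by (auto simp: presented_group_carrier)
  obtain v where "v \<in> words S" "(v @ w, []) \<in> word_rel S Q"
    using word_inverse[OF w(1)] by blast
  with w have "word_rel S Q `` {v} \<otimes>\<^bsub>presented_group S Q\<^esub> A = \<one>\<^bsub>presented_group S Q\<^esub>"
    and "word_rel S Q `` {v} \<in> carrier (presented_group S Q)"
    by (simp add: presented_group_mult presented_group_one word_class_eq_iff del: Image_singleton_iff,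
        auto simp only: presented_group_carrier)
  then show "\<exists>B\<in>carrier (presented_group S Q). B \<otimes>\<^bsub>presented_group S Q\<^esub> A = \<one>\<^bsub>presented_group S Q\<^esub>"
    by blast
next
  fix A B assume "A \<in> carrier (presented_group S Q)" "B \<in> carrier (presented_group S Q)"
  then obtain u v where "u \<in> words S" "A = word_rel S Q `` {u}" "v \<in> words S" "B = word_rel S Q `` {v}"
    unfolding presented_group_carrier by blast
  then show "A \<otimes>\<^bsub>presented_group S Q\<^esub> B \<in> carrier (presented_group S Q)"
    unfolding presented_group_carrier using presented_group_mult[of u S v Q] words_append by blast
next
  show "\<one>\<^bsub>presented_group S Q\<^esub> \<in> carrier (presented_group S Q)"
    unfolding presented_group_carrier presented_group_one using words_Nil by blast
next
  fix A B C
  assume "A \<in> carrier (presented_group S Q)" "B \<in> carrier (presented_group S Q)"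
    "C \<in> carrier (presented_group S Q)"
  then obtain u v w where "u \<in> words S" "A = word_rel S Q `` {u}" "v \<in> words S" "B = word_rel S Q `` {v}"
    "w \<in> words S" "C = word_rel S Q `` {w}"
    unfolding presented_group_carrier by blast
  then show "A \<otimes>\<^bsub>presented_group S Q\<^esub> B \<otimes>\<^bsub>presented_group S Q\<^esub> C
      = A \<otimes>\<^bsub>presented_group S Q\<^esub> (B \<otimes>\<^bsub>presented_group S Q\<^esub> C)"
    by (simp only: presented_group_mult words_append append_assoc simp_thms)
next
  fix A assume "A \<in> carrier (presented_group S Q)"
  then obtain w where "w \<in> words S" "A = word_rel S Q `` {w}"
    unfolding presented_group_carrier by blast
  then show "\<one>\<^bsub>presented_group S Q\<^esub> \<otimes>\<^bsub>presented_group S Q\<^esub> A = A"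
    by (simp only: presented_group_one presented_group_mult words_Nil append_Nil)
qed

fun word_value :: "('a, 'b) monoid_scheme \<Rightarrow> ('g \<Rightarrow> 'a) \<Rightarrow> 'g word \<Rightarrow> 'a" where
  "word_value G f [] = \<one>\<^bsub>G\<^esub>"
| "word_value G f ((e, g) # w) = (if e then f g else inv\<^bsub>G\<^esub> (f g)) \<otimes>\<^bsub>G\<^esub> word_value G f w"

definition presented_lift :: "('a, 'b) monoid_scheme \<Rightarrow> ('g \<Rightarrow> 'a) \<Rightarrow> 'g word set \<Rightarrow> 'a" where
  "presented_lift G f A = word_value G f (SOME w. w \<in> A)"

context group
begin

lemma word_value_closed:
  "f \<in> S \<rightarrow> carrier G \<Longrightarrow> w \<in> words S \<Longrightarrow> word_value G f w \<in> carrier G"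
  by (induction w) (auto simp: Pi_iff)

lemma word_value_append:
  "f \<in> S \<rightarrow> carrier G \<Longrightarrow> u \<in> words S \<Longrightarrow> v \<in> words S
    \<Longrightarrow> word_value G f (u @ v) = word_value G f u \<otimes> word_value G f v"
proof (induction u)
  case (Cons a u)
  then show ?case by (cases a) (auto simp: m_assoc word_value_closed Pi_iff)
qed (auto simp: word_value_closed)

lemma word_value_rel:
  assumes f: "f \<in> S \<rightarrow> carrier G"
    and Q: "\<And>u v. (u, v) \<in> Q \<Longrightarrow> u \<in> words S \<Longrightarrow> v \<in> words S \<Longrightarrow> word_value G f u = word_value G f v"
    and "(u, v) \<in> word_rel S Q"
  shows "word_value G f u = word_value G f v"
  using assms(3)
proof induction
  case (congr u v p q)
  then have "u \<in> words S" "v \<in> words S" using word_rel_subset by blast+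
  with congr show ?case by (simp add: word_value_append[OF f])
next
  case (cancel g e)
  then show ?case using f by (auto simp: Pi_iff)
qed (use Q in auto)

text \<open>Von Dyck's theorem. Word values are constant on the classes of \<open>word_rel\<close>
  as soon as the relations hold in \<open>G\<close>, so the representative picked in
  \<open>presented_lift\<close> is immaterial and any word may be used to evaluate the lift.\<close>

lemma presented_lift:
  assumes f: "f \<in> S \<rightarrow> carrier G"
    and Q: "\<And>u v. (u, v) \<in> Q \<Longrightarrow> u \<in> words S \<Longrightarrow> v \<in> words S \<Longrightarrow> word_value G f u = word_value G f v"
  shows presented_lift_class:
      "w \<in> words S \<Longrightarrow> presented_lift G f (word_rel S Q `` {w}) = word_value G f w"
    and presented_lift_hom: "group_hom (presented_group S Q) G (presented_lift G f)"
proof -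
  have *: "presented_lift G f (word_rel S Q `` {w}) = word_value G f w" if "w \<in> words S" for w
  proof -
    have "w \<in> word_rel S Q `` {w}" using that by (auto intro: word_rel.refl)
    then have "(SOME v. v \<in> word_rel S Q `` {w}) \<in> word_rel S Q `` {w}" by (rule someI)
    then show ?thesis unfolding presented_lift_def using word_value_rel[OF f Q] by auto
  qed
  then show "w \<in> words S \<Longrightarrow> presented_lift G f (word_rel S Q `` {w}) = word_value G f w" .
  show "group_hom (presented_group S Q) G (presented_lift G f)"
  proof (intro group_hom.intro group_presented_group is_group group_hom_axioms.intro homI)
    fix A assume "A \<in> carrier (presented_group S Q)"
    then show "presented_lift G f A \<in> carrier G"
      by (auto simp: presented_group_carrier * word_value_closed[OF f])
  next
    fix A B assume "A \<in> carrier (presented_group S Q)" "B \<in> carrier (presented_group S Q)"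
    then show "presented_lift G f (A \<otimes>\<^bsub>presented_group S Q\<^esub> B)
        = presented_lift G f A \<otimes> presented_lift G f B"
      by (auto simp: presented_group_carrier presented_group_mult * word_value_append[OF f])
  qed
qed

end

text \<open>This reduces the comparison of representations at neighbouring levels to generators, see
  \<open>representation_compatible\<close>.\<close>

lemma (in group_hom) hom_word_value:
  "f \<in> S \<rightarrow> carrier G \<Longrightarrow> w \<in> words S \<Longrightarrow> h (word_value G f w) = word_value H (h \<circ> f) w"
proof (induction w)
  case (Cons a w)
  then show ?case by (cases a) (auto simp: Pi_iff G.word_value_closed)
qed auto

lemma word_value_cong:
  "(\<And>g. g \<in> S \<Longrightarrow> f g = f' g) \<Longrightarrow> w \<in> words S \<Longrightarrow> word_value G f w = word_value G f' w"
  by (induction w) auto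

section \<open>Direct limits of sequences of groups, and homomorphisms between them\<close>

section \<open>Sequential colimits\<close>

locale group_sequence =
  fixes G :: "nat \<Rightarrow> 'a monoid" and \<iota> :: "nat \<Rightarrow> 'a \<Rightarrow> 'a"
  assumes group_G: "group (G n)"
    and \<iota>_hom: "\<iota> n \<in> hom (G n) (G (Suc n))"
begin

lemma transition_hom: "transition \<iota> m d \<in> hom (G m) (G (m + d))"
proof (induction d)
  case 0
  then show ?case by (simp add: hom_def)
next
  case (Suc d)
  then show ?case using \<iota>_hom[of "m + d"] by (auto simp: hom_def Pi_iff)
qed

lemma transition_add: "transition \<iota> m (d + e) x = transition \<iota> (m + d) e (transition \<iota> m d x)"
  by (induction e) (auto simp: add.assoc)

text \<open>Indexing the transition map by its target level instead of the number of steps makes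
  composition free of sums and differences. For \<open>k < m\<close> it degenerates to the identity,
  so a bound \<open>m \<le> k\<close> accompanies its use as a map between levels.\<close>

definition to_level :: "nat \<Rightarrow> nat \<Rightarrow> 'a \<Rightarrow> 'a" where
  "to_level m k = transition \<iota> m (k - m)"

lemma to_level_group_hom: "m \<le> k \<Longrightarrow> group_hom (G m) (G k) (to_level m k)"
  using transition_hom[of m "k - m"] group_G
  by (auto intro!: group_hom.intro group_hom_axioms.intro simp: to_level_def)

lemma to_level_closed: "m \<le> k \<Longrightarrow> x \<in> carrier (G m) \<Longrightarrow> to_level m k x \<in> carrier (G k)"
  by (rule group_hom.hom_closed[OF to_level_group_hom])

lemma to_level_trans: "m \<le> k \<Longrightarrow> k \<le> l \<Longrightarrow> to_level k l (to_level m k x) = to_level m l x"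
  using transition_add[of m "k - m" "l - k"] by (simp add: to_level_def)

lemma to_level_self [simp]: "to_level m m x = x"
  by (simp add: to_level_def)

lemma colimit_rel_iff:
  "((m, x), (n, y)) \<in> colimit_rel G \<iota> \<longleftrightarrow> x \<in> carrier (G m) \<and> y \<in> carrier (G n) \<and>
     (\<exists>k\<ge>max m n. to_level m k x = to_level n k y)"
  by (auto simp: colimit_rel_def to_level_def)

text \<open>An equality reached at one level persists at all higher ones, so two witnesses can be
  replaced by their maximum.\<close>

lemma colimit_rel_mono:
  assumes "k \<ge> max m n" "to_level m k x = to_level n k y" "l \<ge> k"
  shows "to_level m l x = to_level n l y"
  using to_level_trans[of m k l x] to_level_trans[of n k l y] assms by simp

lemma equiv_colimit_rel: "equiv (SIGMA n:UNIV. carrier (G n)) (colimit_rel G \<iota>)"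
proof (intro equivI refl_onI symI transI)
  show "colimit_rel G \<iota> \<subseteq> (SIGMA n:UNIV. carrier (G n)) \<times> (SIGMA n:UNIV. carrier (G n))"
    by (auto simp: colimit_rel_def)
next
  fix a assume "a \<in> (SIGMA n:UNIV. carrier (G n))"
  then show "(a, a) \<in> colimit_rel G \<iota>" by (cases a) (auto simp: colimit_rel_iff)
next
  fix a b assume "(a, b) \<in> colimit_rel G \<iota>"
  then show "(b, a) \<in> colimit_rel G \<iota>"
    by (cases a, cases b) (simp add: colimit_rel_iff, metis)
next
  fix a b c assume ab: "(a, b) \<in> colimit_rel G \<iota>" and bc: "(b, c) \<in> colimit_rel G \<iota>"
  obtain m x n y p z where e: "a = (m, x)" "b = (n, y)" "c = (p, z)" by (metis surj_pair)
  from ab bc obtain k l where *: "x \<in> carrier (G m)" "z \<in> carrier (G p)"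
    "k \<ge> max m n" "to_level m k x = to_level n k y"
    "l \<ge> max n p" "to_level n l y = to_level p l z"
    unfolding e colimit_rel_iff by blast
  have "to_level m (max k l) x = to_level n (max k l) y" "to_level n (max k l) y = to_level p (max k l) z"
    using * by (auto intro: colimit_rel_mono)
  then show "(a, c) \<in> colimit_rel G \<iota>" using * unfolding e colimit_rel_iff
    by (auto intro!: exI[of _ "max k l"])
qed

lemma colimit_in_eq_iff:
  assumes "x \<in> carrier (G m)" "y \<in> carrier (G n)"
  shows "colimit_in G \<iota> m x = colimit_in G \<iota> n y \<longleftrightarrow> (\<exists>k\<ge>max m n. to_level m k x = to_level n k y)"
  unfolding colimit_in_def
  using eq_equiv_class_iff[OF equiv_colimit_rel, of "(m, x)" "(n, y)"] assms
  by (auto simp: colimit_rel_iff)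

lemma colimit_in_to_level:
  assumes "x \<in> carrier (G m)" "m \<le> k"
  shows "colimit_in G \<iota> k (to_level m k x) = colimit_in G \<iota> m x"
  using assms to_level_closed[of m k x]
  by (subst colimit_in_eq_iff) (auto intro!: exI[of _ k])

lemma colimit_in_mem:
  "(n, y) \<in> colimit_in G \<iota> m x \<Longrightarrow> y \<in> carrier (G n) \<and> colimit_in G \<iota> n y = colimit_in G \<iota> m x"
  unfolding colimit_in_def using equiv_class_eq[OF equiv_colimit_rel, of "(m, x)" "(n, y)"]
  by (auto simp: colimit_rel_iff)

lemma colimit_in_self: "x \<in> carrier (G m) \<Longrightarrow> (m, x) \<in> colimit_in G \<iota> m x"
  unfolding colimit_in_def by (auto simp: colimit_rel_iff)

lemma colimit_group_carrier:
  "A \<in> carrier (colimit_group G \<iota>) \<longleftrightarrow> (\<exists>m. \<exists>x\<in>carrier (G m). A = colimit_in G \<iota> m x)"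
  unfolding colimit_group_def colimit_in_def by (auto simp: quotient_def)

text \<open>With representatives available at every sufficiently high level, finitely many elements
  can be moved to one common level, where the group laws are inherited from a single group.\<close>

lemma colimit_group_carrier_levels:
  assumes "A \<in> carrier (colimit_group G \<iota>)"
  obtains m where "\<And>k. k \<ge> m \<Longrightarrow> \<exists>x\<in>carrier (G k). A = colimit_in G \<iota> k x"
  using assms colimit_in_to_level to_level_closed unfolding colimit_group_carrier by metis

lemma colimit_in_mult_level:
  assumes "x \<in> carrier (G k)" "y \<in> carrier (G k)" "k \<le> l"
  shows "colimit_in G \<iota> l (to_level k l x \<otimes>\<^bsub>G l\<^esub> to_level k l y) = colimit_in G \<iota> k (x \<otimes>\<^bsub>G k\<^esub> y)"
proof -
  interpret group_hom "G k" "G l" "to_level k l" by (rule to_level_group_hom[OF assms(3)])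
  show ?thesis using assms colimit_in_to_level[of "x \<otimes>\<^bsub>G k\<^esub> y" k l] by simp
qed

text \<open>Well-definedness of the product: both pairs of representatives agree at some common
  level, and the level maps are homomorphisms.\<close>

lemma colimit_in_mult_cong:
  assumes "x \<in> carrier (G k)" "y \<in> carrier (G k)" "x' \<in> carrier (G l)" "y' \<in> carrier (G l)"
    and "colimit_in G \<iota> k x = colimit_in G \<iota> l x'" "colimit_in G \<iota> k y = colimit_in G \<iota> l y'"
  shows "colimit_in G \<iota> k (x \<otimes>\<^bsub>G k\<^esub> y) = colimit_in G \<iota> l (x' \<otimes>\<^bsub>G l\<^esub> y')"
proof -
  obtain i where i: "i \<ge> max k l" "to_level k i x = to_level l i x'"
    using colimit_in_eq_iff[of x k x' l] assms by blast
  obtain j where j: "j \<ge> max k l" "to_level k j y = to_level l j y'"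
    using colimit_in_eq_iff[of y k y' l] assms by blast
  have "to_level k (max i j) x = to_level l (max i j) x'" "to_level k (max i j) y = to_level l (max i j) y'"
    using i j by (auto intro: colimit_rel_mono)
  moreover have "k \<le> max i j" "l \<le> max i j" using i(1) by auto
  ultimately show ?thesis
    using colimit_in_mult_level[of x k y "max i j"] colimit_in_mult_level[of x' l y' "max i j"] assms
    by simp
qed

text \<open>The defining union runs over representatives at all levels, but
  \<open>colimit_in_mult_cong\<close> makes all its members equal. Products can thus be computed at
  any level that both factors reach.\<close>

lemma colimit_group_mult:
  assumes "x \<in> carrier (G k)" "y \<in> carrier (G k)"
  shows "colimit_in G \<iota> k x \<otimes>\<^bsub>colimit_group G \<iota>\<^esub> colimit_in G \<iota> k y = colimit_in G \<iota> k (x \<otimes>\<^bsub>G k\<^esub> y)"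
proof -
  have "colimit_in G \<iota> (max m n) (to_level m (max m n) x' \<otimes>\<^bsub>G (max m n)\<^esub> to_level n (max m n) y')
      = colimit_in G \<iota> k (x \<otimes>\<^bsub>G k\<^esub> y)"
    if "(m, x') \<in> colimit_in G \<iota> k x" "(n, y') \<in> colimit_in G \<iota> k y" for m x' n y'
    using colimit_in_mem[OF that(1)] colimit_in_mem[OF that(2)] assms
    by (intro colimit_in_mult_cong) (auto simp: to_level_closed colimit_in_to_level)
  then have "(\<Union>(m, x')\<in>colimit_in G \<iota> k x. \<Union>(n, y')\<in>colimit_in G \<iota> k y.
        colimit_in G \<iota> (max m n) (to_level m (max m n) x' \<otimes>\<^bsub>G (max m n)\<^esub> to_level n (max m n) y'))
      = (\<Union>(m, x')\<in>colimit_in G \<iota> k x. \<Union>(n, y')\<in>colimit_in G \<iota> k y. colimit_in G \<iota> k (x \<otimes>\<^bsub>G k\<^esub> y))"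
    by (intro SUP_cong HOL.refl) (auto intro!: SUP_cong)
  also have "\<dots> = colimit_in G \<iota> k (x \<otimes>\<^bsub>G k\<^esub> y)"
    using colimit_in_self[OF assms(1)] colimit_in_self[OF assms(2)] by fastforce
  finally show ?thesis by (simp add: colimit_group_def to_level_def)
qed

text \<open>Level maps preserve identities, so the unit can be taken at the level where the other
  factor of a product lives.\<close>

lemma colimit_group_one: "\<one>\<^bsub>colimit_group G \<iota>\<^esub> = colimit_in G \<iota> k \<one>\<^bsub>G k\<^esub>"
proof -
  interpret group_hom "G 0" "G k" "to_level 0 k" by (rule to_level_group_hom) simp
  show ?thesis using colimit_in_to_level[of "\<one>\<^bsub>G 0\<^esub>" 0 k] by (simp add: colimit_group_def)
qed

lemma group_colimit_group: "group (colimit_group G \<iota>)"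
proof (rule groupI)
  fix A B C
  assume A: "A \<in> carrier (colimit_group G \<iota>)" and B: "B \<in> carrier (colimit_group G \<iota>)"
    and C: "C \<in> carrier (colimit_group G \<iota>)"
  obtain a where a: "\<And>k. k \<ge> a \<Longrightarrow> \<exists>x\<in>carrier (G k). A = colimit_in G \<iota> k x"
    using colimit_group_carrier_levels[OF A] by blast
  obtain b where b: "\<And>k. k \<ge> b \<Longrightarrow> \<exists>x\<in>carrier (G k). B = colimit_in G \<iota> k x"
    using colimit_group_carrier_levels[OF B] by blast
  obtain c where c: "\<And>k. k \<ge> c \<Longrightarrow> \<exists>x\<in>carrier (G k). C = colimit_in G \<iota> k x"
    using colimit_group_carrier_levels[OF C] by blast
  define k where "k = max a (max b c)"
  interpret group "G k" by (rule group_G)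
  have "a \<le> k" "b \<le> k" "c \<le> k" by (auto simp: k_def)
  then obtain x y z where "A = colimit_in G \<iota> k x" "B = colimit_in G \<iota> k y" "C = colimit_in G \<iota> k z"
    and "x \<in> carrier (G k)" "y \<in> carrier (G k)" "z \<in> carrier (G k)"
    using a b c by meson
  then show "A \<otimes>\<^bsub>colimit_group G \<iota>\<^esub> B \<in> carrier (colimit_group G \<iota>)"
    and "A \<otimes>\<^bsub>colimit_group G \<iota>\<^esub> B \<otimes>\<^bsub>colimit_group G \<iota>\<^esub> C
      = A \<otimes>\<^bsub>colimit_group G \<iota>\<^esub> (B \<otimes>\<^bsub>colimit_group G \<iota>\<^esub> C)"
    by (auto simp: colimit_group_mult m_assoc colimit_group_carrier)
next
  fix A assume "A \<in> carrier (colimit_group G \<iota>)"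
  then obtain k x where A: "A = colimit_in G \<iota> k x" "x \<in> carrier (G k)"
    by (auto simp: colimit_group_carrier)
  interpret group "G k" by (rule group_G)
  show "\<one>\<^bsub>colimit_group G \<iota>\<^esub> \<otimes>\<^bsub>colimit_group G \<iota>\<^esub> A = A"
    using A by (simp add: colimit_group_one[of k] colimit_group_mult)
  show "\<exists>B\<in>carrier (colimit_group G \<iota>). B \<otimes>\<^bsub>colimit_group G \<iota>\<^esub> A = \<one>\<^bsub>colimit_group G \<iota>\<^esub>"
    using A by (intro bexI[of _ "colimit_in G \<iota> k (inv\<^bsub>G k\<^esub> x)"])
      (auto simp: colimit_group_one[of k] colimit_group_mult colimit_group_carrier)
next
  show "\<one>\<^bsub>colimit_group G \<iota>\<^esub> \<in> carrier (colimit_group G \<iota>)"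
    using group.is_monoid[OF group_G] 
    by (auto simp: colimit_group_carrier colimit_group_one[of 0] intro: monoid.one_closed)
qed

end

text \<open>A union over all representatives instead of a choice of one; compatibility of
  \<open>\<Phi>\<close> with the transition maps makes every member the same class.\<close>

definition colimit_map ::
  "(nat \<Rightarrow> 'b monoid) \<Rightarrow> (nat \<Rightarrow> 'b \<Rightarrow> 'b) \<Rightarrow> (nat \<Rightarrow> 'a \<Rightarrow> 'b) \<Rightarrow> (nat \<times> 'a) set \<Rightarrow> (nat \<times> 'b) set" where
  "colimit_map H \<kappa> \<Phi> A = (\<Union>(n, x)\<in>A. colimit_in H \<kappa> n (\<Phi> n x))"

lemma colimit_map:
  assumes "group_sequence G \<iota>" "group_sequence H \<kappa>"
    and \<Phi>: "\<And>n. group_hom (G n) (H n) (\<Phi> n)"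
    and compat: "\<And>n x. x \<in> carrier (G n) \<Longrightarrow> \<Phi> (Suc n) (\<iota> n x) = \<kappa> n (\<Phi> n x)"
  shows colimit_map_in: "x \<in> carrier (G n) \<Longrightarrow>
      colimit_map H \<kappa> \<Phi> (colimit_in G \<iota> n x) = colimit_in H \<kappa> n (\<Phi> n x)"
    and colimit_map_hom: "group_hom (colimit_group G \<iota>) (colimit_group H \<kappa>) (colimit_map H \<kappa> \<Phi>)"
proof -
  interpret G: group_sequence G \<iota> by fact
  interpret H: group_sequence H \<kappa> by fact
  interpret \<Phi>: group_hom "G n" "H n" "\<Phi> n" for n by (rule \<Phi>)
  \<comment> \<open>Compatibility with one step is iterated. The induction has to keep track of
    carriers because \<open>compat\<close> speaks only about elements of \<open>G n\<close>.\<close>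
  have trans: "\<Phi> (m + d) (transition \<iota> m d x) = transition \<kappa> m d (\<Phi> m x)"
    if "x \<in> carrier (G m)" for m d x
  proof (induction d)
    case (Suc d)
    have "transition \<iota> m d x \<in> carrier (G (m + d))"
      using G.transition_hom[of m d] that by (auto simp: hom_def)
    with Suc show ?case by (simp add: compat)
  qed simp
  have level: "\<Phi> k (G.to_level m k x) = H.to_level m k (\<Phi> m x)"
    if "x \<in> carrier (G m)" "m \<le> k" for m k x
    using trans[OF that(1), of "k - m"] that(2) by (simp add: G.to_level_def H.to_level_def)
  have *: "colimit_map H \<kappa> \<Phi> (colimit_in G \<iota> n x) = colimit_in H \<kappa> n (\<Phi> n x)"
    if x: "x \<in> carrier (G n)" for n x
  proof -
    have "colimit_in H \<kappa> m (\<Phi> m y) = colimit_in H \<kappa> n (\<Phi> n x)" if my: "(m, y) \<in> colimit_in G \<iota> n x" for m y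
    proof -
      have y: "y \<in> carrier (G m)" using G.colimit_in_mem[OF my] by blast
      then obtain k where k: "k \<ge> max m n" "G.to_level m k y = G.to_level n k x"
        using G.colimit_in_mem[OF my] G.colimit_in_eq_iff[OF y x] by blast
      then have "H.to_level m k (\<Phi> m y) = H.to_level n k (\<Phi> n x)"
        using level[OF y, of k] level[OF x, of k] by simp
      with k(1) H.colimit_in_eq_iff[of "\<Phi> m y" m "\<Phi> n x" n] x y show ?thesis by auto
    qed
    then have "colimit_map H \<kappa> \<Phi> (colimit_in G \<iota> n x)
        = (\<Union>(m, y)\<in>colimit_in G \<iota> n x. colimit_in H \<kappa> n (\<Phi> n x))"
      unfolding colimit_map_def by (intro SUP_cong HOL.refl) auto
    with G.colimit_in_self[OF x] show ?thesis by auto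
  qed
  then show "x \<in> carrier (G n) \<Longrightarrow>
      colimit_map H \<kappa> \<Phi> (colimit_in G \<iota> n x) = colimit_in H \<kappa> n (\<Phi> n x)" .
  show "group_hom (colimit_group G \<iota>) (colimit_group H \<kappa>) (colimit_map H \<kappa> \<Phi>)"
  proof (intro group_hom.intro group_hom_axioms.intro G.group_colimit_group H.group_colimit_group homI)
    fix A assume "A \<in> carrier (colimit_group G \<iota>)"
    then show "colimit_map H \<kappa> \<Phi> A \<in> carrier (colimit_group H \<kappa>)"
      by (metis G.colimit_group_carrier H.colimit_group_carrier * \<Phi>.hom_closed)
  next
    fix A B assume A: "A \<in> carrier (colimit_group G \<iota>)" and B: "B \<in> carrier (colimit_group G \<iota>)"
    obtain a where a: "\<And>k. k \<ge> a \<Longrightarrow> \<exists>x\<in>carrier (G k). A = colimit_in G \<iota> k x"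
      using G.colimit_group_carrier_levels[OF A] by blast
    obtain b where b: "\<And>k. k \<ge> b \<Longrightarrow> \<exists>x\<in>carrier (G k). B = colimit_in G \<iota> k x"
      using G.colimit_group_carrier_levels[OF B] by blast
    obtain x y where "A = colimit_in G \<iota> (max a b) x" "B = colimit_in G \<iota> (max a b) y"
      "x \<in> carrier (G (max a b))" "y \<in> carrier (G (max a b))"
      using a[of "max a b"] b[of "max a b"] by auto
    then show "colimit_map H \<kappa> \<Phi> (A \<otimes>\<^bsub>colimit_group G \<iota>\<^esub> B)
        = colimit_map H \<kappa> \<Phi> A \<otimes>\<^bsub>colimit_group H \<kappa>\<^esub> colimit_map H \<kappa> \<Phi> B"
      by (simp add: G.colimit_group_mult H.colimit_group_mult *)
  qed
qed

section \<open>The framed braid groups as a direct system\<close>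

section \<open>Framed braid groups\<close>

lemma group_FB: "group (FB n)"
  unfolding FB_def by (rule group_presented_group)

lemma fb_gens_mono: "fb_gens n \<subseteq> fb_gens (Suc n)"
  by (auto simp: fb_gens_def)

lemma fb_words_mono: "w \<in> words (fb_gens n) \<Longrightarrow> w \<in> words (fb_gens (Suc n))"
  unfolding words_def using fb_gens_mono[of n] by (auto dest: lists_mono[THEN subsetD, rotated])

lemma fb_relations_mono: "fb_relations n \<subseteq> fb_relations (Suc n)"
  unfolding fb_relations_def by (intro Un_mono; fastforce)

lemma FB_carrier: "A \<in> carrier (FB n) \<longleftrightarrow> (\<exists>w\<in>words (fb_gens n). A = fb_class n w)"
  by (simp add: FB_def fb_class_def presented_group_carrier)

lemma FB_mult:
  "u \<in> words (fb_gens n) \<Longrightarrow> v \<in> words (fb_gens n)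
    \<Longrightarrow> fb_class n u \<otimes>\<^bsub>FB n\<^esub> fb_class n v = fb_class n (u @ v)"
  by (simp add: FB_def fb_class_def presented_group_mult)

text \<open>Generators and relations persist at the next level, so equivalent words stay equivalent
  and the union in \<open>FB_incl\<close> collapses to one class.\<close>

lemma FB_incl_class:
  assumes "w \<in> words (fb_gens n)"
  shows "FB_incl n (fb_class n w) = fb_class (Suc n) w"
proof -
  have "fb_class (Suc n) v = fb_class (Suc n) w" if "v \<in> fb_class n w" for v
    using that word_rel_mono[OF fb_gens_mono fb_relations_mono, of n]
      equiv_class_eq[OF equiv_word_rel, of w v "fb_gens (Suc n)" "fb_relations (Suc n)"]
    unfolding fb_class_def by auto
  then have "FB_incl n (fb_class n w) = (\<Union>v\<in>fb_class n w. fb_class (Suc n) w)"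
    unfolding FB_incl_def by (intro SUP_cong HOL.refl)
  moreover have "w \<in> fb_class n w" using assms by (auto simp: fb_class_def intro: word_rel.refl)
  ultimately show ?thesis by auto
qed

lemma group_sequence_FB: "group_sequence FB FB_incl"
proof (rule group_sequence.intro)
  show "FB_incl n \<in> hom (FB n) (FB (Suc n))" for n
    by (rule homI) (auto simp: FB_carrier FB_incl_class FB_mult fb_words_mono)
qed (rule group_FB)

section \<open>The product of the tensor algebra on cosets of formal tensors\<close>

section \<open>The tensor algebra\<close>

lemma formal_scale_single: "formal_scale c (Poly_Mapping.single xs d) = Poly_Mapping.single xs (c * d)"
  by (rule poly_mapping_eqI) (simp add: lookup_formal_scale lookup_single when_def)

lemma formal_scale_scale: "formal_scale c (formal_scale d f) = formal_scale (c * d) f"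
  by (rule poly_mapping_eqI) (simp add: lookup_formal_scale)

lemma formal_scale_zero: "formal_scale c 0 = 0"
  by (rule poly_mapping_eqI) (simp add: lookup_formal_scale)

text \<open>Written as an iterated \<open>formal_extend\<close>, the product is linear in the outer
  argument by \<open>linear_formal_extend\<close>. The mirrored lemma exchanges the two sums to
  obtain linearity in the other argument.\<close>

lemma formal_mult_extend_left:
  "formal_mult f g = formal_extend (\<lambda>xs. formal_extend (\<lambda>ys. Poly_Mapping.single (xs @ ys) 1) g) f"
proof -
  interpret vector_space "formal_scale :: 'b \<Rightarrow> ('a, 'b) formal_tensor \<Rightarrow> _"
    by (rule vector_space_formal_scale)
  show ?thesis
    by (simp add: formal_mult_def formal_extend_def formal_scale_single scale_sum_right)
qed

lemma formal_mult_extend_right: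
  "formal_mult f g = formal_extend (\<lambda>ys. formal_extend (\<lambda>xs. Poly_Mapping.single (xs @ ys) 1) f) g"
proof -
  interpret vector_space "formal_scale :: 'b \<Rightarrow> ('a, 'b) formal_tensor \<Rightarrow> _"
    by (rule vector_space_formal_scale)
  show ?thesis
    unfolding formal_mult_def formal_extend_def
    by (subst sum.swap) (simp add: formal_scale_single scale_sum_right mult.commute)
qed

lemma linear_formal_mult_left:
  "Vector_Spaces.linear formal_scale formal_scale (\<lambda>f. formal_mult f g)"
  unfolding formal_mult_extend_left by (rule linear_formal_extend)

lemma linear_formal_mult_right:
  "Vector_Spaces.linear formal_scale formal_scale (\<lambda>g. formal_mult f g)"
  unfolding formal_mult_extend_right by (rule linear_formal_extend)

lemma formal_mult_single:
  "formal_mult (Poly_Mapping.single xs c) (Poly_Mapping.single ys d) = Poly_Mapping.single (xs @ ys) (c * d)"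
  by (simp add: formal_mult_extend_left formal_extend_single formal_scale_single)

text \<open>Expanding one factor in basis words reduces the ideal property of
  \<open>null_tensors\<close> to multiplication by a single word.\<close>

lemma formal_mult_expand_right:
  "formal_mult f g = formal_extend (\<lambda>ys. formal_mult f (Poly_Mapping.single ys 1)) g"
proof -
  interpret vector_space "formal_scale :: 'b \<Rightarrow> ('a, 'b) formal_tensor \<Rightarrow> _"
    by (rule vector_space_formal_scale)
  show ?thesis
    by (simp add: formal_mult_extend_right[of f] formal_extend_single)
qed

lemma formal_mult_expand_left:
  "formal_mult f g = formal_extend (\<lambda>xs. formal_mult (Poly_Mapping.single xs 1) g) f"
proof -
  interpret vector_space "formal_scale :: 'b \<Rightarrow> ('a, 'b) formal_tensor \<Rightarrow> _"
    by (rule vector_space_formal_scale)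
  show ?thesis
    by (simp add: formal_mult_extend_left[of _ g] formal_extend_single)
qed

lemma formal_tensor_induct [case_names zero step]:
  fixes f :: "('y, 'k::field) formal_tensor"
  assumes "P 0" and step: "\<And>c xs f. P f \<Longrightarrow> P (formal_scale c (Poly_Mapping.single xs 1) + f)"
  shows "P f"
proof -
  have "P (\<Sum>xs\<in>S. formal_scale (Poly_Mapping.lookup f xs) (Poly_Mapping.single xs 1))" if "finite S" for S
    using that by (induction S) (auto intro: assms)
  from this[of "Poly_Mapping.keys f"] show ?thesis
    using formal_tensor_expand[of "Poly_Mapping.keys f" f] by simp
qed

locale tensor_space =
  fixes s :: "'k::field \<Rightarrow> 'x::ab_group_add \<Rightarrow> 'x"
begin

interpretation formal: vector_space "formal_scale :: 'k \<Rightarrow> ('x, 'k) formal_tensor \<Rightarrow> _"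
  by (rule vector_space_formal_scale)

abbreviation tensor_sum (infixl "\<boxplus>" 65) where "A \<boxplus> B \<equiv> tensor_add s A B"
abbreviation tensor_prod (infixl "\<boxtimes>" 70) where "A \<boxtimes> B \<equiv> tensor_mult s A B"
abbreviation tensor_zero ("\<zero>\<^sub>t") where "\<zero>\<^sub>t \<equiv> tensor_class s 0"

lemma null_formal_extend:
  assumes "\<And>xs. \<rho> xs \<in> null_tensors s"
  shows "formal_extend \<rho> (f :: ('y, 'k) formal_tensor) \<in> null_tensors s"
  using assms unfolding formal_extend_def null_tensors_def
  by (intro formal.span_sum formal.span_scale)

text \<open>A multilinearity relation changes one slot between arbitrary words \<open>us\<close> and
  \<open>vs\<close>; appending \<open>ws\<close> only lengthens \<open>vs\<close>, so generators of
  the subspace go to generators.\<close>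

lemma null_mult_single_right:
  assumes "f \<in> null_tensors s"
  shows "formal_mult f (Poly_Mapping.single ws 1) \<in> null_tensors s"
  using assms unfolding null_tensors_def
proof (induction rule: formal.span_induct_alt)
  interpret L: Vector_Spaces.linear formal_scale formal_scale "\<lambda>p :: ('x, 'k) formal_tensor. formal_mult p q" for q
    by (rule linear_formal_mult_left)
  {
    case base
    show ?case by (simp add: L.zero formal.span_zero)
  next
    case (step c r h)
    have "formal_mult r (Poly_Mapping.single ws 1) \<in> multilinearity_relations s"
      using step(1) unfolding multilinearity_relations_def
      by (elim UnE CollectE exE conjE; simp add: L.diff formal_mult_single; blast)
    then show ?case using step(2)
      by (simp add: L.add L.scale formal.span_add formal.span_scale formal.span_base)
  }
qed

lemma null_mult_single_left:
  assumes "f \<in> null_tensors s"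
  shows "formal_mult (Poly_Mapping.single ws 1) f \<in> null_tensors s"
  using assms unfolding null_tensors_def
proof (induction rule: formal.span_induct_alt)
  interpret L: Vector_Spaces.linear formal_scale formal_scale "\<lambda>q :: ('x, 'k) formal_tensor. formal_mult p q" for p
    by (rule linear_formal_mult_right)
  {
    case base
    show ?case by (simp add: L.zero formal.span_zero)
  next
    case (step c r h)
    \<comment> \<open>Bracketing \<open>ws @ us\<close> as one prefix exhibits the product as a
      relation of the defining form.\<close>
    have add: "Poly_Mapping.single ((ws @ us) @ [x + y] @ vs) 1 - Poly_Mapping.single ((ws @ us) @ [x] @ vs) 1
        - Poly_Mapping.single ((ws @ us) @ [y] @ vs) 1 \<in> multilinearity_relations s" for us x y vs
      unfolding multilinearity_relations_def by blast
    have scale: "Poly_Mapping.single ((ws @ us) @ [s c x] @ vs) 1 - Poly_Mapping.single ((ws @ us) @ [x] @ vs) c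
        \<in> multilinearity_relations s" for us c x vs
      unfolding multilinearity_relations_def by blast
    have "formal_mult (Poly_Mapping.single ws 1) r \<in> multilinearity_relations s"
      using step(1)[unfolded multilinearity_relations_def]
      by (elim UnE CollectE exE conjE; use add scale in \<open>simp add: L.diff formal_mult_single\<close>)
    then show ?case using step(2)
      by (simp add: L.add L.scale formal.span_add formal.span_scale formal.span_base)
  }
qed

text \<open>With its mirror image this says that \<open>null_tensors\<close> is a two-sided ideal,
  which is why the product descends to cosets.\<close>

lemma null_mult_right: "f \<in> null_tensors s \<Longrightarrow> formal_mult f g \<in> null_tensors s"
  by (subst formal_mult_expand_right) (intro null_formal_extend null_mult_single_right)

lemma null_mult_left: "g \<in> null_tensors s \<Longrightarrow> formal_mult f g \<in> null_tensors s"
  by (subst formal_mult_expand_left) (intro null_formal_extend null_mult_single_left)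

lemma tensor_mult_class:
  "tensor_class s f \<boxtimes> tensor_class s g = tensor_class s (formal_mult f g)"
proof -
  interpret L: Vector_Spaces.linear formal_scale formal_scale "\<lambda>p :: ('x, 'k) formal_tensor. formal_mult p q" for q
    by (rule linear_formal_mult_left)
  interpret R: Vector_Spaces.linear formal_scale formal_scale "\<lambda>q :: ('x, 'k) formal_tensor. formal_mult p q" for p
    by (rule linear_formal_mult_right)
  have "tensor_class s (formal_mult f' g') = tensor_class s (formal_mult f g)"
    if "f' \<in> tensor_class s f" "g' \<in> tensor_class s g" for f' g'
  proof -
    have "f' - f \<in> null_tensors s" "g' - g \<in> null_tensors s"
      using that by (auto simp: tensor_class_def)
    \<comment> \<open>The telescoped form of \<open>formal_mult f' g' - formal_mult f g\<close>: one
      factor is exchanged at a time.\<close>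
    then have "formal_mult (f' - f) g' + formal_mult f (g' - g) \<in> null_tensors s"
      by (intro null_add null_mult_left null_mult_right)
    then show ?thesis by (simp add: L.diff R.diff tensor_class_eq_iff)
  qed
  then have "tensor_class s f \<boxtimes> tensor_class s g
      = (\<Union>f'\<in>tensor_class s f. \<Union>g'\<in>tensor_class s g. tensor_class s (formal_mult f g))"
    unfolding tensor_mult_def by (intro SUP_cong HOL.refl)
  moreover have "tensor_class s f \<noteq> {}" "tensor_class s g \<noteq> {}"
    using tensor_class_self[of f s] tensor_class_self[of g s] by blast+
  ultimately show ?thesis by simp
qed

lemma mem_tensor_add: "h \<in> A \<boxplus> B \<longleftrightarrow> (\<exists>f\<in>A. \<exists>g\<in>B. h - (f + g) \<in> null_tensors s)"
  by (simp add: tensor_add_def tensor_class_def)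

text \<open>Argued elementwise for arbitrary sets of formal tensors, as is associativity. Rewriting
  with \<open>tensor_add_ac\<close> therefore produces no side conditions.\<close>

lemma tensor_add_commute: "A \<boxplus> B = B \<boxplus> A"
proof -
  have "A \<boxplus> B \<subseteq> B \<boxplus> A" for A B
  proof
    fix h assume "h \<in> A \<boxplus> B"
    then obtain f g where "f \<in> A" "g \<in> B" "h - (f + g) \<in> null_tensors s"
      unfolding mem_tensor_add by blast
    then show "h \<in> B \<boxplus> A"
      unfolding mem_tensor_add by (intro bexI[of _ g] bexI[of _ f]) (simp_all add: add.commute)
  qed
  then show ?thesis by blast
qed

lemma tensor_add_assoc: "(A \<boxplus> B) \<boxplus> C = A \<boxplus> (B \<boxplus> C)"
proof (intro Set.set_eqI iffI)
  fix k assume "k \<in> (A \<boxplus> B) \<boxplus> C"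
  then obtain h c where "h \<in> A \<boxplus> B" "c \<in> C" and k: "k - (h + c) \<in> null_tensors s"
    unfolding mem_tensor_add[of k] by blast
  then obtain a b where ab: "a \<in> A" "b \<in> B" "h - (a + b) \<in> null_tensors s" by (auto simp: mem_tensor_add)
  have "b + c \<in> B \<boxplus> C" using \<open>b \<in> B\<close> \<open>c \<in> C\<close> null_zero[of s] unfolding mem_tensor_add by force
  moreover have "k - (a + (b + c)) \<in> null_tensors s"
    using null_add[OF k ab(3)] by (simp add: algebra_simps)
  ultimately show "k \<in> A \<boxplus> (B \<boxplus> C)" unfolding mem_tensor_add[of k] using ab by blast
next
  fix k assume "k \<in> A \<boxplus> (B \<boxplus> C)"
  then obtain a h where "h \<in> B \<boxplus> C" "a \<in> A" and k: "k - (a + h) \<in> null_tensors s"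
    unfolding mem_tensor_add[of k] by blast
  then obtain b c where bc: "b \<in> B" "c \<in> C" "h - (b + c) \<in> null_tensors s" by (auto simp: mem_tensor_add)
  have "a + b \<in> A \<boxplus> B" using \<open>b \<in> B\<close> \<open>a \<in> A\<close> null_zero[of s] unfolding mem_tensor_add by force
  moreover have "k - ((a + b) + c) \<in> null_tensors s"
    using null_add[OF k bc(3)] by (simp add: algebra_simps)
  ultimately show "k \<in> (A \<boxplus> B) \<boxplus> C" unfolding mem_tensor_add[of k] using bc by blast
qed

lemma tensor_add_left_commute: "A \<boxplus> (B \<boxplus> C) = B \<boxplus> (A \<boxplus> C)"
  by (metis tensor_add_assoc tensor_add_commute)

lemmas tensor_add_ac = tensor_add_assoc tensor_add_commute tensor_add_left_commute

lemma tensor_power_range: "A \<in> tensor_power s m \<Longrightarrow> A \<in> range (tensor_class s)"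
  by (auto simp: tensor_power_def)

lemma tensor_zero_in: "\<zero>\<^sub>t \<in> tensor_power s m"
  unfolding tensor_power_def by (rule imageI) simp

text \<open>Adding zero to an arbitrary set saturates it under \<open>null_tensors\<close>; a coset
  is already saturated.\<close>

lemma tensor_add_zero:
  assumes "A \<in> range (tensor_class s)"
  shows "A \<boxplus> \<zero>\<^sub>t = A" "\<zero>\<^sub>t \<boxplus> A = A"
  using assms by (auto simp: tensor_add_class)

lemma tensor_add_range:
  "A \<in> range (tensor_class s) \<Longrightarrow> B \<in> range (tensor_class s) \<Longrightarrow> A \<boxplus> B \<in> range (tensor_class s)"
  by (auto simp: tensor_add_class)

lemma tensor_scale_range:
  "A \<in> range (tensor_class s) \<Longrightarrow> tensor_scale s c A \<in> range (tensor_class s)"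
  by (auto simp: tensor_scale_class)

lemma tensor_mult_range:
  "A \<in> range (tensor_class s) \<Longrightarrow> B \<in> range (tensor_class s) \<Longrightarrow> A \<boxtimes> B \<in> range (tensor_class s)"
  by (auto simp: tensor_mult_class)

lemma tensor_scale_add:
  assumes "A \<in> range (tensor_class s)" "B \<in> range (tensor_class s)"
  shows "tensor_scale s c (A \<boxplus> B) = tensor_scale s c A \<boxplus> tensor_scale s c B"
  using assms by (auto simp: tensor_add_class tensor_scale_class formal.scale_right_distrib)

lemma tensor_scale_scale:
  assumes "A \<in> range (tensor_class s)"
  shows "tensor_scale s c (tensor_scale s d A) = tensor_scale s (c * d) A"
  using assms by (auto simp: tensor_scale_class formal_scale_scale)

lemma tensor_add_scale_minus_one:
  assumes "A \<in> range (tensor_class s)"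
  shows "A \<boxplus> tensor_scale s (- 1) A = \<zero>\<^sub>t"
  using assms by (auto simp: tensor_scale_class tensor_add_class)

lemma tensor_mult_add_left:
  assumes "A \<in> range (tensor_class s)" "B \<in> range (tensor_class s)" "C \<in> range (tensor_class s)"
  shows "(A \<boxplus> B) \<boxtimes> C = (A \<boxtimes> C) \<boxplus> (B \<boxtimes> C)"
proof -
  interpret L: Vector_Spaces.linear formal_scale formal_scale "\<lambda>p :: ('x, 'k) formal_tensor. formal_mult p q" for q
    by (rule linear_formal_mult_left)
  show ?thesis using assms by (auto simp: tensor_add_class tensor_mult_class L.add)
qed

lemma tensor_mult_add_right:
  assumes "A \<in> range (tensor_class s)" "B \<in> range (tensor_class s)" "C \<in> range (tensor_class s)"
  shows "C \<boxtimes> (A \<boxplus> B) = (C \<boxtimes> A) \<boxplus> (C \<boxtimes> B)"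
proof -
  interpret R: Vector_Spaces.linear formal_scale formal_scale "\<lambda>q :: ('x, 'k) formal_tensor. formal_mult p q" for p
    by (rule linear_formal_mult_right)
  show ?thesis using assms by (auto simp: tensor_add_class tensor_mult_class R.add)
qed

lemma tensor_mult_scale_left:
  assumes "A \<in> range (tensor_class s)" "C \<in> range (tensor_class s)"
  shows "tensor_scale s c A \<boxtimes> C = tensor_scale s c (A \<boxtimes> C)"
proof -
  interpret L: Vector_Spaces.linear formal_scale formal_scale "\<lambda>p :: ('x, 'k) formal_tensor. formal_mult p q" for q
    by (rule linear_formal_mult_left)
  show ?thesis using assms by (auto simp: tensor_scale_class tensor_mult_class L.scale)
qed

lemma tensor_mult_scale_right:
  assumes "A \<in> range (tensor_class s)" "C \<in> range (tensor_class s)"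
  shows "C \<boxtimes> tensor_scale s c A = tensor_scale s c (C \<boxtimes> A)"
proof -
  interpret R: Vector_Spaces.linear formal_scale formal_scale "\<lambda>q :: ('x, 'k) formal_tensor. formal_mult p q" for p
    by (rule linear_formal_mult_right)
  show ?thesis using assms by (auto simp: tensor_scale_class tensor_mult_class R.scale)
qed

lemma tensor_mult_zero:
  assumes "A \<in> range (tensor_class s)"
  shows "A \<boxtimes> \<zero>\<^sub>t = \<zero>\<^sub>t" "\<zero>\<^sub>t \<boxtimes> A = \<zero>\<^sub>t"
  using assms by (auto simp: tensor_mult_class formal_mult_def)

lemma pure_range: "pure s xs \<in> range (tensor_class s)"
  by (simp add: pure_def)

lemma pure_mult: "pure s xs \<boxtimes> pure s ys = pure s (xs @ ys)"
  by (simp add: pure_def tensor_mult_class formal_mult_single)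

lemma pure_add: "pure s (us @ [x + y] @ vs) = pure s (us @ [x] @ vs) \<boxplus> pure s (us @ [y] @ vs)"
proof -
  have "Poly_Mapping.single (us @ [x + y] @ vs) 1
        - Poly_Mapping.single (us @ [x] @ vs) 1 - Poly_Mapping.single (us @ [y] @ vs) 1 \<in> null_tensors s"
    unfolding null_tensors_def multilinearity_relations_def by (rule formal.span_base) blast
  then show ?thesis by (simp add: pure_def tensor_add_class tensor_class_eq_iff diff_diff_eq)
qed

lemma pure_scale: "pure s (us @ [s c x] @ vs) = tensor_scale s c (pure s (us @ [x] @ vs))"
proof -
  have "Poly_Mapping.single (us @ [s c x] @ vs) 1 - Poly_Mapping.single (us @ [x] @ vs) c \<in> null_tensors s"
    unfolding null_tensors_def multilinearity_relations_def by (rule formal.span_base) blast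
  then show ?thesis by (simp add: pure_def tensor_scale_class formal_scale_single tensor_class_eq_iff)
qed

lemma tensor_mult_in:
  assumes "A \<in> tensor_power s m" "B \<in> tensor_power s n"
  shows "A \<boxtimes> B \<in> tensor_power s (m + n)"
  using assms(1)
proof (induction rule: tensor_power_induct)
  case zero
  then show ?case using tensor_power_range[OF assms(2)] by (simp add: tensor_mult_zero tensor_zero_in)
next
  case (step c xs A)
  have "pure s xs \<boxtimes> B \<in> tensor_power s (m + n)"
    using assms(2)
  proof (induction rule: tensor_power_induct)
    case zero
    then show ?case by (simp add: tensor_mult_zero tensor_zero_in pure_range)
  next
    case (step d ys B)
    then show ?case using \<open>length xs = m\<close>
      by (simp add: tensor_mult_add_right tensor_mult_scale_right pure_range tensor_power_range
          tensor_scale_range pure_mult tensor_add_in tensor_scale_in pure_in_tensor_power)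
  qed
  with step show ?case using assms(2)
    by (simp add: tensor_mult_add_left tensor_mult_scale_left pure_range tensor_power_range
          tensor_scale_range tensor_add_in tensor_scale_in)
qed

lemma formal_mult_assoc:
  fixes f g h :: "('x, 'k) formal_tensor"
  shows "formal_mult (formal_mult f g) h = formal_mult f (formal_mult g h)"
proof -
  interpret L: Vector_Spaces.linear formal_scale formal_scale "\<lambda>p :: ('x, 'k) formal_tensor. formal_mult p q" for q
    by (rule linear_formal_mult_left)
  interpret R: Vector_Spaces.linear formal_scale formal_scale "\<lambda>q :: ('x, 'k) formal_tensor. formal_mult p q" for p
    by (rule linear_formal_mult_right)
  have 1: "formal_mult (Poly_Mapping.single (xs @ ys) 1) h
      = formal_mult (Poly_Mapping.single xs 1) (formal_mult (Poly_Mapping.single ys 1) h)" for xs ys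
    by (induction h rule: formal_tensor_induct) (simp_all add: R.zero R.add R.scale formal_mult_single)
  have 2: "formal_mult (formal_mult (Poly_Mapping.single xs 1) g) h
      = formal_mult (Poly_Mapping.single xs 1) (formal_mult g h)" for xs
    by (induction g rule: formal_tensor_induct)
      (simp_all add: L.zero R.zero L.add R.add L.scale R.scale formal_mult_single 1)
  show ?thesis
    by (induction f rule: formal_tensor_induct) (simp_all add: L.zero L.add L.scale 2)
qed

text \<open>Associativity is an equality and not merely an isomorphism: concatenation of words is
  associative, and all degrees live in one type.\<close>

lemma tensor_mult_assoc:
  assumes "A \<in> range (tensor_class s)" "B \<in> range (tensor_class s)" "C \<in> range (tensor_class s)"
  shows "(A \<boxtimes> B) \<boxtimes> C = A \<boxtimes> (B \<boxtimes> C)"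
  using assms by (auto simp: tensor_mult_class formal_mult_assoc)

end

section \<open>Linear maps between tensor powers, their tensor products and paddings\<close>

section \<open>Endomorphisms and automorphisms of tensor powers\<close>

context tensor_space
begin

lemma tensor_linear_add:
  "tensor_linear s m f \<Longrightarrow> u \<in> tensor_power s m \<Longrightarrow> v \<in> tensor_power s m
    \<Longrightarrow> f (tensor_add s u v) = tensor_add s (f u) (f v)"
  by (simp add: tensor_linear_def)

lemma tensor_linear_scale:
  "tensor_linear s m f \<Longrightarrow> u \<in> tensor_power s m
    \<Longrightarrow> f (tensor_scale s c u) = tensor_scale s c (f u)"
  by (simp add: tensor_linear_def)

lemma tensor_linear_into:
  assumes f: "tensor_linear s m f" and pure: "\<And>xs. length xs = m \<Longrightarrow> f (pure s xs) \<in> tensor_power s p"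
  shows "f \<in> tensor_power s m \<rightarrow> tensor_power s p"
proof
  fix u assume "u \<in> tensor_power s m"
  then show "f u \<in> tensor_power s p"
  proof (induction rule: tensor_power_induct)
    case zero
    show ?case by (subst tensor_linear_zero[OF f]) (simp add: pure tensor_scale_in)
  next
    case (step c xs u)
    then show ?case
      by (simp add: tensor_linear_add[OF f] tensor_linear_scale[OF f] pure pure_in_tensor_power
          tensor_scale_in tensor_add_in)
  qed
qed

lemma tensor_linear_comp:
  assumes "tensor_linear s m f" "f \<in> tensor_power s m \<rightarrow> tensor_power s p" "tensor_linear s p g"
  shows "tensor_linear s m (\<lambda>u. g (f u))"
  using assms unfolding tensor_linear_def by (auto simp: Pi_iff)

lemma tensor_linear_mult_left:
  "C \<in> range (tensor_class s) \<Longrightarrow> tensor_linear s m (\<lambda>u. tensor_mult s C u)"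
  unfolding tensor_linear_def
  by (simp add: tensor_mult_add_right tensor_mult_scale_right tensor_power_range)

lemma tensor_linear_mult_right:
  "C \<in> range (tensor_class s) \<Longrightarrow> tensor_linear s m (\<lambda>u. tensor_mult s u C)"
  unfolding tensor_linear_def
  by (simp add: tensor_mult_add_left tensor_mult_scale_left tensor_power_range)

lemma tensor_linear_id: "tensor_linear s m id"
  by (simp add: tensor_linear_def)

lemma multilinear_pure: "multilinear s m (pure s)"
  using pure_add pure_scale by (simp add: multilinear_def)

lemma multilinear_comp:
  assumes "multilinear s m \<phi>" "\<And>xs. length xs = m \<Longrightarrow> \<phi> xs \<in> tensor_power s p" "tensor_linear s p f"
  shows "multilinear s m (\<lambda>xs. f (\<phi> xs))"
  using assms by (simp add: multilinear_def tensor_linear_def)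

lemma multilinear_mult:
  assumes \<phi>: "multilinear s m \<phi>" "\<And>xs. length xs = m \<Longrightarrow> \<phi> xs \<in> range (tensor_class s)"
    and \<psi>: "multilinear s n \<psi>" "\<And>xs. length xs = n \<Longrightarrow> \<psi> xs \<in> range (tensor_class s)"
  shows "multilinear s (m + n) (\<lambda>xs. tensor_mult s (\<phi> (take m xs)) (\<psi> (drop m xs)))"
proof -
  let ?F = "\<lambda>xs. tensor_mult s (\<phi> (take m xs)) (\<psi> (drop m xs))"
  have "?F (us @ [x + y] @ vs) = tensor_add s (?F (us @ [x] @ vs)) (?F (us @ [y] @ vs)) \<and>
    ?F (us @ [s c x] @ vs) = tensor_scale s c (?F (us @ [x] @ vs))"
    if len: "length us + length vs + 1 = m + n" for us vs x y c
  proof (cases "length us < m")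
    case True
    \<comment> \<open>The varied slot lies in the first block; \<open>k\<close> counts the entries
      of that block behind it, so the cut after \<open>m\<close> entries falls inside
      \<open>vs\<close>.\<close>
    then obtain k where m: "m = length us + Suc k" using less_imp_Suc_add by fastforce
    have t: "take m (us @ [z] @ vs) = us @ [z] @ take k vs" "drop m (us @ [z] @ vs) = drop k vs" for z
      by (simp_all add: m)
    have l: "length us + length (take k vs) + 1 = m" "length (drop k vs) = n"
      using len m by auto
    from l \<phi>(1) have "\<phi> (us @ [x + y] @ take k vs) = tensor_add s (\<phi> (us @ [x] @ take k vs)) (\<phi> (us @ [y] @ take k vs))"
      "\<phi> (us @ [s c x] @ take k vs) = tensor_scale s c (\<phi> (us @ [x] @ take k vs))"
      unfolding multilinear_def by blast+
    moreover have "\<phi> (us @ [z] @ take k vs) \<in> range (tensor_class s)" for z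
      by (rule \<phi>(2)) (use l in simp)
    ultimately show ?thesis unfolding t
      using \<psi>(2)[OF l(2)] by (simp only: tensor_mult_add_left tensor_mult_scale_left simp_thms)
  next
    case False
    have t: "take m (us @ [z] @ vs) = take m us" "drop m (us @ [z] @ vs) = drop m us @ [z] @ vs" for z
      using False by simp_all
    have l: "length (drop m us) + length vs + 1 = n" "length (take m us) = m"
      using len False by auto
    from l \<psi>(1) have "\<psi> (drop m us @ [x + y] @ vs) = tensor_add s (\<psi> (drop m us @ [x] @ vs)) (\<psi> (drop m us @ [y] @ vs))"
      "\<psi> (drop m us @ [s c x] @ vs) = tensor_scale s c (\<psi> (drop m us @ [x] @ vs))"
      unfolding multilinear_def by blast+
    moreover have "\<psi> (drop m us @ [z] @ vs) \<in> range (tensor_class s)" for z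
      by (rule \<psi>(2)) (use l in simp)
    ultimately show ?thesis unfolding t
      using \<phi>(2)[OF l(2)] by (simp only: tensor_mult_add_right tensor_mult_scale_right simp_thms)
  qed
  then show ?thesis unfolding multilinear_def by blast
qed

text \<open>Pure tensors are replaced one argument at a time: the right factor is made general while
  the left is pure, then the left one for that fixed \<open>B\<close>. This is why linearity on the
  right is asked for at pure tensors and linearity on the left for every \<open>B\<close>.\<close>

lemma bilinear_eq_mult:
  assumes f: "tensor_linear s (m + n) f"
    and h1: "\<And>xs. length xs = m \<Longrightarrow> tensor_linear s n (h (pure s xs))"
    and h2: "\<And>B. B \<in> tensor_power s n \<Longrightarrow> tensor_linear s m (\<lambda>A. h A B)"
    and pure: "\<And>xs ys. length xs = m \<Longrightarrow> length ys = n
      \<Longrightarrow> f (pure s (xs @ ys)) = h (pure s xs) (pure s ys)"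
    and A: "A \<in> tensor_power s m" and B: "B \<in> tensor_power s n"
  shows "f (tensor_mult s A B) = h A B"
proof (rule tensor_lift_unique[OF _ h2[OF B] _ A])
  show "tensor_linear s m (\<lambda>A. f (tensor_mult s A B))"
    by (rule tensor_linear_comp[OF tensor_linear_mult_right _ f])
      (use B in \<open>auto intro: tensor_mult_in tensor_power_range\<close>)
  fix xs :: "'x list" assume xs: "length xs = m"
  show "f (tensor_mult s (pure s xs) B) = h (pure s xs) B"
  proof (rule tensor_lift_unique[OF _ h1[OF xs] _ B])
    show "tensor_linear s n (\<lambda>B. f (tensor_mult s (pure s xs) B))"
      by (rule tensor_linear_comp[OF tensor_linear_mult_left _ f])
        (use xs in \<open>auto intro: tensor_mult_in pure_in_tensor_power pure_range\<close>)
  qed (simp add: pure_mult pure xs)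
qed

lemma
  assumes f: "tensor_linear s m f" "f \<in> tensor_power s m \<rightarrow> tensor_power s p"
    and g: "tensor_linear s n g" "g \<in> tensor_power s n \<rightarrow> tensor_power s q"
  shows tensor_map_extensional: "tensor_map s m n f g \<in> extensional (tensor_power s (m + n))"
    and tensor_map_linear: "tensor_linear s (m + n) (tensor_map s m n f g)"
    and tensor_map_mult: "A \<in> tensor_power s m \<Longrightarrow> B \<in> tensor_power s n
      \<Longrightarrow> tensor_map s m n f g (tensor_mult s A B) = tensor_mult s (f A) (g B)"
    and tensor_map_funcset: "tensor_map s m n f g \<in> tensor_power s (m + n) \<rightarrow> tensor_power s (p + q)"
proof -
  let ?\<phi> = "\<lambda>xs. tensor_mult s (f (pure s (take m xs))) (g (pure s (drop m xs)))"
  have f': "f u \<in> tensor_power s p" if "u \<in> tensor_power s m" for u using f(2) that by auto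
  have g': "g u \<in> tensor_power s q" if "u \<in> tensor_power s n" for u using g(2) that by auto
  have ml: "multilinear s (m + n) ?\<phi>"
    by (intro multilinear_mult[of m "\<lambda>xs. f (pure s xs)" n "\<lambda>xs. g (pure s xs)"]
        multilinear_comp[OF multilinear_pure _ f(1)] multilinear_comp[OF multilinear_pure _ g(1)])
      (auto intro!: tensor_power_range f' g' pure_in_tensor_power)
  have in_pq: "?\<phi> xs \<in> tensor_power s (p + q)" if "length xs = m + n" for xs
    using that by (intro tensor_mult_in f' g' pure_in_tensor_power) auto
  note * = ml tensor_power_range[OF in_pq]
  note lin = tensor_lift_linear[OF *] and lift = tensor_lift_pure[OF *]
  show "tensor_map s m n f g \<in> extensional (tensor_power s (m + n))"
    and lin': "tensor_linear s (m + n) (tensor_map s m n f g)"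
    unfolding tensor_map_def by (intro tensor_lift_extensional lin * | simp)+
  show "tensor_map s m n f g \<in> tensor_power s (m + n) \<rightarrow> tensor_power s (p + q)"
    by (rule tensor_linear_into[OF lin']) (simp add: tensor_map_def lift in_pq)
  assume A: "A \<in> tensor_power s m" and B: "B \<in> tensor_power s n"
  show "tensor_map s m n f g (tensor_mult s A B) = tensor_mult s (f A) (g B)"
  proof (rule bilinear_eq_mult[OF lin' _ _ _ A B, where h = "\<lambda>A B. tensor_mult s (f A) (g B)"])
    show "tensor_linear s n (\<lambda>B. tensor_mult s (f (pure s xs)) (g B))" if "length xs = m" for xs
      by (rule tensor_linear_comp[OF g tensor_linear_mult_left])
        (use that in \<open>simp add: tensor_power_range[OF f'] pure_in_tensor_power\<close>)
    show "tensor_linear s m (\<lambda>A. tensor_mult s (f A) (g B))" if "B \<in> tensor_power s n" for B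
      by (rule tensor_linear_comp[OF f tensor_linear_mult_right])
        (use that in \<open>auto intro: tensor_power_range g'\<close>)
  qed (simp add: tensor_map_def lift)
qed

text \<open>Extensionality is built in, as in \<open>Bij\<close>, so that agreement on pure tensors
  gives equality of functions and not just equality on the tensor power.\<close>

definition tensor_End :: "nat \<Rightarrow> (('x, 'k) tensor \<Rightarrow> ('x, 'k) tensor) set" where
  "tensor_End m = {f \<in> extensional (tensor_power s m) \<inter> (tensor_power s m \<rightarrow> tensor_power s m). tensor_linear s m f}"

lemma tensor_EndD:
  assumes "f \<in> tensor_End m"
  shows "f \<in> extensional (tensor_power s m)" "f \<in> tensor_power s m \<rightarrow> tensor_power s m"
    "tensor_linear s m f" "u \<in> tensor_power s m \<Longrightarrow> f u \<in> tensor_power s m"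
  using assms by (auto simp: tensor_End_def)

lemma tensor_End_eq_pureI:
  assumes "f \<in> tensor_End m" "g \<in> tensor_End m" "\<And>xs. length xs = m \<Longrightarrow> f (pure s xs) = g (pure s xs)"
  shows "f = g"
proof (rule extensionalityI[of _ "tensor_power s m"])
  show "f u = g u" if "u \<in> tensor_power s m" for u
    by (rule tensor_lift_unique[OF assms(1,2)[THEN tensor_EndD(3)] assms(3) that])
qed (use assms in \<open>auto dest: tensor_EndD\<close>)

lemma tensor_End_eqI:
  assumes f: "f \<in> tensor_End (a + m + b)" and g: "g \<in> tensor_End (a + m + b)"
    and pure: "\<And>us vs ws. length us = a \<Longrightarrow> length vs = m \<Longrightarrow> length ws = b \<Longrightarrow>
      f (tensor_mult s (tensor_mult s (pure s us) (pure s vs)) (pure s ws))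
        = g (tensor_mult s (tensor_mult s (pure s us) (pure s vs)) (pure s ws))"
  shows "f = g"
proof (rule tensor_End_eq_pureI[OF f g])
  fix xs :: "'x list" assume "length xs = a + m + b"
  then show "f (pure s xs) = g (pure s xs)"
    using pure[of "take a xs" "take m (drop a xs)" "drop (a + m) xs"]
    by (simp add: pure_mult flip: take_add)
qed

lemma
  assumes f: "f \<in> tensor_End m"
  shows tensor_pad_End: "tensor_pad s a m f b \<in> tensor_End (a + m + b)"
    and tensor_pad_mult: "A \<in> tensor_power s a \<Longrightarrow> B \<in> tensor_power s m \<Longrightarrow> C \<in> tensor_power s b \<Longrightarrow>
      tensor_pad s a m f b (tensor_mult s (tensor_mult s A B) C) = tensor_mult s (tensor_mult s A (f B)) C"
proof -
  \<comment> \<open>\<open>id\<close> is in general not extensional on a tensor power and so not a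
    member of \<open>tensor_End\<close>. The facts about \<open>tensor_map\<close> ask only for
    linearity and a range, which \<open>id\<close> has.\<close>
  have id: "id \<in> tensor_power s n \<rightarrow> tensor_power s n" for n by auto
  note l = tensor_linear_id id tensor_EndD(3,2)[OF f]
  note l' = tensor_map_linear[OF l, of a] tensor_map_funcset[OF l, of a] tensor_linear_id[of b] id[of b]
  show "tensor_pad s a m f b \<in> tensor_End (a + m + b)"
    unfolding tensor_End_def tensor_pad_def
    using tensor_map_extensional[OF l'] tensor_map_linear[OF l'] tensor_map_funcset[OF l'] by simp
  show "tensor_pad s a m f b (tensor_mult s (tensor_mult s A B) C) = tensor_mult s (tensor_mult s A (f B)) C"
    if "A \<in> tensor_power s a" "B \<in> tensor_power s m" "C \<in> tensor_power s b"
    unfolding tensor_pad_def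
    using that by (simp add: tensor_map_mult[OF l'] tensor_map_mult[OF l] tensor_mult_in)
qed

lemma tensor_pad_pure:
  assumes "f \<in> tensor_End m" "length us = a" "length vs = m" "length ws = b"
  shows "tensor_pad s a m f b (pure s (us @ vs @ ws)) = pure s us \<boxtimes> f (pure s vs) \<boxtimes> pure s ws"
  using tensor_pad_mult[OF assms(1) assms(2-4)[THEN pure_in_tensor_power]] by (simp add: pure_mult)

lemma compose_End:
  assumes "f \<in> tensor_End m" "g \<in> tensor_End m"
  shows "compose (tensor_power s m) f g \<in> tensor_End m"
  using assms unfolding tensor_End_def
  by (auto simp: compose_def tensor_linear_def tensor_add_in tensor_scale_in Pi_iff)

lemma id_End: "(\<lambda>u\<in>tensor_power s m. u) \<in> tensor_End m"
  unfolding tensor_End_def by (auto simp: tensor_linear_def tensor_add_in tensor_scale_in)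

lemma tensor_pad_compose:
  assumes f: "f \<in> tensor_End m" and g: "g \<in> tensor_End m"
  shows "tensor_pad s a m (compose (tensor_power s m) f g) b
    = compose (tensor_power s (a + m + b)) (tensor_pad s a m f b) (tensor_pad s a m g b)"
proof (rule tensor_End_eqI)
  fix us vs ws :: "'x list" assume "length us = a" "length vs = m" "length ws = b"
  note pure = this[THEN pure_in_tensor_power[of _ _ s]]
  show "tensor_pad s a m (compose (tensor_power s m) f g) b
      (tensor_mult s (tensor_mult s (pure s us) (pure s vs)) (pure s ws))
    = compose (tensor_power s (a + m + b)) (tensor_pad s a m f b) (tensor_pad s a m g b)
      (tensor_mult s (tensor_mult s (pure s us) (pure s vs)) (pure s ws))"
    using pure tensor_EndD(4)[OF g pure(2)]
    by (simp add: tensor_pad_mult compose_End f g compose_eq tensor_mult_in)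
qed (intro tensor_pad_End compose_End f g)+

lemma tensor_pad_id:
  "tensor_pad s a m (\<lambda>u\<in>tensor_power s m. u) b = (\<lambda>u\<in>tensor_power s (a + m + b). u)"
  by (rule tensor_End_eqI[where a = a and m = m and b = b])
    (simp_all add: tensor_pad_End id_End tensor_pad_mult tensor_mult_in pure_in_tensor_power)

text \<open>Both the transport of local relations and the compatibility with stabilisation rest on
  merging paddings. The sizes enter through equations so that instances with numerals and truncated
  differences fit.\<close>

lemma tensor_pad_pad:
  assumes f: "f \<in> tensor_End m" and "M = a + m + b" "c = a' + a" "d = b + b'"
  shows "tensor_pad s a' M (tensor_pad s a m f b) b' = tensor_pad s c m f d"
  unfolding assms(2-4)
proof (rule tensor_End_eqI)
  show "tensor_pad s (a' + a) m f (b + b') \<in> tensor_End ((a' + a) + m + (b + b'))"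
    by (rule tensor_pad_End[OF f])
  show "tensor_pad s a' (a + m + b) (tensor_pad s a m f b) b' \<in> tensor_End ((a' + a) + m + (b + b'))"
    using tensor_pad_End[OF tensor_pad_End[OF f, of a b], of a' b'] by (simp add: add_ac)
  fix us vs ws :: "'x list" assume l: "length us = a' + a" "length vs = m" "length ws = b + b'"
  define us1 us2 ws1 ws2 where "us1 = take a' us" "us2 = drop a' us" "ws1 = take b ws" "ws2 = drop b ws"
  have e: "us = us1 @ us2" "ws = ws1 @ ws2" and l': "length us1 = a'" "length us2 = a" "length ws1 = b" "length ws2 = b'"
    using l by (auto simp: us1_us2_ws1_ws2_def)
  let ?U = "tensor_mult s (tensor_mult s (pure s us2) (pure s vs)) (pure s ws1)"
  have fv: "f (pure s vs) \<in> tensor_power s m"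
    using l by (simp add: tensor_EndD(4)[OF f] pure_in_tensor_power)
  have "tensor_pad s a' (a + m + b) (tensor_pad s a m f b) b'
      (tensor_mult s (tensor_mult s (pure s us1) ?U) (pure s ws2))
    = tensor_mult s (tensor_mult s (pure s us1)
        (tensor_mult s (tensor_mult s (pure s us2) (f (pure s vs))) (pure s ws1))) (pure s ws2)"
    using l l' by (simp add: tensor_pad_mult tensor_pad_End f tensor_mult_in pure_in_tensor_power)
  also have "\<dots> = tensor_mult s (tensor_mult s (pure s us) (f (pure s vs))) (pure s ws)"
    using tensor_power_range[OF fv]
    by (simp add: e tensor_mult_assoc tensor_mult_range pure_range flip: pure_mult)
  also have "\<dots> = tensor_pad s (a' + a) m f (b + b') (tensor_mult s (tensor_mult s (pure s us) (pure s vs)) (pure s ws))"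
    using l by (simp add: tensor_pad_mult f pure_in_tensor_power)
  finally show "tensor_pad s a' (a + m + b) (tensor_pad s a m f b) b'
      (tensor_mult s (tensor_mult s (pure s us) (pure s vs)) (pure s ws)) = \<dots>"
    by (simp add: pure_mult e)
qed

text \<open>The empty pure tensor is the unit of the tensor algebra; this is what makes padding by
  zero factors disappear.\<close>

lemma pure_Nil_mult:
  assumes A: "A \<in> tensor_power s m"
  shows "tensor_mult s (pure s []) A = A" "tensor_mult s A (pure s []) = A"
proof -
  have "tensor_mult s (pure s []) A = id A"
    by (rule tensor_lift_unique[OF tensor_linear_mult_left tensor_linear_id _ A])
      (simp_all add: pure_range pure_mult)
  moreover have "tensor_mult s A (pure s []) = id A"
    by (rule tensor_lift_unique[OF tensor_linear_mult_right tensor_linear_id _ A])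
      (simp_all add: pure_range pure_mult)
  ultimately show "tensor_mult s (pure s []) A = A" "tensor_mult s A (pure s []) = A" by auto
qed

text \<open>\<open>Aut_incl\<close> is defined through \<open>tensor_map\<close>, the generators
  through \<open>tensor_pad\<close>. Removing a left padding by zero factors reconciles the two;
  \<open>f\<close> is extensional, so the result is an equality of functions.\<close>

lemma tensor_map_0_left:
  assumes f: "f \<in> tensor_End m"
  shows "tensor_map s 0 m id f = f"
proof -
  have "id \<in> tensor_power s 0 \<rightarrow> tensor_power s 0" by auto
  note l = tensor_linear_id this tensor_EndD(3,2)[OF f]
  have nil: "pure s [] \<in> tensor_power s 0" by (simp add: pure_in_tensor_power)
  show ?thesis
  proof (rule extensionalityI[of _ "tensor_power s m"])
    show "tensor_map s 0 m id f \<in> extensional (tensor_power s m)"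
      using tensor_map_extensional[OF l] by simp
    show "tensor_map s 0 m id f u = f u" if "u \<in> tensor_power s m" for u
      using tensor_map_mult[OF l nil that] pure_Nil_mult[OF that] pure_Nil_mult[OF tensor_EndD(4)[OF f that]]
      by simp
  qed (rule tensor_EndD(1)[OF f])
qed

lemma tensor_pad_0_left:
  "f \<in> tensor_End m \<Longrightarrow> tensor_pad s 0 m f b = tensor_map s m b f id"
  by (simp add: tensor_pad_def tensor_map_0_left)

text \<open>The interchange law: on a product of five blocks both composites apply \<open>f\<close>
  to the second and \<open>g\<close> to the fourth. The work consists of rebracketing.\<close>

lemma tensor_pad_commute:
  assumes f: "f \<in> tensor_End m" and g: "g \<in> tensor_End m'" and N: "N = a + m + c + m' + b"
  shows "compose (tensor_power s N) (tensor_pad s a m f (c + m' + b)) (tensor_pad s (a + m + c) m' g b)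
    = compose (tensor_power s N) (tensor_pad s (a + m + c) m' g b) (tensor_pad s a m f (c + m' + b))"
proof (rule tensor_End_eqI[where a = "a + m + c" and m = m' and b = b])
  have F: "tensor_pad s a m f (c + m' + b) \<in> tensor_End N"
    using tensor_pad_End[OF f, of a "c + m' + b"] by (simp add: N add_ac)
  have G: "tensor_pad s (a + m + c) m' g b \<in> tensor_End N"
    using tensor_pad_End[OF g, of "a + m + c" b] by (simp add: N)
  show "compose (tensor_power s N) (tensor_pad s a m f (c + m' + b)) (tensor_pad s (a + m + c) m' g b)
      \<in> tensor_End (a + m + c + m' + b)"
    and "compose (tensor_power s N) (tensor_pad s (a + m + c) m' g b) (tensor_pad s a m f (c + m' + b))
      \<in> tensor_End (a + m + c + m' + b)"
    using compose_End[OF F G] compose_End[OF G F] by (simp_all add: N)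
  fix us vs ws :: "'x list" assume l: "length us = a + m + c" "length vs = m'" "length ws = b"
  define A B C where "A = pure s (take a us)" "B = pure s (take m (drop a us))" "C = pure s (drop (a + m) us)"
  define D E where "D = pure s vs" "E = pure s ws"
  have us: "pure s us = A \<boxtimes> B \<boxtimes> C"
    by (simp add: A_B_C_def pure_mult flip: take_add)
  have P: "A \<in> tensor_power s a" "B \<in> tensor_power s m" "C \<in> tensor_power s c"
    "D \<in> tensor_power s m'" "E \<in> tensor_power s b"
    using l by (simp_all add: A_B_C_def D_E_def pure_in_tensor_power)
  have P': "f B \<in> tensor_power s m" "g D \<in> tensor_power s m'"
    using P f g by (simp_all add: tensor_EndD(4))
  note r = P[THEN tensor_power_range] P'[THEN tensor_power_range]
  \<comment> \<open>The left-nested product suits the map acting further right. For the map further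
    left, everything behind its block has to be grouped as one right-hand factor.\<close>
  have re: "A \<boxtimes> X \<boxtimes> C \<boxtimes> Y \<boxtimes> E = A \<boxtimes> X \<boxtimes> (C \<boxtimes> Y \<boxtimes> E)"
    if "X \<in> range (tensor_class s)" "Y \<in> range (tensor_class s)" for X Y
    using r that by (simp add: tensor_mult_assoc tensor_mult_range)
  have f1: "tensor_pad s a m f (c + m' + b) (A \<boxtimes> B \<boxtimes> C \<boxtimes> Y \<boxtimes> E) = A \<boxtimes> f B \<boxtimes> C \<boxtimes> Y \<boxtimes> E"
    if "Y \<in> tensor_power s m'" for Y
  proof -
    have "C \<boxtimes> Y \<boxtimes> E \<in> tensor_power s (c + m' + b)" using P that by (intro tensor_mult_in)
    then show ?thesis
      using re r tensor_power_range[OF that] by (simp add: tensor_pad_mult[OF f P(1,2)])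
  qed
  have g1: "tensor_pad s (a + m + c) m' g b (A \<boxtimes> X \<boxtimes> C \<boxtimes> D \<boxtimes> E) = A \<boxtimes> X \<boxtimes> C \<boxtimes> g D \<boxtimes> E"
    if "X \<in> tensor_power s m" for X
    using P that by (intro tensor_pad_mult[OF g] tensor_mult_in)
  have "A \<boxtimes> B \<boxtimes> C \<boxtimes> D \<boxtimes> E \<in> tensor_power s N"
    unfolding N using P by (intro tensor_mult_in)
  then show "compose (tensor_power s N) (tensor_pad s a m f (c + m' + b)) (tensor_pad s (a + m + c) m' g b)
      (pure s us \<boxtimes> pure s vs \<boxtimes> pure s ws)
    = compose (tensor_power s N) (tensor_pad s (a + m + c) m' g b) (tensor_pad s a m f (c + m' + b))
      (pure s us \<boxtimes> pure s vs \<boxtimes> pure s ws)"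
    unfolding us D_E_def[symmetric] using P P' by (simp add: compose_eq f1 g1)
qed

section \<open>The automorphism group of a tensor power\<close>

lemma tensor_Aut_mult:
  assumes "f \<in> carrier (tensor_Aut s m)" "g \<in> carrier (tensor_Aut s m)"
  shows "f \<otimes>\<^bsub>tensor_Aut s m\<^esub> g = compose (tensor_power s m) f g"
  using assms by (simp add: tensor_Aut_def BijGroup_def)

lemma tensor_Aut_apply:
  assumes "f \<in> carrier (tensor_Aut s m)" "g \<in> carrier (tensor_Aut s m)" "u \<in> tensor_power s m"
  shows "(f \<otimes>\<^bsub>tensor_Aut s m\<^esub> g) u = f (g u)"
  using assms by (simp add: tensor_Aut_mult compose_eq)

lemma tensor_Aut_one: "\<one>\<^bsub>tensor_Aut s m\<^esub> = (\<lambda>u\<in>tensor_power s m. u)"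
  by (simp add: tensor_Aut_def BijGroup_def)

lemma tensor_Aut_End: "f \<in> carrier (tensor_Aut s m) \<Longrightarrow> f \<in> tensor_End m"
  by (auto simp: tensor_Aut_def tensor_End_def Bij_def bij_betw_def)

lemma tensor_AutI:
  assumes f: "f \<in> tensor_End m" and g: "g \<in> tensor_End m"
    and "compose (tensor_power s m) f g = (\<lambda>u\<in>tensor_power s m. u)"
    and "compose (tensor_power s m) g f = (\<lambda>u\<in>tensor_power s m. u)"
  shows "f \<in> carrier (tensor_Aut s m)"
proof -
  have "f (g u) = u" "g (f u) = u" if "u \<in> tensor_power s m" for u
    using that assms(3,4)[THEN fun_cong, of u] by (simp_all add: compose_eq)
  then have "bij_betw f (tensor_power s m) (tensor_power s m)"
    using tensor_EndD(2)[OF f] tensor_EndD(2)[OF g] by (intro bij_betwI[where g = g])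
  then show ?thesis using tensor_EndD(1,3)[OF f] by (simp add: tensor_Aut_def Bij_def)
qed

text \<open>Linearity of the inverse comes from writing a sum or multiple as the image under
  \<open>f\<close> of the same combination of preimages. Restricting \<open>inv_into\<close> makes
  the inverse extensional.\<close>

lemma tensor_Aut_inverse:
  assumes "f \<in> carrier (tensor_Aut s m)"
  obtains g where "g \<in> carrier (tensor_Aut s m)"
    "compose (tensor_power s m) f g = (\<lambda>u\<in>tensor_power s m. u)"
    "compose (tensor_power s m) g f = (\<lambda>u\<in>tensor_power s m. u)"
proof
  let ?T = "tensor_power s m"
  let ?g = "restrict (inv_into ?T f) ?T"
  have f: "f \<in> Bij ?T" "tensor_linear s m f" using assms by (auto simp: tensor_Aut_def)
  then have b: "bij_betw f ?T ?T" by (simp add: Bij_def)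
  have f_in: "f u \<in> ?T" if "u \<in> ?T" for u using b that by (auto simp: bij_betw_def)
  have g_in: "?g u \<in> ?T" if "u \<in> ?T" for u
    using that bij_betw_inv_into[OF b] by (auto simp: bij_betw_def)
  have fg: "f (?g u) = u" if "u \<in> ?T" for u
    using that bij_betw_inv_into_right[OF b] by simp
  have gf: "?g (f u) = u" if "u \<in> ?T" for u
    using that f_in bij_betw_inv_into_left[OF b] by simp
  show "compose ?T f ?g = (\<lambda>u\<in>?T. u)" "compose ?T ?g f = (\<lambda>u\<in>?T. u)"
    unfolding compose_def by (rule restrict_ext, simp only: fg gf)+
  have "?g (tensor_add s u v) = tensor_add s (?g u) (?g v)" if "u \<in> ?T" "v \<in> ?T" for u v
  proof -
    have "tensor_add s u v = f (tensor_add s (?g u) (?g v))"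
      by (subst tensor_linear_add[OF f(2)]) (use that in \<open>simp_all only: g_in fg\<close>)
    then show ?thesis using that by (simp only: gf tensor_add_in g_in)
  qed
  moreover have "?g (tensor_scale s c u) = tensor_scale s c (?g u)" if "u \<in> ?T" for u c
  proof -
    have "tensor_scale s c u = f (tensor_scale s c (?g u))"
      by (subst tensor_linear_scale[OF f(2)]) (use that in \<open>simp_all only: g_in fg\<close>)
    then show ?thesis using that by (simp only: gf tensor_scale_in g_in)
  qed
  ultimately show "?g \<in> carrier (tensor_Aut s m)"
    using restrict_inv_into_Bij[OF f(1)] unfolding tensor_Aut_def tensor_linear_def by simp
qed

lemma group_tensor_Aut: "group (tensor_Aut s m)"
proof (rule groupI)
  fix f g h assume f: "f \<in> carrier (tensor_Aut s m)" and g: "g \<in> carrier (tensor_Aut s m)"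
    and h: "h \<in> carrier (tensor_Aut s m)"
  have closed: "compose (tensor_power s m) f g \<in> carrier (tensor_Aut s m)"
    if "f \<in> carrier (tensor_Aut s m)" "g \<in> carrier (tensor_Aut s m)" for f g
    using that compose_End[OF tensor_Aut_End tensor_Aut_End, of f m g] compose_Bij[of f "tensor_power s m" g]
    by (simp add: tensor_Aut_def tensor_EndD)
  show "f \<otimes>\<^bsub>tensor_Aut s m\<^esub> g \<in> carrier (tensor_Aut s m)"
    using closed[OF f g] by (simp add: tensor_Aut_mult f g)
  show "f \<otimes>\<^bsub>tensor_Aut s m\<^esub> g \<otimes>\<^bsub>tensor_Aut s m\<^esub> h = f \<otimes>\<^bsub>tensor_Aut s m\<^esub> (g \<otimes>\<^bsub>tensor_Aut s m\<^esub> h)"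
    using tensor_EndD(2)[OF tensor_Aut_End[OF h]]
    by (simp add: tensor_Aut_mult f g h closed compose_assoc)
next
  show "\<one>\<^bsub>tensor_Aut s m\<^esub> \<in> carrier (tensor_Aut s m)"
    unfolding tensor_Aut_one
    by (rule tensor_AutI[OF id_End id_End]) (auto simp: compose_def fun_eq_iff)
  then show "\<one>\<^bsub>tensor_Aut s m\<^esub> \<otimes>\<^bsub>tensor_Aut s m\<^esub> f = f" if f: "f \<in> carrier (tensor_Aut s m)" for f
    using tensor_EndD(1,2)[OF tensor_Aut_End[OF f]]
    by (simp add: tensor_Aut_mult f) (simp add: tensor_Aut_one Id_compose)
next
  fix f assume f: "f \<in> carrier (tensor_Aut s m)"
  from tensor_Aut_inverse[OF f] show "\<exists>g\<in>carrier (tensor_Aut s m). g \<otimes>\<^bsub>tensor_Aut s m\<^esub> f = \<one>\<^bsub>tensor_Aut s m\<^esub>"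
    by (metis tensor_Aut_mult tensor_Aut_one f)
qed

text \<open>Padding respects composition and identities, so the padded inverse of \<open>f\<close>
  inverts the padded \<open>f\<close>.\<close>

lemma tensor_pad_Aut:
  assumes f: "f \<in> carrier (tensor_Aut s m)" and N: "N = a + m + b"
  shows "tensor_pad s a m f b \<in> carrier (tensor_Aut s N)"
proof -
  obtain g where g: "g \<in> carrier (tensor_Aut s m)"
    "compose (tensor_power s m) f g = (\<lambda>u\<in>tensor_power s m. u)"
    "compose (tensor_power s m) g f = (\<lambda>u\<in>tensor_power s m. u)"
    using tensor_Aut_inverse[OF f] .
  note End = f[THEN tensor_Aut_End] g(1)[THEN tensor_Aut_End]
  show ?thesis unfolding N
    by (rule tensor_AutI[OF End[THEN tensor_pad_End]])
      (simp_all add: End g tensor_pad_id flip: tensor_pad_compose)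
qed

text \<open>In this form a relation proved on few factors is moved to any position by
  \<open>arg_cong\<close> and the homomorphism laws.\<close>

lemma tensor_pad_hom:
  "N = a + m + b \<Longrightarrow> group_hom (tensor_Aut s m) (tensor_Aut s N) (\<lambda>f. tensor_pad s a m f b)"
  by (intro group_hom.intro group_hom_axioms.intro group_tensor_Aut homI)
    (simp_all add: tensor_pad_Aut tensor_Aut_mult tensor_pad_compose tensor_Aut_End)

lemma tensor_pad_Aut_commute:
  assumes f: "f \<in> carrier (tensor_Aut s m)" and g: "g \<in> carrier (tensor_Aut s m')"
    and N: "N = a + m + b" "N = a' + m' + b'" and le: "a + m \<le> a'"
  shows "tensor_pad s a m f b \<otimes>\<^bsub>tensor_Aut s N\<^esub> tensor_pad s a' m' g b'
    = tensor_pad s a' m' g b' \<otimes>\<^bsub>tensor_Aut s N\<^esub> tensor_pad s a m f b"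
proof -
  obtain c where c: "a' = a + m + c" using le le_Suc_ex by blast
  then have b: "b = c + m' + b'" and N': "N = a + m + c + m' + b'" using N by auto
  have F: "tensor_pad s a m f b \<in> carrier (tensor_Aut s N)"
    by (rule tensor_pad_Aut[OF f N(1)])
  have G: "tensor_pad s a' m' g b' \<in> carrier (tensor_Aut s N)"
    by (rule tensor_pad_Aut[OF g N(2)])
  show ?thesis
    using tensor_pad_commute[OF tensor_Aut_End[OF f] tensor_Aut_End[OF g] N']
    by (simp add: tensor_Aut_mult F G) (simp add: b c)
qed

end

section \<open>Representations of the framed braid groups from a local braiding and twist\<close>

section \<open>From local relations to framed braid groups\<close>

text \<open>A strand is a pair of tensor factors: a crossing involves 4 of them, a twist 2, the
  braid relation 6. The two twist relations move a framing through a crossing from either strand to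
  the other, matching the transposition in the mixed relations of the group.\<close>

locale framed_braiding = tensor_space s for s :: "'k::field \<Rightarrow> 'x::ab_group_add \<Rightarrow> 'x" +
  fixes R \<theta> :: "('x, 'k) tensor \<Rightarrow> ('x, 'k) tensor"
  assumes R: "R \<in> carrier (tensor_Aut s 4)"
    and \<theta>: "\<theta> \<in> carrier (tensor_Aut s 2)"
    and braid: "tensor_pad s 0 4 R 2 \<otimes>\<^bsub>tensor_Aut s 6\<^esub> tensor_pad s 2 4 R 0 \<otimes>\<^bsub>tensor_Aut s 6\<^esub> tensor_pad s 0 4 R 2
      = tensor_pad s 2 4 R 0 \<otimes>\<^bsub>tensor_Aut s 6\<^esub> tensor_pad s 0 4 R 2 \<otimes>\<^bsub>tensor_Aut s 6\<^esub> tensor_pad s 2 4 R 0"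
    and twist_left: "R \<otimes>\<^bsub>tensor_Aut s 4\<^esub> tensor_pad s 0 2 \<theta> 2 = tensor_pad s 2 2 \<theta> 0 \<otimes>\<^bsub>tensor_Aut s 4\<^esub> R"
    and twist_right: "R \<otimes>\<^bsub>tensor_Aut s 4\<^esub> tensor_pad s 2 2 \<theta> 0 = tensor_pad s 0 2 \<theta> 2 \<otimes>\<^bsub>tensor_Aut s 4\<^esub> R"
begin

definition crossing :: "nat \<Rightarrow> nat \<Rightarrow> ('x, 'k) tensor \<Rightarrow> ('x, 'k) tensor" where
  "crossing n i = tensor_pad s (2 * i - 2) 4 R (2 * n - 2 * i - 2)"

definition twist :: "nat \<Rightarrow> nat \<Rightarrow> ('x, 'k) tensor \<Rightarrow> ('x, 'k) tensor" where
  "twist n i = tensor_pad s (2 * i - 2) 2 \<theta> (2 * n - 2 * i)"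

primrec generator_image :: "nat \<Rightarrow> fb_gen \<Rightarrow> ('x, 'k) tensor \<Rightarrow> ('x, 'k) tensor" where
  "generator_image n (Sigma i) = crossing n i"
| "generator_image n (Twist i) = twist n i"

lemma crossing_Aut:
  assumes "1 \<le> i" "i < n" shows "crossing n i \<in> carrier (tensor_Aut s (2 * n))"
  unfolding crossing_def by (rule tensor_pad_Aut[OF R]) (use assms in simp)

lemma twist_Aut:
  assumes "1 \<le> i" "i \<le> n" shows "twist n i \<in> carrier (tensor_Aut s (2 * n))"
  unfolding twist_def by (rule tensor_pad_Aut[OF \<theta>]) (use assms in simp)

lemma generator_image_Aut: "generator_image n \<in> fb_gens n \<rightarrow> carrier (tensor_Aut s (2 * n))"
  by (auto simp: fb_gens_def crossing_Aut twist_Aut)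

lemma crossing_commute:
  assumes "1 \<le> i" "i + 2 \<le> j" "j < n"
  shows "crossing n i \<otimes>\<^bsub>tensor_Aut s (2 * n)\<^esub> crossing n j = crossing n j \<otimes>\<^bsub>tensor_Aut s (2 * n)\<^esub> crossing n i"
  unfolding crossing_def by (rule tensor_pad_Aut_commute[OF R R]) (use assms in auto)

lemma twist_commute:
  assumes "1 \<le> i" "i < j" "j \<le> n"
  shows "twist n i \<otimes>\<^bsub>tensor_Aut s (2 * n)\<^esub> twist n j = twist n j \<otimes>\<^bsub>tensor_Aut s (2 * n)\<^esub> twist n i"
  unfolding twist_def by (rule tensor_pad_Aut_commute[OF \<theta> \<theta>]) (use assms in auto)

lemma crossing_twist_commute:
  assumes "1 \<le> i" "i \<le> n" "1 \<le> j" "j < n" "i < j \<or> j + 1 < i"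
  shows "crossing n j \<otimes>\<^bsub>tensor_Aut s (2 * n)\<^esub> twist n i = twist n i \<otimes>\<^bsub>tensor_Aut s (2 * n)\<^esub> crossing n j"
  using assms(5)
proof
  assume "i < j"
  then show ?thesis unfolding twist_def crossing_def
    by (intro tensor_pad_Aut_commute[OF \<theta> R, symmetric]) (use assms in auto)
next
  assume "j + 1 < i"
  then show ?thesis unfolding twist_def crossing_def
    by (intro tensor_pad_Aut_commute[OF R \<theta>]) (use assms in auto)
qed

lemma crossing_braid:
  assumes "1 \<le> i" "i + 1 < n"
  shows "crossing n i \<otimes>\<^bsub>tensor_Aut s (2 * n)\<^esub> (crossing n (i + 1) \<otimes>\<^bsub>tensor_Aut s (2 * n)\<^esub> crossing n i)
    = crossing n (i + 1) \<otimes>\<^bsub>tensor_Aut s (2 * n)\<^esub> (crossing n i \<otimes>\<^bsub>tensor_Aut s (2 * n)\<^esub> crossing n (i + 1))"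
proof -
  \<comment> \<open>The strands \<open>i\<close>, \<open>i + 1\<close> and \<open>i + 2\<close>
    occupy the six factors after the first \<open>2 * i - 2\<close>, leaving
    \<open>2 * n - 2 * i - 4\<close> on the right.\<close>
  let ?h = "\<lambda>f. tensor_pad s (2 * i - 2) 6 f (2 * n - 2 * i - 4)"
  interpret h: group_hom "tensor_Aut s 6" "tensor_Aut s (2 * n)" ?h
    by (rule tensor_pad_hom) (use assms in auto)
  have P: "tensor_pad s 0 4 R 2 \<in> carrier (tensor_Aut s 6)" "tensor_pad s 2 4 R 0 \<in> carrier (tensor_Aut s 6)"
    by (rule tensor_pad_Aut[OF R], simp)+
  have "crossing n i = ?h (tensor_pad s 0 4 R 2)" "crossing n (i + 1) = ?h (tensor_pad s 2 4 R 0)"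
    unfolding crossing_def
    by (rule tensor_pad_pad[OF tensor_Aut_End[OF R], symmetric]; use assms in simp)+
  moreover note arg_cong[OF braid, of ?h]
  ultimately show ?thesis by (simp only: h.hom_mult h.hom_closed h.G.m_closed P h.H.m_assoc)
qed

lemma crossing_twist:
  assumes "1 \<le> i" "i < n"
  shows "crossing n i \<otimes>\<^bsub>tensor_Aut s (2 * n)\<^esub> twist n i = twist n (i + 1) \<otimes>\<^bsub>tensor_Aut s (2 * n)\<^esub> crossing n i"
    and "crossing n i \<otimes>\<^bsub>tensor_Aut s (2 * n)\<^esub> twist n (i + 1) = twist n i \<otimes>\<^bsub>tensor_Aut s (2 * n)\<^esub> crossing n i"
proof -
  let ?h = "\<lambda>f. tensor_pad s (2 * i - 2) 4 f (2 * n - 2 * i - 2)"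
  interpret h: group_hom "tensor_Aut s 4" "tensor_Aut s (2 * n)" ?h
    by (rule tensor_pad_hom) (use assms in auto)
  have P: "tensor_pad s 0 2 \<theta> 2 \<in> carrier (tensor_Aut s 4)" "tensor_pad s 2 2 \<theta> 0 \<in> carrier (tensor_Aut s 4)"
    by (rule tensor_pad_Aut[OF \<theta>], simp)+
  have e: "twist n i = ?h (tensor_pad s 0 2 \<theta> 2)" "twist n (i + 1) = ?h (tensor_pad s 2 2 \<theta> 0)"
    unfolding twist_def
    by (rule tensor_pad_pad[OF tensor_Aut_End[OF \<theta>], symmetric]; use assms in simp)+
  show "crossing n i \<otimes>\<^bsub>tensor_Aut s (2 * n)\<^esub> twist n i = twist n (i + 1) \<otimes>\<^bsub>tensor_Aut s (2 * n)\<^esub> crossing n i"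
    using arg_cong[OF twist_left, of ?h] unfolding e crossing_def by (simp only: h.hom_mult P R)
  show "crossing n i \<otimes>\<^bsub>tensor_Aut s (2 * n)\<^esub> twist n (i + 1) = twist n i \<otimes>\<^bsub>tensor_Aut s (2 * n)\<^esub> crossing n i"
    using arg_cong[OF twist_right, of ?h] unfolding e crossing_def by (simp only: h.hom_mult P R)
qed

lemma fb_relations_hold:
  assumes "(u, v) \<in> fb_relations n"
  shows "word_value (tensor_Aut s (2 * n)) (generator_image n) u
    = word_value (tensor_Aut s (2 * n)) (generator_image n) v"
proof -
  interpret group "tensor_Aut s (2 * n)" by (rule group_tensor_Aut)
  from assms consider
    (far) i j where "u = sigma_word i @ sigma_word j" "v = sigma_word j @ sigma_word i"
      "1 \<le> i" "i < n" "1 \<le> j" "j < n" "i + 2 \<le> j \<or> j + 2 \<le> i"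
  | (near) i where "u = sigma_word i @ sigma_word (i + 1) @ sigma_word i"
      "v = sigma_word (i + 1) @ sigma_word i @ sigma_word (i + 1)" "1 \<le> i" "i + 1 < n"
  | (twists) i j where "u = twist_word i @ twist_word j" "v = twist_word j @ twist_word i"
      "1 \<le> i" "i \<le> n" "1 \<le> j" "j \<le> n"
  | (mixed) i j where "u = sigma_word j @ twist_word i" "v = twist_word (transpose j (j + 1) i) @ sigma_word j"
      "1 \<le> i" "i \<le> n" "1 \<le> j" "j < n"
    unfolding fb_relations_def by fastforce
  then show ?thesis
  proof cases
    case far
    then show ?thesis
      using crossing_commute[of i j n] crossing_commute[of j i n] by (auto simp: crossing_Aut)
  next
    case near
    then show ?thesis using crossing_braid[of i n] by (simp add: crossing_Aut)
  next
    case twists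
    then show ?thesis
      using twist_commute[of i j n] twist_commute[of j i n]
      by (cases i j rule: linorder_cases) (auto simp: twist_Aut)
  next
    case mixed
    \<comment> \<open>The framed strand is the left strand of the crossing, its right strand, or
      disjoint from it.\<close>
    consider "i = j" | "i = j + 1" | "i < j \<or> j + 1 < i" by linarith
    then show ?thesis
    proof cases
      case 1
      then show ?thesis using mixed crossing_twist(1)[of j n] by (simp add: crossing_Aut twist_Aut)
    next
      case 2
      then show ?thesis using mixed crossing_twist(2)[of j n] by (simp add: crossing_Aut twist_Aut)
    next
      case 3
      then have "transpose j (j + 1) i = i" by (auto simp: transpose_def)
      then show ?thesis using 3 mixed crossing_twist_commute[of i n j] by (simp add: crossing_Aut twist_Aut)
    qed
  qed
qed

definition representation :: "nat \<Rightarrow> fb_gen word set \<Rightarrow> ('x, 'k) tensor \<Rightarrow> ('x, 'k) tensor" where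
  "representation n = presented_lift (tensor_Aut s (2 * n)) (generator_image n)"

lemma representation_hom: "group_hom (FB n) (tensor_Aut s (2 * n)) (representation n)"
  unfolding representation_def FB_def
  by (rule group.presented_lift_hom[OF group_tensor_Aut generator_image_Aut fb_relations_hold])

lemma representation_class:
  "w \<in> words (fb_gens n) \<Longrightarrow>
    representation n (fb_class n w) = word_value (tensor_Aut s (2 * n)) (generator_image n) w"
  unfolding representation_def fb_class_def
  by (rule group.presented_lift_class[OF group_tensor_Aut generator_image_Aut fb_relations_hold])

lemma representation_sigma:
  assumes "1 \<le> i" "i < n" shows "representation n (fb_class n (sigma_word i)) = crossing n i"
proof -
  interpret group "tensor_Aut s (2 * n)" by (rule group_tensor_Aut)
  have "sigma_word i \<in> words (fb_gens n)" using assms by (simp add: fb_gens_def)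
  then show ?thesis using assms by (simp add: representation_class crossing_Aut)
qed

lemma representation_twist:
  assumes "1 \<le> i" "i \<le> n" shows "representation n (fb_class n (twist_word i)) = twist n i"
proof -
  interpret group "tensor_Aut s (2 * n)" by (rule group_tensor_Aut)
  have "twist_word i \<in> words (fb_gens n)" using assms by (simp add: fb_gens_def)
  then show ?thesis using assms by (simp add: representation_class twist_Aut)
qed

abbreviation stabilize :: "nat \<Rightarrow> (('x, 'k) tensor \<Rightarrow> ('x, 'k) tensor) \<Rightarrow> ('x, 'k) tensor \<Rightarrow> ('x, 'k) tensor" where
  "stabilize n f \<equiv> tensor_map s (2 * n) 2 f id"

text \<open>Stabilisation takes the shape of a padding, to which \<open>tensor_pad_hom\<close> and
  \<open>tensor_pad_pad\<close> apply.\<close>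

lemma stabilize_eq_pad: "f \<in> carrier (tensor_Aut s (2 * n)) \<Longrightarrow> stabilize n f = tensor_pad s 0 (2 * n) f 2"
  by (simp add: tensor_pad_0_left tensor_Aut_End)

lemma stabilize_hom: "group_hom (tensor_Aut s (2 * n)) (tensor_Aut s (2 * Suc n)) (stabilize n)"
proof -
  interpret h: group_hom "tensor_Aut s (2 * n)" "tensor_Aut s (2 * Suc n)" "\<lambda>f. tensor_pad s 0 (2 * n) f 2"
    by (rule tensor_pad_hom) simp
  show ?thesis
    by (intro group_hom.intro group_hom_axioms.intro group_tensor_Aut homI)
      (simp_all only: stabilize_eq_pad h.hom_closed h.hom_mult h.G.m_closed)
qed

lemma stabilize_generator:
  assumes "g \<in> fb_gens n"
  shows "stabilize n (generator_image n g) = generator_image (Suc n) g"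
proof (cases g)
  case (Sigma i)
  then have i: "1 \<le> i" "i < n" using assms by (auto simp: fb_gens_def)
  have "tensor_pad s 0 (2 * n) (crossing n i) 2 = crossing (Suc n) i"
    unfolding crossing_def by (rule tensor_pad_pad[OF tensor_Aut_End[OF R]]) (use i in simp_all)
  then show ?thesis using crossing_Aut[OF i] by (simp add: Sigma stabilize_eq_pad)
next
  case (Twist i)
  then have i: "1 \<le> i" "i \<le> n" using assms by (auto simp: fb_gens_def)
  have "tensor_pad s 0 (2 * n) (twist n i) 2 = twist (Suc n) i"
    unfolding twist_def by (rule tensor_pad_pad[OF tensor_Aut_End[OF \<theta>]]) (use i in simp_all)
  then show ?thesis using twist_Aut[OF i] by (simp add: Twist stabilize_eq_pad)
qed

text \<open>Agreement on generators suffices, and there it is the merging of two paddings;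
  \<open>hom_word_value\<close> carries it to all words.\<close>

lemma representation_compatible:
  assumes "A \<in> carrier (FB n)"
  shows "representation (Suc n) (FB_incl n A) = stabilize n (representation n A)"
proof -
  interpret h: group_hom "tensor_Aut s (2 * n)" "tensor_Aut s (2 * Suc n)" "stabilize n"
    by (rule stabilize_hom)
  obtain w where w: "w \<in> words (fb_gens n)" "A = fb_class n w" using assms by (auto simp: FB_carrier)
  have "representation (Suc n) (FB_incl n A) = word_value (tensor_Aut s (2 * Suc n)) (generator_image (Suc n)) w"
    using w by (simp only: FB_incl_class representation_class fb_words_mono)
  also have "\<dots> = word_value (tensor_Aut s (2 * Suc n)) (stabilize n \<circ> generator_image n) w"
    by (rule word_value_cong[OF _ w(1)]) (simp only: comp_def stabilize_generator)
  also have "\<dots> = stabilize n (word_value (tensor_Aut s (2 * n)) (generator_image n) w)"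
    by (rule h.hom_word_value[OF generator_image_Aut w(1), symmetric])
  also have "\<dots> = stabilize n (representation n A)"
    using w by (simp only: representation_class)
  finally show ?thesis .
qed

lemma group_sequence_Aut: "group_sequence (\<lambda>n. tensor_Aut s (2 * n)) stabilize"
  by (rule group_sequence.intro) (use group_tensor_Aut group_hom.homh[OF stabilize_hom] in auto)

lemma representation_colimit_in:
  assumes "A \<in> carrier (FB n)"
  shows "colimit_map (\<lambda>n. tensor_Aut s (2 * n)) stabilize representation (colimit_in FB FB_incl n A)
    = colimit_in (\<lambda>n. tensor_Aut s (2 * n)) stabilize n (representation n A)"
  by (rule colimit_map_in[OF group_sequence_FB group_sequence_Aut representation_hom _ assms])
    (rule representation_compatible)

lemma representation_colimit_hom:
  "group_hom FB_infinity (colimit_group (\<lambda>n. tensor_Aut s (2 * n)) stabilize)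
    (colimit_map (\<lambda>n. tensor_Aut s (2 * n)) stabilize representation)"
  unfolding FB_infinity_def
  by (rule colimit_map_hom[OF group_sequence_FB group_sequence_Aut representation_hom])
    (rule representation_compatible)

end

section \<open>Braidings obtained from a Leibniz product with an annihilating element\<close>

section \<open>Braidings from Leibniz brackets\<close>

context tensor_space
begin

lemma tensor_linear_sum:
  assumes "tensor_linear s m f" "tensor_linear s m g"
    and "\<And>u. u \<in> tensor_power s m \<Longrightarrow> f u \<in> range (tensor_class s)"
    and "\<And>u. u \<in> tensor_power s m \<Longrightarrow> g u \<in> range (tensor_class s)"
  shows "tensor_linear s m (\<lambda>u. f u \<boxplus> g u)"
  using assms unfolding tensor_linear_def by (simp add: tensor_add_ac tensor_scale_add)

lemma tensor_linear_scaled: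
  assumes "tensor_linear s m f" "\<And>u. u \<in> tensor_power s m \<Longrightarrow> f u \<in> range (tensor_class s)"
  shows "tensor_linear s m (\<lambda>u. tensor_scale s c (f u))"
  using assms unfolding tensor_linear_def by (simp add: tensor_scale_add tensor_scale_scale mult.commute)

lemma tensor_linear_const_zero: "tensor_linear s m (\<lambda>u. \<zero>\<^sub>t)"
  unfolding tensor_linear_def by (simp add: tensor_add_class tensor_scale_class formal_scale_zero)

lemma tensor_End_restrictI:
  "tensor_linear s m f \<Longrightarrow> f \<in> tensor_power s m \<rightarrow> tensor_power s m \<Longrightarrow> restrict f (tensor_power s m) \<in> tensor_End m"
  unfolding tensor_End_def by (auto simp: tensor_linear_def tensor_add_in tensor_scale_in)

lemma tensor_End_eqI2:
  assumes f: "f \<in> tensor_End (m + n)" and g: "g \<in> tensor_End (m + n)"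
    and pure: "\<And>xs ys. length xs = m \<Longrightarrow> length ys = n
      \<Longrightarrow> f (pure s xs \<boxtimes> pure s ys) = g (pure s xs \<boxtimes> pure s ys)"
  shows "f = g"
proof (rule tensor_End_eq_pureI[OF f g])
  fix xs :: "'x list" assume "length xs = m + n"
  then show "f (pure s xs) = g (pure s xs)"
    using pure[of "take m xs" "drop m xs"] by (simp add: pure_mult)
qed

lemma tensor_pad_0_left_mult:
  assumes f: "f \<in> tensor_End m" and "A \<in> tensor_power s m" "B \<in> tensor_power s b"
  shows "tensor_pad s 0 m f b (A \<boxtimes> B) = f A \<boxtimes> B"
  using tensor_map_mult[OF tensor_EndD(3,2)[OF f] tensor_linear_id, of b b] assms
  by (simp add: tensor_pad_0_left[OF f])

lemma tensor_pad_0_right_mult: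
  assumes f: "f \<in> tensor_End m" and "A \<in> tensor_power s a" "B \<in> tensor_power s m"
  shows "tensor_pad s a m f 0 (A \<boxtimes> B) = A \<boxtimes> f B"
  using tensor_pad_mult[OF f assms(2,3) pure_in_tensor_power[of "[]" 0]]
    pure_Nil_mult(2)[OF tensor_mult_in[OF assms(2,3)]]
    pure_Nil_mult(2)[OF tensor_mult_in[OF assms(2) tensor_EndD(4)[OF f assms(3)]]]
  by simp

lemma multilinear_pure_swap: "multilinear s (m + n) (\<lambda>xs. pure s (drop m xs @ take m xs))"
proof -
  let ?F = "\<lambda>xs. pure s (drop m xs @ take m xs)"
  have "?F (us @ [x + y] @ vs) = (?F (us @ [x] @ vs)) \<boxplus> (?F (us @ [y] @ vs)) \<and>
    ?F (us @ [s c x] @ vs) = tensor_scale s c (?F (us @ [x] @ vs))" for us vs x y c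
  proof (cases "length us < m")
    case True
    then obtain k where m: "m = length us + Suc k" using less_imp_Suc_add by fastforce
    have "drop m (us @ [z] @ vs) @ take m (us @ [z] @ vs) = (drop k vs @ us) @ [z] @ take k vs" for z
      by (simp add: m)
    then show ?thesis by (simp only: pure_add pure_scale simp_thms)
  next
    case False
    then have "drop m (us @ [z] @ vs) @ take m (us @ [z] @ vs) = drop m us @ [z] @ (vs @ take m us)" for z
      by simp
    then show ?thesis by (simp only: pure_add pure_scale simp_thms)
  qed
  then show ?thesis unfolding multilinear_def by blast
qed

definition tensor_swap :: "nat \<Rightarrow> nat \<Rightarrow> ('x, 'k) tensor \<Rightarrow> ('x, 'k) tensor" where
  "tensor_swap m n = tensor_lift s (m + n) (\<lambda>xs. pure s (drop m xs @ take m xs))"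

lemma tensor_swap_linear: "tensor_linear s (m + n) (tensor_swap m n)"
  unfolding tensor_swap_def by (intro tensor_lift_linear multilinear_pure_swap pure_range)

lemma tensor_swap_pure:
  "length xs = m \<Longrightarrow> length ys = n \<Longrightarrow> tensor_swap m n (pure s (xs @ ys)) = pure s (ys @ xs)"
  unfolding tensor_swap_def by (subst tensor_lift_pure[OF multilinear_pure_swap pure_range]) simp_all

lemma tensor_swap_mult:
  assumes "A \<in> tensor_power s m" "B \<in> tensor_power s n"
  shows "tensor_swap m n (A \<boxtimes> B) = B \<boxtimes> A"
  by (rule bilinear_eq_mult[OF tensor_swap_linear _ _ _ assms, where h = "\<lambda>A B. B \<boxtimes> A"])
    (simp_all add: tensor_linear_mult_left tensor_linear_mult_right tensor_power_range pure_range
      tensor_swap_pure pure_mult)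

lemma tensor_swap_in: "u \<in> tensor_power s (m + n) \<Longrightarrow> tensor_swap m n u \<in> tensor_power s (m + n)"
proof -
  have "tensor_swap m n \<in> tensor_power s (m + n) \<rightarrow> tensor_power s (m + n)"
  proof (rule tensor_linear_into[OF tensor_swap_linear])
    fix xs :: "'x list" assume "length xs = m + n"
    then show "tensor_swap m n (pure s xs) \<in> tensor_power s (m + n)"
      using tensor_swap_pure[of "take m xs" m "drop m xs" n] by (simp add: pure_in_tensor_power)
  qed
  then show "u \<in> tensor_power s (m + n) \<Longrightarrow> tensor_swap m n u \<in> tensor_power s (m + n)" by auto
qed

end

text \<open>\<open>M\<close> is kept apart from \<open>k + k\<close> so that instances match the numerals 2 and 4 in \<open>R\<close> and \<open>\<theta>\<close>.\<close>

locale leibniz_bracket = tensor_space s for s :: "'k::field \<Rightarrow> 'x::ab_group_add \<Rightarrow> 'x" +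
  fixes k M :: nat and L :: "('x, 'k) tensor \<Rightarrow> ('x, 'k) tensor" and E :: "('x, 'k) tensor"
  assumes M: "M = k + k"
    and L_linear: "tensor_linear s M L"
    and L_funcset: "L \<in> tensor_power s M \<rightarrow> tensor_power s k"
    and E: "E \<in> tensor_power s k"
    and L_E_left_pure: "\<And>xs. length xs = k \<Longrightarrow> L (E \<boxtimes> pure s xs) = \<zero>\<^sub>t"
    and L_E_right_pure: "\<And>xs. length xs = k \<Longrightarrow> L (pure s xs \<boxtimes> E) = \<zero>\<^sub>t"
    and leibniz: "\<And>xs ys zs. length xs = k \<Longrightarrow> length ys = k \<Longrightarrow> length zs = k \<Longrightarrow>
      L (L (pure s xs \<boxtimes> pure s ys) \<boxtimes> pure s zs)
        = L (L (pure s xs \<boxtimes> pure s zs) \<boxtimes> pure s ys) \<boxplus> L (pure s xs \<boxtimes> L (pure s ys \<boxtimes> pure s zs))"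
begin

lemma mult_in_M: "A \<in> tensor_power s k \<Longrightarrow> B \<in> tensor_power s k \<Longrightarrow> A \<boxtimes> B \<in> tensor_power s M"
  unfolding M by (rule tensor_mult_in)

lemma L_in: "u \<in> tensor_power s M \<Longrightarrow> L u \<in> tensor_power s k"
  using L_funcset by auto

text \<open>The locale states the annihilation laws on pure tensors only, where instances can
  compute; linearity of \<open>L\<close> extends them to the whole tensor power.\<close>

lemma L_E:
  assumes A: "A \<in> tensor_power s k"
  shows "L (E \<boxtimes> A) = \<zero>\<^sub>t" "L (A \<boxtimes> E) = \<zero>\<^sub>t"
proof -
  have "tensor_linear s k (\<lambda>A. L (E \<boxtimes> A))"
    by (rule tensor_linear_comp[OF tensor_linear_mult_left _ L_linear])
      (use E mult_in_M in \<open>auto intro: tensor_power_range\<close>)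
  from tensor_lift_unique[OF this tensor_linear_const_zero _ A] show "L (E \<boxtimes> A) = \<zero>\<^sub>t"
    by (simp add: L_E_left_pure)
  have "tensor_linear s k (\<lambda>A. L (A \<boxtimes> E))"
    by (rule tensor_linear_comp[OF tensor_linear_mult_right _ L_linear])
      (use E mult_in_M in \<open>auto intro: tensor_power_range\<close>)
  from tensor_lift_unique[OF this tensor_linear_const_zero _ A] show "L (A \<boxtimes> E) = \<zero>\<^sub>t"
    by (simp add: L_E_right_pure)
qed

definition braiding :: "('x, 'k) tensor \<Rightarrow> ('x, 'k) tensor" where
  "braiding = (\<lambda>u\<in>tensor_power s M. tensor_swap k k u \<boxplus> (E \<boxtimes> L u))"

definition inverse_braiding :: "('x, 'k) tensor \<Rightarrow> ('x, 'k) tensor" where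
  "inverse_braiding = (\<lambda>u\<in>tensor_power s M.
     tensor_swap k k u \<boxplus> tensor_scale s (- 1) (L (tensor_swap k k u) \<boxtimes> E))"

lemma swap_in: "u \<in> tensor_power s M \<Longrightarrow> tensor_swap k k u \<in> tensor_power s M"
  unfolding M by (rule tensor_swap_in)

lemma swap_linear: "tensor_linear s M (tensor_swap k k)"
  unfolding M by (rule tensor_swap_linear)

lemma braiding_End: "braiding \<in> tensor_End M"
  unfolding braiding_def
proof (rule tensor_End_restrictI)
  have "tensor_linear s M (\<lambda>u. E \<boxtimes> L u)"
    by (rule tensor_linear_comp[OF L_linear L_funcset tensor_linear_mult_left[OF tensor_power_range[OF E]]])
  then show "tensor_linear s M (\<lambda>u. tensor_swap k k u \<boxplus> (E \<boxtimes> L u))"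
    by (intro tensor_linear_sum swap_linear tensor_power_range[OF swap_in]
        tensor_power_range[OF mult_in_M] E L_in)
qed (auto intro!: tensor_add_in swap_in mult_in_M E L_in)

lemma inverse_braiding_End: "inverse_braiding \<in> tensor_End M"
  unfolding inverse_braiding_def
proof (rule tensor_End_restrictI)
  have "tensor_linear s M (\<lambda>u. L (tensor_swap k k u))"
    by (rule tensor_linear_comp[OF swap_linear _ L_linear]) (simp add: swap_in)
  then have "tensor_linear s M (\<lambda>u. L (tensor_swap k k u) \<boxtimes> E)"
    by (rule tensor_linear_comp[OF _ _ tensor_linear_mult_right[OF tensor_power_range[OF E]], where p = k])
      (simp add: swap_in L_in)
  then show "tensor_linear s M (\<lambda>u. tensor_swap k k u \<boxplus> tensor_scale s (- 1) (L (tensor_swap k k u) \<boxtimes> E))"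
    by (intro tensor_linear_sum tensor_linear_scaled swap_linear tensor_power_range[OF swap_in]
        tensor_power_range[OF mult_in_M] E L_in swap_in tensor_scale_range)
qed (auto intro!: tensor_add_in tensor_scale_in swap_in mult_in_M E L_in)

lemma braiding_mult:
  "A \<in> tensor_power s k \<Longrightarrow> B \<in> tensor_power s k \<Longrightarrow> braiding (A \<boxtimes> B) = (B \<boxtimes> A) \<boxplus> (E \<boxtimes> L (A \<boxtimes> B))"
  by (simp add: braiding_def mult_in_M tensor_swap_mult)

lemma inverse_braiding_mult:
  "A \<in> tensor_power s k \<Longrightarrow> B \<in> tensor_power s k \<Longrightarrow>
    inverse_braiding (A \<boxtimes> B) = (B \<boxtimes> A) \<boxplus> tensor_scale s (- 1) (L (B \<boxtimes> A) \<boxtimes> E)"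
  by (simp add: inverse_braiding_def mult_in_M tensor_swap_mult)

text \<open>The correction term of either map contains \<open>E\<close> as a factor, so applying the
  other map merely swaps it: its own correction would be a product with \<open>E\<close> and
  vanishes. What remains is the correction with the opposite sign.\<close>

lemma braiding_Aut: "braiding \<in> carrier (tensor_Aut s M)"
proof (rule tensor_AutI[OF braiding_End inverse_braiding_End])
  have eq: "compose (tensor_power s M) f g = (\<lambda>u\<in>tensor_power s M. u)"
    if "f \<in> tensor_End M" "g \<in> tensor_End M"
      "\<And>A B. A \<in> tensor_power s k \<Longrightarrow> B \<in> tensor_power s k \<Longrightarrow> f (g (A \<boxtimes> B)) = A \<boxtimes> B" for f g
    using that compose_End[OF that(1,2)] id_End[of M]
    by (intro tensor_End_eqI2[of _ k k, folded M])
      (simp_all add: compose_eq mult_in_M pure_in_tensor_power)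
  have cancel: "X \<boxplus> Y \<boxplus> tensor_scale s (- 1) Y = X"
    if "X \<in> tensor_power s M" "Y \<in> tensor_power s M" for X Y
    using that[THEN tensor_power_range] by (simp add: tensor_add_assoc tensor_add_scale_minus_one tensor_add_zero)
  have cancel': "X \<boxplus> tensor_scale s (- 1) Y \<boxplus> Y = X"
    if "X \<in> tensor_power s M" "Y \<in> tensor_power s M" for X Y
    using cancel[OF that] by (simp add: tensor_add_ac)
  show "compose (tensor_power s M) braiding inverse_braiding = (\<lambda>u\<in>tensor_power s M. u)"
  proof (rule eq[OF braiding_End inverse_braiding_End])
    fix A B assume A: "A \<in> tensor_power s k" and B: "B \<in> tensor_power s k"
    let ?U = "L (B \<boxtimes> A)"
    have U: "?U \<in> tensor_power s k" by (intro L_in mult_in_M A B)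
    note lin = tensor_linear_add[OF tensor_EndD(3)[OF braiding_End]] tensor_linear_scale[OF tensor_EndD(3)[OF braiding_End]]
    have "braiding (inverse_braiding (A \<boxtimes> B))
      = (A \<boxtimes> B) \<boxplus> (E \<boxtimes> ?U) \<boxplus> tensor_scale s (- 1) ((E \<boxtimes> ?U) \<boxplus> (E \<boxtimes> \<zero>\<^sub>t))"
      using A B U E by (simp add: inverse_braiding_mult lin mult_in_M tensor_scale_in braiding_mult L_E)
    also have "\<dots> = A \<boxtimes> B"
      using E U by (simp add: tensor_mult_zero tensor_add_zero tensor_power_range tensor_mult_range
          cancel mult_in_M A B)
    finally show "braiding (inverse_braiding (A \<boxtimes> B)) = A \<boxtimes> B" .
  qed
  show "compose (tensor_power s M) inverse_braiding braiding = (\<lambda>u\<in>tensor_power s M. u)"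
  proof (rule eq[OF inverse_braiding_End braiding_End])
    fix A B assume A: "A \<in> tensor_power s k" and B: "B \<in> tensor_power s k"
    let ?U = "L (A \<boxtimes> B)"
    have U: "?U \<in> tensor_power s k" by (intro L_in mult_in_M A B)
    note lin = tensor_linear_add[OF tensor_EndD(3)[OF inverse_braiding_End]]
    have "inverse_braiding (braiding (A \<boxtimes> B))
      = (A \<boxtimes> B) \<boxplus> tensor_scale s (- 1) (?U \<boxtimes> E) \<boxplus> ((?U \<boxtimes> E) \<boxplus> tensor_scale s (- 1) (\<zero>\<^sub>t \<boxtimes> E))"
      using A B U E by (simp add: braiding_mult lin mult_in_M inverse_braiding_mult L_E)
    also have "\<dots> = A \<boxtimes> B \<boxplus> tensor_scale s (- 1) (?U \<boxtimes> E) \<boxplus> (?U \<boxtimes> E)"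
      using E U by (simp add: tensor_mult_zero tensor_add_zero tensor_power_range tensor_mult_range
          tensor_scale_class formal_scale_zero)
    also have "\<dots> = A \<boxtimes> B" using E U A B by (simp add: cancel' mult_in_M)
    finally show "inverse_braiding (braiding (A \<boxtimes> B)) = A \<boxtimes> B" .
  qed
qed

text \<open>Write a product for \<open>L\<close>. On A (x) B (x) C both sides contain C (x) B (x) A,
  E (x) BC (x) A, E (x) B (x) AC and C (x) E (x) AB; all products with E vanish. The rest is E (x) E
  (x) (AB)C on one side and E (x) E (x) ((AC)B + A(BC)) on the other, so the relation comes down to
  the Leibniz identity.\<close>

lemma braiding_braid:
  assumes N: "N = M + k"
  shows "tensor_pad s 0 M braiding k \<otimes>\<^bsub>tensor_Aut s N\<^esub> tensor_pad s k M braiding 0 \<otimes>\<^bsub>tensor_Aut s N\<^esub> tensor_pad s 0 M braiding k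
    = tensor_pad s k M braiding 0 \<otimes>\<^bsub>tensor_Aut s N\<^esub> tensor_pad s 0 M braiding k \<otimes>\<^bsub>tensor_Aut s N\<^esub> tensor_pad s k M braiding 0"
proof -
  interpret group "tensor_Aut s N" by (rule group_tensor_Aut)
  define p q where "p = tensor_pad s 0 M braiding k" "q = tensor_pad s k M braiding 0"
  have p: "p \<in> carrier (tensor_Aut s N)" and q: "q \<in> carrier (tensor_Aut s N)"
    unfolding p_q_def by (rule tensor_pad_Aut[OF braiding_Aut], simp add: N)+
  have N3: "N = k + k + k" by (simp add: N M)
  have "p \<otimes>\<^bsub>tensor_Aut s N\<^esub> q \<otimes>\<^bsub>tensor_Aut s N\<^esub> p = q \<otimes>\<^bsub>tensor_Aut s N\<^esub> p \<otimes>\<^bsub>tensor_Aut s N\<^esub> q"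
  proof (rule tensor_End_eqI[of _ k k k, folded N3])
    show "p \<otimes>\<^bsub>tensor_Aut s N\<^esub> q \<otimes>\<^bsub>tensor_Aut s N\<^esub> p \<in> tensor_End N"
      "q \<otimes>\<^bsub>tensor_Aut s N\<^esub> p \<otimes>\<^bsub>tensor_Aut s N\<^esub> q \<in> tensor_End N"
      using p q by (auto intro!: tensor_Aut_End)
    fix us vs ws :: "'x list" assume l: "length us = k" "length vs = k" "length ws = k"
    define A B C where "A = pure s us" "B = pure s vs" "C = pure s ws"
    have ABC: "A \<in> tensor_power s k" "B \<in> tensor_power s k" "C \<in> tensor_power s k"
      using l by (simp_all add: A_B_C_def pure_in_tensor_power)
    have in_N: "X \<boxtimes> Y \<boxtimes> Z \<in> tensor_power s N"
      if "X \<in> tensor_power s k" "Y \<in> tensor_power s k" "Z \<in> tensor_power s k" for X Y Z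
      unfolding N3 using that by (intro tensor_mult_in)
    have L': "L (X \<boxtimes> Y) \<in> tensor_power s k" if "X \<in> tensor_power s k" "Y \<in> tensor_power s k" for X Y
      using that by (intro L_in mult_in_M)
    note Lr = tensor_power_range[OF L']
    have p_mult: "p (X \<boxtimes> Y \<boxtimes> Z) = Y \<boxtimes> X \<boxtimes> Z \<boxplus> E \<boxtimes> L (X \<boxtimes> Y) \<boxtimes> Z"
      if "X \<in> tensor_power s k" "Y \<in> tensor_power s k" "Z \<in> tensor_power s k" for X Y Z
      unfolding p_q_def using that E
      by (simp add: tensor_pad_0_left_mult[OF braiding_End] mult_in_M braiding_mult
          tensor_mult_add_left tensor_power_range tensor_mult_range Lr)
    have q_mult: "q (X \<boxtimes> Y \<boxtimes> Z) = X \<boxtimes> Z \<boxtimes> Y \<boxplus> X \<boxtimes> E \<boxtimes> L (Y \<boxtimes> Z)"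
      if "X \<in> tensor_power s k" "Y \<in> tensor_power s k" "Z \<in> tensor_power s k" for X Y Z
      unfolding p_q_def using that E
      by (simp add: tensor_mult_assoc tensor_pad_0_right_mult[OF braiding_End] mult_in_M braiding_mult
          tensor_mult_add_right tensor_power_range tensor_mult_range Lr)
    note add = tensor_linear_add[OF tensor_EndD(3)[OF tensor_Aut_End[OF p]]]
      tensor_linear_add[OF tensor_EndD(3)[OF tensor_Aut_End[OF q]]]
    have zero: "X \<boxtimes> \<zero>\<^sub>t = \<zero>\<^sub>t" "\<zero>\<^sub>t \<boxtimes> X = \<zero>\<^sub>t" "X \<boxplus> \<zero>\<^sub>t = X" "\<zero>\<^sub>t \<boxplus> X = X"
      if "X \<in> range (tensor_class s)" for X
      using that by (simp_all add: tensor_mult_zero tensor_add_zero)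
    \<comment> \<open>The Leibniz identity is assumed for pure tensors, which \<open>A\<close>,
      \<open>B\<close> and \<open>C\<close> are. It is stated with the prefix
      \<open>E \<boxtimes> E\<close> because that is where its terms occur in the expansion.\<close>
    have E_leib: "E \<boxtimes> E \<boxtimes> L (L (A \<boxtimes> B) \<boxtimes> C)
      = E \<boxtimes> E \<boxtimes> L (L (A \<boxtimes> C) \<boxtimes> B) \<boxplus> E \<boxtimes> E \<boxtimes> L (A \<boxtimes> L (B \<boxtimes> C))"
      unfolding A_B_C_def leibniz[OF l]
      using ABC E by (simp add: tensor_mult_add_right tensor_power_range tensor_mult_range Lr L' flip: A_B_C_def)
    have "p (q (p (A \<boxtimes> B \<boxtimes> C))) = q (p (q (A \<boxtimes> B \<boxtimes> C)))"
      using ABC E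
      by (simp add: p_mult q_mult add in_N L' tensor_add_in L_E zero tensor_power_range tensor_mult_range
          Lr E_leib) (simp only: tensor_add_ac)
    then show "(p \<otimes>\<^bsub>tensor_Aut s N\<^esub> q \<otimes>\<^bsub>tensor_Aut s N\<^esub> p) (pure s us \<boxtimes> pure s vs \<boxtimes> pure s ws)
      = (q \<otimes>\<^bsub>tensor_Aut s N\<^esub> p \<otimes>\<^bsub>tensor_Aut s N\<^esub> q) (pure s us \<boxtimes> pure s vs \<boxtimes> pure s ws)"
      using p q in_N[OF ABC] tensor_EndD(4)[OF tensor_Aut_End[OF p]] tensor_EndD(4)[OF tensor_Aut_End[OF q]]
      by (simp add: tensor_Aut_apply A_B_C_def)
  qed
  then show ?thesis by (simp only: p_q_def)
qed

end

section \<open>Doubling the strands of a braiding\<close>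

section \<open>Cabling\<close>

context monoid
begin

text \<open>With a trailing factor \<open>z\<close> the relation applies inside right-nested
  products; the next lemma does the same for braid relations.\<close>

lemma braid_lcomm:
  "x \<otimes> y = y \<otimes> x \<Longrightarrow> x \<in> carrier G \<Longrightarrow> y \<in> carrier G \<Longrightarrow> z \<in> carrier G \<Longrightarrow> x \<otimes> (y \<otimes> z) = y \<otimes> (x \<otimes> z)"
  by (simp flip: m_assoc)

lemma braid_lbraid:
  "x \<otimes> (y \<otimes> x) = y \<otimes> (x \<otimes> y) \<Longrightarrow> x \<in> carrier G \<Longrightarrow> y \<in> carrier G \<Longrightarrow> z \<in> carrier G \<Longrightarrow>
    x \<otimes> (y \<otimes> (x \<otimes> z)) = y \<otimes> (x \<otimes> (y \<otimes> z))"
  by (drule arg_cong[where f = "\<lambda>w. w \<otimes> z"]) (simp add: m_assoc)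

text \<open>Read b a c b as the crossing of two 2-strand cables. A crossing inside one cable slides
  through it and emerges inside the other, so \<open>a\<close> on one side becomes \<open>c\<close>
  on the other and conversely.\<close>

lemma cable_slide:
  assumes [simp]: "a \<in> carrier G" "b \<in> carrier G" "c \<in> carrier G"
    and ab: "a \<otimes> (b \<otimes> a) = b \<otimes> (a \<otimes> b)" and bc: "b \<otimes> (c \<otimes> b) = c \<otimes> (b \<otimes> c)" and ac: "a \<otimes> c = c \<otimes> a"
  shows "b \<otimes> (a \<otimes> (c \<otimes> (b \<otimes> a))) = c \<otimes> (b \<otimes> (a \<otimes> (c \<otimes> b)))"
    and "b \<otimes> (a \<otimes> (c \<otimes> (b \<otimes> c))) = a \<otimes> (b \<otimes> (a \<otimes> (c \<otimes> b)))"
proof -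
  have "b \<otimes> (a \<otimes> (c \<otimes> (b \<otimes> a))) = b \<otimes> (c \<otimes> (a \<otimes> (b \<otimes> a)))" by (simp add: braid_lcomm[OF ac])
  also have "\<dots> = b \<otimes> (c \<otimes> (b \<otimes> (a \<otimes> b)))" by (simp only: ab)
  also have "\<dots> = c \<otimes> (b \<otimes> (c \<otimes> (a \<otimes> b)))" by (simp add: braid_lbraid[OF bc])
  also have "\<dots> = c \<otimes> (b \<otimes> (a \<otimes> (c \<otimes> b)))" by (simp add: braid_lcomm[OF ac])
  finally show "b \<otimes> (a \<otimes> (c \<otimes> (b \<otimes> a))) = c \<otimes> (b \<otimes> (a \<otimes> (c \<otimes> b)))" .
  have "b \<otimes> (a \<otimes> (c \<otimes> (b \<otimes> c))) = b \<otimes> (a \<otimes> (b \<otimes> (c \<otimes> b)))" by (simp only: bc)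
  also have "\<dots> = a \<otimes> (b \<otimes> (a \<otimes> (c \<otimes> b)))" by (simp add: braid_lbraid[OF ab[symmetric]])
  finally show "b \<otimes> (a \<otimes> (c \<otimes> (b \<otimes> c))) = a \<otimes> (b \<otimes> (a \<otimes> (c \<otimes> b)))" .
qed

text \<open>The squares of \<open>a\<close> and \<open>c\<close> are the full twists of the two
  cables; sliding a single crossing through twice moves a full twist.\<close>

lemma cable_twist:
  assumes "a \<in> carrier G" "b \<in> carrier G" "c \<in> carrier G"
    and "a \<otimes> (b \<otimes> a) = b \<otimes> (a \<otimes> b)" "b \<otimes> (c \<otimes> b) = c \<otimes> (b \<otimes> c)" "a \<otimes> c = c \<otimes> a"
  shows "(b \<otimes> a \<otimes> c \<otimes> b) \<otimes> (a \<otimes> a) = (c \<otimes> c) \<otimes> (b \<otimes> a \<otimes> c \<otimes> b)"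
    and "(b \<otimes> a \<otimes> c \<otimes> b) \<otimes> (c \<otimes> c) = (a \<otimes> a) \<otimes> (b \<otimes> a \<otimes> c \<otimes> b)"
proof -
  let ?x = "b \<otimes> a \<otimes> c \<otimes> b"
  have x: "?x \<in> carrier G" using assms by simp
  have xa: "?x \<otimes> a = c \<otimes> ?x" and xc: "?x \<otimes> c = a \<otimes> ?x"
    using cable_slide[OF assms] assms(1-3) by (simp_all add: m_assoc)
  show "?x \<otimes> (a \<otimes> a) = (c \<otimes> c) \<otimes> ?x" using x xa assms(1-3) by (metis m_assoc)
  show "?x \<otimes> (c \<otimes> c) = (a \<otimes> a) \<otimes> ?x" using x xc assms(1-3) by (metis m_assoc)
qed

text \<open>Conjugation by x y takes a, b, c to c, d, e. It therefore takes the word x = b a c b to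
  d c e d = y, which is the braid relation (x y) x = y (x y). For \<open>a\<close> and
  \<open>c\<close> this follows from sliding through one cable crossing and commuting with the
  other.\<close>

lemma cable_braid:
  assumes G: "a \<in> carrier G" "b \<in> carrier G" "c \<in> carrier G" "d \<in> carrier G" "e \<in> carrier G"
    and ab: "a \<otimes> (b \<otimes> a) = b \<otimes> (a \<otimes> b)" and bc: "b \<otimes> (c \<otimes> b) = c \<otimes> (b \<otimes> c)"
    and cd: "c \<otimes> (d \<otimes> c) = d \<otimes> (c \<otimes> d)" and de: "d \<otimes> (e \<otimes> d) = e \<otimes> (d \<otimes> e)"
    and ac: "a \<otimes> c = c \<otimes> a" and ad: "a \<otimes> d = d \<otimes> a" and ae: "a \<otimes> e = e \<otimes> a"
    and bd: "b \<otimes> d = d \<otimes> b" and be: "b \<otimes> e = e \<otimes> b" and ce: "c \<otimes> e = e \<otimes> c"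
  shows "(b \<otimes> a \<otimes> c \<otimes> b) \<otimes> (d \<otimes> c \<otimes> e \<otimes> d) \<otimes> (b \<otimes> a \<otimes> c \<otimes> b)
    = (d \<otimes> c \<otimes> e \<otimes> d) \<otimes> (b \<otimes> a \<otimes> c \<otimes> b) \<otimes> (d \<otimes> c \<otimes> e \<otimes> d)"
proof -
  note [simp] = G
  define x y where "x = b \<otimes> a \<otimes> c \<otimes> b" "y = d \<otimes> c \<otimes> e \<otimes> d"
  have x [simp]: "x \<in> carrier G" and y [simp]: "y \<in> carrier G" by (simp_all add: x_y_def)
  have xa: "x \<otimes> a = c \<otimes> x" and yc: "y \<otimes> c = e \<otimes> y"
    using cable_slide(1)[OF G(1-3) ab bc ac] cable_slide(1)[OF G(3-5) cd de ce]
    by (simp_all add: x_y_def m_assoc)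
  have ya: "y \<otimes> a = a \<otimes> y"
    by (simp add: x_y_def m_assoc ac ad ae braid_lcomm[OF ac] braid_lcomm[OF ad] braid_lcomm[OF ae]
        flip: ac ad ae)
  have xe: "x \<otimes> e = e \<otimes> x"
    by (simp add: x_y_def m_assoc ae be ce braid_lcomm[OF ae] braid_lcomm[OF be] braid_lcomm[OF ce])
  \<comment> \<open>The only generator that sees both cable crossings is \<open>b\<close>: it joins
    two different cables. It is moved left until the braid relation with \<open>c\<close> applies;
    the one between \<open>c\<close> and \<open>d\<close> then releases a \<open>d\<close> that
    passes to the front.\<close>
  have "x \<otimes> (y \<otimes> b) = b \<otimes> (a \<otimes> (c \<otimes> (b \<otimes> (d \<otimes> (c \<otimes> (e \<otimes> (b \<otimes> d)))))))"
    by (simp add: x_y_def m_assoc bd)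
  also have "\<dots> = b \<otimes> (a \<otimes> (c \<otimes> (b \<otimes> (d \<otimes> (c \<otimes> (b \<otimes> (e \<otimes> d)))))))"
    by (simp add: braid_lcomm[OF be])
  also have "\<dots> = b \<otimes> (a \<otimes> (c \<otimes> (d \<otimes> (b \<otimes> (c \<otimes> (b \<otimes> (e \<otimes> d)))))))"
    by (simp add: braid_lcomm[OF bd])
  also have "\<dots> = b \<otimes> (a \<otimes> (c \<otimes> (d \<otimes> (c \<otimes> (b \<otimes> (c \<otimes> (e \<otimes> d)))))))"
    by (simp add: braid_lbraid[OF bc])
  also have "\<dots> = b \<otimes> (a \<otimes> (d \<otimes> (c \<otimes> (d \<otimes> (b \<otimes> (c \<otimes> (e \<otimes> d)))))))"
    by (simp add: braid_lbraid[OF cd])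
  also have "\<dots> = d \<otimes> (b \<otimes> (a \<otimes> (c \<otimes> (b \<otimes> (d \<otimes> (c \<otimes> (e \<otimes> d)))))))"
    by (simp add: braid_lcomm[OF bd] braid_lcomm[OF ad])
  also have "\<dots> = d \<otimes> (x \<otimes> y)" by (simp add: x_y_def m_assoc)
  finally have xyb: "(x \<otimes> y) \<otimes> b = d \<otimes> (x \<otimes> y)" by (simp add: m_assoc)
  have xya: "(x \<otimes> y) \<otimes> a = c \<otimes> (x \<otimes> y)"
    using xa ya by (metis m_assoc G x y)
  have xyc: "(x \<otimes> y) \<otimes> c = e \<otimes> (x \<otimes> y)"
    using yc xe by (metis m_assoc G x y)
  define w where "w = x \<otimes> y"
  have w: "w \<in> carrier G" by (simp add: w_def)
  have step: "w \<otimes> (g \<otimes> h) = g' \<otimes> (w \<otimes> h)"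
    if "w \<otimes> g = g' \<otimes> w" "g \<in> carrier G" "g' \<in> carrier G" "h \<in> carrier G" for g g' h
    using that w by (simp flip: m_assoc)
  have "w \<otimes> (b \<otimes> (a \<otimes> (c \<otimes> b))) = d \<otimes> (c \<otimes> (e \<otimes> (d \<otimes> w)))"
    using xya xyb xyc by (simp add: step w flip: w_def)
  then have "w \<otimes> x = y \<otimes> w" using w by (simp add: x_y_def m_assoc)
  then show ?thesis unfolding w_def x_y_def[symmetric] by (simp add: m_assoc)
qed

end

locale braided_space = tensor_space s for s :: "'k::field \<Rightarrow> 'x::ab_group_add \<Rightarrow> 'x" +
  fixes r :: "('x, 'k) tensor \<Rightarrow> ('x, 'k) tensor"
  assumes r: "r \<in> carrier (tensor_Aut s 2)"
    and r_braid: "tensor_pad s 0 2 r 1 \<otimes>\<^bsub>tensor_Aut s 3\<^esub> tensor_pad s 1 2 r 0 \<otimes>\<^bsub>tensor_Aut s 3\<^esub> tensor_pad s 0 2 r 1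
      = tensor_pad s 1 2 r 0 \<otimes>\<^bsub>tensor_Aut s 3\<^esub> tensor_pad s 0 2 r 1 \<otimes>\<^bsub>tensor_Aut s 3\<^esub> tensor_pad s 1 2 r 0"
begin

text \<open>Positions count from 0 and \<open>N\<close> counts tensor factors, so this is the braid
  generator r_(i+1) on X^N. In contrast, generators of the framed braid group count from 1 and in
  pairs of factors.\<close>

definition strand_crossing :: "nat \<Rightarrow> nat \<Rightarrow> ('x, 'k) tensor \<Rightarrow> ('x, 'k) tensor" where
  "strand_crossing N i = tensor_pad s i 2 r (N - 2 - i)"

lemma strand_crossing_Aut: "i + 2 \<le> N \<Longrightarrow> strand_crossing N i \<in> carrier (tensor_Aut s N)"
  unfolding strand_crossing_def by (rule tensor_pad_Aut[OF r]) simp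

lemma strand_crossing_commute:
  "i + 2 \<le> j \<Longrightarrow> j + 2 \<le> N \<Longrightarrow> strand_crossing N i \<otimes>\<^bsub>tensor_Aut s N\<^esub> strand_crossing N j
    = strand_crossing N j \<otimes>\<^bsub>tensor_Aut s N\<^esub> strand_crossing N i"
  unfolding strand_crossing_def by (rule tensor_pad_Aut_commute[OF r r]) simp_all

lemma tensor_pad_strand_crossing:
  "i + 2 \<le> M \<Longrightarrow> N = a + M + b \<Longrightarrow> tensor_pad s a M (strand_crossing M i) b = strand_crossing N (a + i)"
  unfolding strand_crossing_def by (rule tensor_pad_pad[OF tensor_Aut_End[OF r]]) simp_all

lemma strand_crossing_braid:
  assumes "i + 3 \<le> N" and j: "j = i + 1"
  shows "strand_crossing N i \<otimes>\<^bsub>tensor_Aut s N\<^esub> (strand_crossing N j \<otimes>\<^bsub>tensor_Aut s N\<^esub> strand_crossing N i)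
    = strand_crossing N j \<otimes>\<^bsub>tensor_Aut s N\<^esub> (strand_crossing N i \<otimes>\<^bsub>tensor_Aut s N\<^esub> strand_crossing N j)"
proof -
  let ?h = "\<lambda>f. tensor_pad s i 3 f (N - 3 - i)"
  interpret h: group_hom "tensor_Aut s 3" "tensor_Aut s N" ?h
    by (rule tensor_pad_hom) (use assms in simp)
  have P: "strand_crossing 3 0 \<in> carrier (tensor_Aut s 3)" "strand_crossing 3 1 \<in> carrier (tensor_Aut s 3)"
    by (rule strand_crossing_Aut, simp)+
  have "strand_crossing 3 0 = tensor_pad s 0 2 r 1" "strand_crossing 3 1 = tensor_pad s 1 2 r 0"
    by (simp_all add: strand_crossing_def)
  note braid = r_braid[folded this]
  have e: "?h (strand_crossing 3 0) = strand_crossing N i" "?h (strand_crossing 3 1) = strand_crossing N j"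
    using tensor_pad_strand_crossing[of 0 3 N i "N - 3 - i"] tensor_pad_strand_crossing[of 1 3 N i "N - 3 - i"] assms
    by simp_all
  from arg_cong[OF braid, of ?h]
  have "?h (strand_crossing 3 0) \<otimes>\<^bsub>tensor_Aut s N\<^esub> ?h (strand_crossing 3 1) \<otimes>\<^bsub>tensor_Aut s N\<^esub> ?h (strand_crossing 3 0)
    = ?h (strand_crossing 3 1) \<otimes>\<^bsub>tensor_Aut s N\<^esub> ?h (strand_crossing 3 0) \<otimes>\<^bsub>tensor_Aut s N\<^esub> ?h (strand_crossing 3 1)"
    by (simp only: h.hom_mult h.G.m_closed P)
  then show ?thesis
    unfolding e using strand_crossing_Aut[of i N] strand_crossing_Aut[of j N] assms
    by (simp add: h.H.m_assoc)
qed

definition cable_crossing :: "('x, 'k) tensor \<Rightarrow> ('x, 'k) tensor" where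
  "cable_crossing = strand_crossing 4 1 \<otimes>\<^bsub>tensor_Aut s 4\<^esub> strand_crossing 4 0
    \<otimes>\<^bsub>tensor_Aut s 4\<^esub> strand_crossing 4 2 \<otimes>\<^bsub>tensor_Aut s 4\<^esub> strand_crossing 4 1"

definition full_twist :: "('x, 'k) tensor \<Rightarrow> ('x, 'k) tensor" where
  "full_twist = r \<otimes>\<^bsub>tensor_Aut s 2\<^esub> r"

lemma cable_crossing_Aut: "cable_crossing \<in> carrier (tensor_Aut s 4)"
  unfolding cable_crossing_def
  by (intro monoid.m_closed group.is_monoid group_tensor_Aut strand_crossing_Aut) simp_all

lemma full_twist_Aut: "full_twist \<in> carrier (tensor_Aut s 2)"
  unfolding full_twist_def by (intro monoid.m_closed group.is_monoid group_tensor_Aut r)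

lemma tensor_pad_cable_crossing:
  assumes N: "N = a + 4 + b" and "i = a + 1" "j = a + 2"
  shows "tensor_pad s a 4 cable_crossing b = strand_crossing N i \<otimes>\<^bsub>tensor_Aut s N\<^esub> strand_crossing N a
    \<otimes>\<^bsub>tensor_Aut s N\<^esub> strand_crossing N j \<otimes>\<^bsub>tensor_Aut s N\<^esub> strand_crossing N i"
proof -
  interpret h: group_hom "tensor_Aut s 4" "tensor_Aut s N" "\<lambda>f. tensor_pad s a 4 f b"
    by (rule tensor_pad_hom[OF N])
  have P: "strand_crossing 4 0 \<in> carrier (tensor_Aut s 4)" "strand_crossing 4 1 \<in> carrier (tensor_Aut s 4)"
    "strand_crossing 4 2 \<in> carrier (tensor_Aut s 4)"
    by (rule strand_crossing_Aut, simp)+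
  have "tensor_pad s a 4 (strand_crossing 4 0) b = strand_crossing N a"
    "tensor_pad s a 4 (strand_crossing 4 1) b = strand_crossing N i"
    "tensor_pad s a 4 (strand_crossing 4 2) b = strand_crossing N j"
    using tensor_pad_strand_crossing[OF _ N, of 0] tensor_pad_strand_crossing[OF _ N, of 1]
      tensor_pad_strand_crossing[OF _ N, of 2] assms(2,3) by simp_all
  then show ?thesis unfolding cable_crossing_def by (simp only: h.hom_mult h.G.m_closed P)
qed

lemma tensor_pad_full_twist:
  assumes "N = a + 2 + b"
  shows "tensor_pad s a 2 full_twist b = strand_crossing N a \<otimes>\<^bsub>tensor_Aut s N\<^esub> strand_crossing N a"
proof -
  interpret h: group_hom "tensor_Aut s 2" "tensor_Aut s N" "\<lambda>f. tensor_pad s a 2 f b"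
    by (rule tensor_pad_hom) fact
  show ?thesis unfolding full_twist_def strand_crossing_def using assms by (simp add: r)
qed

text \<open>All premises of the group-theoretic cabling lemmas are braid or far-commutation
  relations of single crossings, on four factors for the twist and on six for the braid
  relation.\<close>

lemma framed_braiding_cable: "framed_braiding s cable_crossing full_twist"
proof
  let ?c = "strand_crossing"
  show "cable_crossing \<in> carrier (tensor_Aut s 4)" by (rule cable_crossing_Aut)
  show "full_twist \<in> carrier (tensor_Aut s 2)" by (rule full_twist_Aut)
  have G4: "?c 4 0 \<in> carrier (tensor_Aut s 4)" "?c 4 1 \<in> carrier (tensor_Aut s 4)" "?c 4 2 \<in> carrier (tensor_Aut s 4)"
    by (rule strand_crossing_Aut, simp)+
  have pads4: "tensor_pad s 0 2 full_twist 2 = ?c 4 0 \<otimes>\<^bsub>tensor_Aut s 4\<^esub> ?c 4 0"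
    "tensor_pad s 2 2 full_twist 0 = ?c 4 2 \<otimes>\<^bsub>tensor_Aut s 4\<^esub> ?c 4 2"
    by (rule tensor_pad_full_twist, simp)+
  have br: "?c 4 0 \<otimes>\<^bsub>tensor_Aut s 4\<^esub> (?c 4 1 \<otimes>\<^bsub>tensor_Aut s 4\<^esub> ?c 4 0)
      = ?c 4 1 \<otimes>\<^bsub>tensor_Aut s 4\<^esub> (?c 4 0 \<otimes>\<^bsub>tensor_Aut s 4\<^esub> ?c 4 1)"
    "?c 4 1 \<otimes>\<^bsub>tensor_Aut s 4\<^esub> (?c 4 2 \<otimes>\<^bsub>tensor_Aut s 4\<^esub> ?c 4 1)
      = ?c 4 2 \<otimes>\<^bsub>tensor_Aut s 4\<^esub> (?c 4 1 \<otimes>\<^bsub>tensor_Aut s 4\<^esub> ?c 4 2)"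
    by (rule strand_crossing_braid; simp)+
  have comm: "?c 4 0 \<otimes>\<^bsub>tensor_Aut s 4\<^esub> ?c 4 2 = ?c 4 2 \<otimes>\<^bsub>tensor_Aut s 4\<^esub> ?c 4 0"
    by (rule strand_crossing_commute; simp)
  note slide = monoid.cable_twist[OF group.is_monoid[OF group_tensor_Aut] G4 br comm]
  show "cable_crossing \<otimes>\<^bsub>tensor_Aut s 4\<^esub> tensor_pad s 0 2 full_twist 2
      = tensor_pad s 2 2 full_twist 0 \<otimes>\<^bsub>tensor_Aut s 4\<^esub> cable_crossing"
    and "cable_crossing \<otimes>\<^bsub>tensor_Aut s 4\<^esub> tensor_pad s 2 2 full_twist 0
      = tensor_pad s 0 2 full_twist 2 \<otimes>\<^bsub>tensor_Aut s 4\<^esub> cable_crossing"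
    unfolding pads4 cable_crossing_def
    by (rule slide)+
  have G6: "?c 6 0 \<in> carrier (tensor_Aut s 6)" "?c 6 1 \<in> carrier (tensor_Aut s 6)" "?c 6 2 \<in> carrier (tensor_Aut s 6)"
    "?c 6 3 \<in> carrier (tensor_Aut s 6)" "?c 6 4 \<in> carrier (tensor_Aut s 6)"
    by (rule strand_crossing_Aut, simp)+
  have pads6: "tensor_pad s 0 4 cable_crossing 2 = ?c 6 1 \<otimes>\<^bsub>tensor_Aut s 6\<^esub> ?c 6 0
      \<otimes>\<^bsub>tensor_Aut s 6\<^esub> ?c 6 2 \<otimes>\<^bsub>tensor_Aut s 6\<^esub> ?c 6 1"
    "tensor_pad s 2 4 cable_crossing 0 = ?c 6 3 \<otimes>\<^bsub>tensor_Aut s 6\<^esub> ?c 6 2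
      \<otimes>\<^bsub>tensor_Aut s 6\<^esub> ?c 6 4 \<otimes>\<^bsub>tensor_Aut s 6\<^esub> ?c 6 3"
    by (rule tensor_pad_cable_crossing; simp)+
  show "tensor_pad s 0 4 cable_crossing 2 \<otimes>\<^bsub>tensor_Aut s 6\<^esub> tensor_pad s 2 4 cable_crossing 0
      \<otimes>\<^bsub>tensor_Aut s 6\<^esub> tensor_pad s 0 4 cable_crossing 2
    = tensor_pad s 2 4 cable_crossing 0 \<otimes>\<^bsub>tensor_Aut s 6\<^esub> tensor_pad s 0 4 cable_crossing 2
      \<otimes>\<^bsub>tensor_Aut s 6\<^esub> tensor_pad s 2 4 cable_crossing 0"
    unfolding pads6
    by (rule monoid.cable_braid[OF group.is_monoid[OF group_tensor_Aut] G6])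
      (rule strand_crossing_braid strand_crossing_commute; simp)+
qed

end

section \<open>Sweedler sums, and explicit nine-term formulas for R and \<theta>\<close>

section \<open>The maps R and \<open>\<theta>\<close> on pure tensors\<close>

context tensor_space
begin

lemmas pure_add_simps =
  pure_add[of "[]", simplified] pure_add[of "[a]" for a, simplified]
  pure_add[of "[a, b]" for a b, simplified] pure_add[of "[a, b, c]" for a b c, simplified]

lemmas pure_scale_simps =
  pure_scale[of "[]", simplified] pure_scale[of "[a]" for a, simplified]
  pure_scale[of "[a, b]" for a b, simplified] pure_scale[of "[a, b, c]" for a b c, simplified]

text \<open>Additivity in the slot at \<open>0 + 0\<close> gives A = A + A, and
  \<open>tensor_scale s (- 1)\<close> supplies the negative that cancels one summand.\<close>

lemma pure_zero: "pure s (us @ [0] @ vs) = \<zero>\<^sub>t"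
proof -
  have "A = \<zero>\<^sub>t" if "A \<in> range (tensor_class s)" "A = A \<boxplus> A" for A
  proof -
    have "A = A \<boxplus> A \<boxplus> tensor_scale s (- 1) A"
      using that(1) by (simp add: tensor_add_assoc tensor_add_scale_minus_one tensor_add_zero)
    then show ?thesis using that by (simp add: tensor_add_scale_minus_one)
  qed
  then show ?thesis using pure_add[of us 0 0 vs] pure_range by simp
qed

lemmas pure_zero_simps =
  pure_zero[of "[]", simplified] pure_zero[of "[a]" for a, simplified]
  pure_zero[of "[a, b]" for a b, simplified] pure_zero[of "[a, b, c]" for a b c, simplified]

lemma multilinear2I:
  assumes "\<And>x x' y. \<phi> [x + x', y] = \<phi> [x, y] \<boxplus> \<phi> [x', y]"
    and "\<And>x y y'. \<phi> [x, y + y'] = \<phi> [x, y] \<boxplus> \<phi> [x, y']"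
    and "\<And>c x y. \<phi> [s c x, y] = tensor_scale s c (\<phi> [x, y])"
    and "\<And>c x y. \<phi> [x, s c y] = tensor_scale s c (\<phi> [x, y])"
  shows "multilinear s 2 \<phi>"
proof -
  have *: "(\<exists>y. us = [] \<and> vs = [y]) \<or> (\<exists>x. us = [x] \<and> vs = [])"
    if "length us + length vs + 1 = 2" for us vs :: "'x list"
    using that by (cases us; cases vs) auto
  show ?thesis unfolding multilinear_def
    by (intro conjI allI impI; drule *; elim disjE exE conjE; simp add: assms)
qed

lemma multilinear3I:
  assumes "\<And>x x' y z. \<phi> [x + x', y, z] = \<phi> [x, y, z] \<boxplus> \<phi> [x', y, z]"
    and "\<And>x y y' z. \<phi> [x, y + y', z] = \<phi> [x, y, z] \<boxplus> \<phi> [x, y', z]"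
    and "\<And>x y z z'. \<phi> [x, y, z + z'] = \<phi> [x, y, z] \<boxplus> \<phi> [x, y, z']"
    and "\<And>c x y z. \<phi> [s c x, y, z] = tensor_scale s c (\<phi> [x, y, z])"
    and "\<And>c x y z. \<phi> [x, s c y, z] = tensor_scale s c (\<phi> [x, y, z])"
    and "\<And>c x y z. \<phi> [x, y, s c z] = tensor_scale s c (\<phi> [x, y, z])"
  shows "multilinear s 3 \<phi>"
proof -
  have *: "(\<exists>y z. us = [] \<and> vs = [y, z]) \<or> (\<exists>x z. us = [x] \<and> vs = [z]) \<or> (\<exists>x y. us = [x, y] \<and> vs = [])"
    if "length us + length vs + 1 = 3" for us vs :: "'x list"
  proof -
    consider "length us = 0 \<and> length vs = 2" | "length us = 1 \<and> length vs = 1" | "length us = 2 \<and> length vs = 0"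
      using \<open>length us + length vs + 1 = 3\<close> by linarith
    then show ?thesis by cases (auto simp: length_Suc_conv numeral_eq_Suc)
  qed
  show ?thesis unfolding multilinear_def
    by (intro conjI allI impI; drule *; elim disjE exE conjE; simp add: assms)
qed

lemma multilinear4I:
  assumes "\<And>x x' y z w. \<phi> [x + x', y, z, w] = \<phi> [x, y, z, w] \<boxplus> \<phi> [x', y, z, w]"
    and "\<And>x y y' z w. \<phi> [x, y + y', z, w] = \<phi> [x, y, z, w] \<boxplus> \<phi> [x, y', z, w]"
    and "\<And>x y z z' w. \<phi> [x, y, z + z', w] = \<phi> [x, y, z, w] \<boxplus> \<phi> [x, y, z', w]"
    and "\<And>x y z w w'. \<phi> [x, y, z, w + w'] = \<phi> [x, y, z, w] \<boxplus> \<phi> [x, y, z, w']"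
    and "\<And>c x y z w. \<phi> [s c x, y, z, w] = tensor_scale s c (\<phi> [x, y, z, w])"
    and "\<And>c x y z w. \<phi> [x, s c y, z, w] = tensor_scale s c (\<phi> [x, y, z, w])"
    and "\<And>c x y z w. \<phi> [x, y, s c z, w] = tensor_scale s c (\<phi> [x, y, z, w])"
    and "\<And>c x y z w. \<phi> [x, y, z, s c w] = tensor_scale s c (\<phi> [x, y, z, w])"
  shows "multilinear s 4 \<phi>"
proof -
  have *: "(\<exists>y z w. us = [] \<and> vs = [y, z, w]) \<or> (\<exists>x z w. us = [x] \<and> vs = [z, w])
      \<or> (\<exists>x y w. us = [x, y] \<and> vs = [w]) \<or> (\<exists>x y z. us = [x, y, z] \<and> vs = [])"
    if "length us + length vs + 1 = 4" for us vs :: "'x list"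
  proof -
    consider "length us = 0 \<and> length vs = 3" | "length us = 1 \<and> length vs = 2"
      | "length us = 2 \<and> length vs = 1" | "length us = 3 \<and> length vs = 0"
      using \<open>length us + length vs + 1 = 4\<close> by linarith
    then show ?thesis by cases (auto simp: length_Suc_conv numeral_eq_Suc)
  qed
  show ?thesis unfolding multilinear_def
    by (intro conjI allI impI; drule *; elim disjE exE conjE; simp add: assms)
qed

end

definition unit_vec :: "'k::field \<times> 'l::ab_group_add" where
  "unit_vec = (1, 0)"

text \<open>The projection of X onto L, with which the comultiplication reads x (x) e + e (x)
  \<open>primitive_part x\<close>. The scalar component travels in the first leg only, so the
  formula is linear in x.\<close>

definition primitive_part :: "'k::field \<times> 'l::ab_group_add \<Rightarrow> 'k \<times> 'l" where
  "primitive_part x = (0, snd x)"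

lemma primitive_part_idem: "primitive_part (primitive_part x) = primitive_part x"
  by (simp add: primitive_part_def)

lemma primitive_part_add: "primitive_part (x + y) = primitive_part x + primitive_part y"
  by (simp add: primitive_part_def)

text \<open>What the two versions of T share, and enough to evaluate R and \<theta> on pure tensors
  once for both.\<close>

locale trilinear_operation = vector_space scale
  for scale :: "'k::field \<Rightarrow> 'l::ab_group_add \<Rightarrow> 'l" +
  fixes T :: "('k, 'l) trilinear"
  assumes T_add: "T (x + x') y z = T x y z + T x' y z"
      "T x (y + y') z = T x y z + T x y' z"
      "T x y (z + z') = T x y z + T x y z'"
    and T_scale: "T (X_scale scale c x) y z = X_scale scale c (T x y z)"
      "T x (X_scale scale c y) z = X_scale scale c (T x y z)"
      "T x y (X_scale scale c z) = X_scale scale c (T x y z)"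
    and T_unit: "T x unit_vec unit_vec = x"
begin

abbreviation "X \<equiv> X_scale scale"

sublocale tensor_space "X_scale scale" .

abbreviation X_tensor_sum (infixl "\<boxplus>" 65) where "A \<boxplus> B \<equiv> tensor_add X A B"
abbreviation X_tensor_prod (infixl "\<boxtimes>" 70) where "A \<boxtimes> B \<equiv> tensor_mult X A B"

lemma primitive_part_scale: "primitive_part (X c x) = X c (primitive_part x)"
  by (simp add: primitive_part_def X_scale_def split_beta)

lemma comult_eq: "comult scale x = pure X [x, unit_vec] \<boxplus> pure X [unit_vec, primitive_part x]"
  by (simp add: comult_def split_beta primitive_part_def unit_vec_def)

text \<open>Applying the comultiplication to the second leg could give four terms, but e has zero
  primitive part, so x (x) e contributes one; the second term gives two because taking the primitive
  part is idempotent.\<close>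

lemma comult2_eq:
  "comult2 scale x = pure X [x, unit_vec, unit_vec] \<boxplus> pure X [unit_vec, primitive_part x, unit_vec]
    \<boxplus> pure X [unit_vec, unit_vec, primitive_part x]"
proof -
  let ?\<phi> = "\<lambda>xs. tensor_mult X (pure X [xs ! 0]) (comult scale (xs ! 1))"
  have \<phi>: "pure X [u] \<boxtimes> comult scale v = pure X [u, v, unit_vec] \<boxplus> pure X [u, unit_vec, primitive_part v]" for u v
    by (simp add: comult_eq tensor_mult_add_right pure_range pure_mult)
  have ml: "multilinear X 2 ?\<phi>" unfolding \<phi>
    by (rule multilinear2I) (simp_all add: pure_add_simps pure_scale_simps primitive_part_add
        primitive_part_scale tensor_scale_add pure_range tensor_add_ac)
  have range: "?\<phi> xs \<in> range (tensor_class X)" for xs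
    unfolding \<phi> by (intro tensor_add_range pure_range)
  define F where "F = tensor_lift X 2 ?\<phi>"
  have lift: "F (pure X [u, v]) = pure X [u, v, unit_vec] \<boxplus> pure X [u, unit_vec, primitive_part v]" for u v
    using tensor_lift_pure[OF ml range, of "[u, v]"] by (simp add: F_def \<phi>)
  have lin: "tensor_linear X 2 F" unfolding F_def by (rule tensor_lift_linear[OF ml range])
  have zero: "primitive_part unit_vec = (0 :: 'k \<times> 'l)"
    by (simp add: primitive_part_def unit_vec_def zero_prod_def)
  show ?thesis
    unfolding comult2_def F_def[symmetric] comult_eq[of x]
    by (simp add: tensor_linear_add[OF lin] lift pure_in_tensor_power zero primitive_part_idem pure_zero_simps tensor_add_zero
        pure_range tensor_add_assoc)
qed

lemma sweedler_eq:
  assumes ml: "multilinear X 3 (\<lambda>xs. \<phi> (xs ! 0) (xs ! 1) (xs ! 2))"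
    and range: "\<And>x y z. \<phi> x y z \<in> range (tensor_class X)"
  shows "sweedler scale x \<phi> = \<phi> x unit_vec unit_vec \<boxplus> \<phi> unit_vec (primitive_part x) unit_vec
    \<boxplus> \<phi> unit_vec unit_vec (primitive_part x)"
proof -
  define F where "F = tensor_lift X 3 (\<lambda>xs. \<phi> (xs ! 0) (xs ! 1) (xs ! 2))"
  have lift: "F (pure X [x, y, z]) = \<phi> x y z" for x y z
    using tensor_lift_pure[OF ml range, of "[x, y, z]"] by (simp add: F_def)
  have "tensor_linear X 3 F" unfolding F_def by (rule tensor_lift_linear[OF ml range])
  then show ?thesis unfolding sweedler_def F_def[symmetric] comult2_eq
    by (simp add: tensor_linear_add pure_in_tensor_power tensor_add_in lift)
qed

lemmas linear_simps = pure_add_simps pure_scale_simps primitive_part_add primitive_part_scale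
  T_add T_scale tensor_scale_add pure_range tensor_add_range

text \<open>Three groups according to the leg of z that carries z or its primitive part, with three
  terms each for the leg of w. \<open>T_unit\<close> is already applied, so T of x with two units
  appears as x.\<close>

definition R_pure :: "'k \<times> 'l \<Rightarrow> 'k \<times> 'l \<Rightarrow> 'k \<times> 'l \<Rightarrow> 'k \<times> 'l \<Rightarrow> ('k \<times> 'l, 'k) tensor" where
  "R_pure x y z w =
    pure X [z, w, x, y]
    \<boxplus> pure X [z, unit_vec, T x unit_vec (primitive_part w), y]
    \<boxplus> pure X [z, unit_vec, x, T y unit_vec (primitive_part w)]
    \<boxplus> (pure X [unit_vec, w, T x (primitive_part z) unit_vec, y]
      \<boxplus> pure X [unit_vec, unit_vec, T x (primitive_part z) (primitive_part w), y]
      \<boxplus> pure X [unit_vec, unit_vec, T x (primitive_part z) unit_vec, T y unit_vec (primitive_part w)])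
    \<boxplus> (pure X [unit_vec, w, x, T y (primitive_part z) unit_vec]
      \<boxplus> pure X [unit_vec, unit_vec, T x unit_vec (primitive_part w), T y (primitive_part z) unit_vec]
      \<boxplus> pure X [unit_vec, unit_vec, x, T y (primitive_part z) (primitive_part w)])"

text \<open>The inner Sweedler sum is evaluated for arbitrary legs of z, since the outer one can be
  evaluated only once the inner sum is known to be trilinear in them.\<close>

lemma R_map:
  shows R_map_End: "R_map scale T \<in> tensor_End 4"
    and R_map_pure: "R_map scale T (pure X [x, y, z, w]) = R_pure x y z w"
proof -
  have inner: "sweedler scale w (\<lambda>w1 w2 w3. pure X [z1, w1, T x z2 w2, T y z3 w3])
    = pure X [z1, w, T x z2 unit_vec, T y z3 unit_vec]
      \<boxplus> pure X [z1, unit_vec, T x z2 (primitive_part w), T y z3 unit_vec]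
      \<boxplus> pure X [z1, unit_vec, T x z2 unit_vec, T y z3 (primitive_part w)]" for x y z1 z2 z3 w
    by (rule sweedler_eq; (rule multilinear3I)?) (simp_all add: linear_simps)
  have outer: "sweedler scale z (\<lambda>z1 z2 z3. sweedler scale w (\<lambda>w1 w2 w3. pure X [z1, w1, T x z2 w2, T y z3 w3]))
    = R_pure x y z w" for x y z w
    unfolding inner
    by (subst sweedler_eq; (rule multilinear3I)?) (simp_all add: linear_simps tensor_add_ac T_unit R_pure_def)
  let ?\<phi> = "\<lambda>xs. R_pure (xs ! 0) (xs ! 1) (xs ! 2) (xs ! 3)"
  have ml: "multilinear X 4 ?\<phi>"
    by (rule multilinear4I) (simp_all add: R_pure_def linear_simps tensor_add_ac)
  have in4: "?\<phi> xs \<in> tensor_power X 4" for xs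
    unfolding R_pure_def by (intro tensor_add_in pure_in_tensor_power) simp_all
  have R: "R_map scale T = tensor_lift X 4 ?\<phi>"
    unfolding R_map_def Let_def outer ..
  note * = ml tensor_power_range[OF in4]
  show "R_map scale T (pure X [x, y, z, w]) = R_pure x y z w"
    unfolding R using tensor_lift_pure[OF *, of "[x, y, z, w]"] by (simp add: numeral_eq_Suc)
  show "R_map scale T \<in> tensor_End 4"
    unfolding R tensor_End_def
    using tensor_lift_extensional[OF *] tensor_lift_linear[OF *] tensor_lift_pure[OF *] in4
      tensor_linear_into[OF tensor_lift_linear[OF *], of 4] by simp
qed

text \<open>The groups follow the legs of x, their members those of y. Terms with
  \<open>unit_vec\<close> in the first slot of T and a primitive argument stay unevaluated here;
  their vanishing is specific to the two versions of T.\<close>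

definition theta_pure :: "'k \<times> 'l \<Rightarrow> 'k \<times> 'l \<Rightarrow> ('k \<times> 'l, 'k) tensor" where
  "theta_pure x y =
    pure X [x, y]
    \<boxplus> pure X [T x unit_vec (primitive_part y), unit_vec]
    \<boxplus> pure X [x, T unit_vec unit_vec (primitive_part y)]
    \<boxplus> (pure X [T unit_vec (primitive_part x) unit_vec, y]
      \<boxplus> pure X [T unit_vec (primitive_part x) (primitive_part y), unit_vec]
      \<boxplus> pure X [T unit_vec (primitive_part x) unit_vec, T unit_vec unit_vec (primitive_part y)])
    \<boxplus> (pure X [unit_vec, T y (primitive_part x) unit_vec]
      \<boxplus> pure X [T unit_vec unit_vec (primitive_part y), T unit_vec (primitive_part x) unit_vec]
      \<boxplus> pure X [unit_vec, T unit_vec (primitive_part x) (primitive_part y)])"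

lemma theta_map:
  shows theta_map_End: "theta_map scale T \<in> tensor_End 2"
    and theta_map_pure: "theta_map scale T (pure X [x, y]) = theta_pure x y"
proof -
  have inner: "sweedler scale y (\<lambda>y1 y2 y3. pure X [T x1 x2 y2, T y1 x3 y3])
    = pure X [T x1 x2 unit_vec, T y x3 unit_vec]
      \<boxplus> pure X [T x1 x2 (primitive_part y), T unit_vec x3 unit_vec]
      \<boxplus> pure X [T x1 x2 unit_vec, T unit_vec x3 (primitive_part y)]" for y x1 x2 x3
    by (rule sweedler_eq; (rule multilinear3I)?) (simp_all add: linear_simps)
  have outer: "sweedler scale x (\<lambda>x1 x2 x3. sweedler scale y (\<lambda>y1 y2 y3. pure X [T x1 x2 y2, T y1 x3 y3]))
    = theta_pure x y" for x y
    unfolding inner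
    by (subst sweedler_eq; (rule multilinear3I)?) (simp_all add: linear_simps tensor_add_ac T_unit theta_pure_def)
  let ?\<phi> = "\<lambda>xs. theta_pure (xs ! 0) (xs ! 1)"
  have ml: "multilinear X 2 ?\<phi>"
    by (rule multilinear2I) (simp_all add: theta_pure_def linear_simps tensor_add_ac)
  have in2: "?\<phi> xs \<in> tensor_power X 2" for xs
    unfolding theta_pure_def by (intro tensor_add_in pure_in_tensor_power) simp_all
  have R: "theta_map scale T = tensor_lift X 2 ?\<phi>"
    unfolding theta_map_def Let_def outer ..
  note * = ml tensor_power_range[OF in2]
  show "theta_map scale T (pure X [x, y]) = theta_pure x y"
    unfolding R using tensor_lift_pure[OF *, of "[x, y]"] by simp
  show "theta_map scale T \<in> tensor_End 2"
    unfolding R tensor_End_def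
    using tensor_lift_extensional[OF *] tensor_lift_linear[OF *] tensor_lift_pure[OF *] in2
      tensor_linear_into[OF tensor_lift_linear[OF *], of 2] by simp
qed

end

section \<open>Lie algebras: R as a cabling and \<theta> as a full twist\<close>

section \<open>Lie algebras\<close>

context lie_algebra
begin

lemmas bracket_add =
  module_hom.add[OF Vector_Spaces.linear.axioms(3)[OF linear_1]]
  module_hom.add[OF Vector_Spaces.linear.axioms(3)[OF linear_2]]
lemmas bracket_scale =
  module_hom.scale[OF Vector_Spaces.linear.axioms(3)[OF linear_1]]
  module_hom.scale[OF Vector_Spaces.linear.axioms(3)[OF linear_2]]
lemmas bracket_zero =
  module_hom.zero[OF Vector_Spaces.linear.axioms(3)[OF linear_1]]
  module_hom.zero[OF Vector_Spaces.linear.axioms(3)[OF linear_2]]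
lemmas bracket_neg =
  module_hom.neg[OF Vector_Spaces.linear.axioms(3)[OF linear_1]]
  module_hom.neg[OF Vector_Spaces.linear.axioms(3)[OF linear_2]]

lemma bracket_antisym: "bracket y x = - bracket x y"
proof -
  have "bracket (x + y) (x + y) = bracket y x + bracket x y"
    by (simp only: bracket_add) (simp add: alternating add.commute)
  then show ?thesis by (simp add: alternating eq_neg_iff_add_eq_0)
qed

text \<open>Jacobi and antisymmetry, arranged so that bracketing with z on the right is a
  derivation, the form required by \<open>leibniz_bracket\<close>.\<close>

lemma bracket_leibniz: "bracket (bracket x y) z = bracket (bracket x z) y + bracket x (bracket y z)"
proof -
  have "bracket (bracket x z) y = bracket y (bracket z x)"
    by (simp add: bracket_antisym[of y] bracket_antisym[of x z] bracket_neg)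
  moreover have "bracket (bracket x y) z = - bracket z (bracket x y)"
    by (rule bracket_antisym)
  moreover have "bracket x (bracket y z) + bracket y (bracket z x) = - bracket z (bracket x y)"
    using jacobi[of x y z] by (simp add: eq_neg_iff_add_eq_0)
  ultimately show ?thesis by (simp add: add.commute)
qed

lemma trilinear_operation_T_lie: "trilinear_operation scale (T_lie scale bracket)"
  by unfold_locales
    (simp_all add: T_lie_def X_scale_def unit_vec_def split_beta prod_eq_iff bracket_add bracket_scale
      bracket_zero algebra_simps scale_right_distrib scale_left_distrib)

definition X_bracket :: "'k \<times> 'l \<Rightarrow> 'k \<times> 'l \<Rightarrow> 'k \<times> 'l" where
  "X_bracket x y = (0, bracket (snd x) (snd y))"

lemma X_bracket_add: "X_bracket (x + x') y = X_bracket x y + X_bracket x' y"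
    "X_bracket x (y + y') = X_bracket x y + X_bracket x y'"
  by (simp_all add: X_bracket_def bracket_add)

lemma X_bracket_scale: "X_bracket (X_scale scale c x) y = X_scale scale c (X_bracket x y)"
    "X_bracket x (X_scale scale c y) = X_scale scale c (X_bracket x y)"
  by (simp_all add: X_bracket_def X_scale_def split_beta bracket_scale)

lemma X_bracket_unit: "X_bracket unit_vec y = 0" "X_bracket x unit_vec = 0"
  by (simp_all add: X_bracket_def unit_vec_def bracket_zero zero_prod_def)

lemma X_bracket_zero: "X_bracket 0 y = 0" "X_bracket x 0 = 0"
  by (simp_all add: X_bracket_def bracket_zero zero_prod_def)

lemma X_bracket_leibniz:
  "X_bracket (X_bracket x y) z = X_bracket (X_bracket x z) y + X_bracket x (X_bracket y z)"
  by (simp add: X_bracket_def bracket_leibniz[of "snd x" "snd y" "snd z"])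

text \<open>These four cases cover every occurrence of T in \<open>R_pure\<close> and
  \<open>theta_pure\<close>: the last two arguments are always units or primitive parts, and then
  only brackets remain.\<close>

lemma T_lie_eq:
  "T_lie scale bracket x unit_vec unit_vec = x"
  "T_lie scale bracket x (primitive_part z) unit_vec = X_bracket x z"
  "T_lie scale bracket x unit_vec (primitive_part w) = X_bracket x w"
  "T_lie scale bracket x (primitive_part z) (primitive_part w) = X_bracket (X_bracket x z) w"
  by (simp_all add: T_lie_def X_bracket_def primitive_part_def unit_vec_def split_beta bracket_zero)

lemma framed_braiding_lie:
  "framed_braiding (X_scale scale) (R_map scale (T_lie scale bracket)) (theta_map scale (T_lie scale bracket))"
proof -
  let ?T = "T_lie scale bracket"
  let ?X = "X_scale scale"
  interpret T: trilinear_operation scale ?T by (rule trilinear_operation_T_lie)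
  define L where "L = tensor_lift ?X 2 (\<lambda>xs. pure ?X [X_bracket (xs ! 0) (xs ! 1)])"
  have ml: "multilinear ?X 2 (\<lambda>xs. pure ?X [X_bracket (xs ! 0) (xs ! 1)])"
    by (rule T.multilinear2I) (simp_all add: X_bracket_add X_bracket_scale T.pure_add_simps T.pure_scale_simps)
  note L = ml T.pure_range
  have L_pure: "L (pure ?X [x, y]) = pure ?X [X_bracket x y]" for x y
    unfolding L_def by (subst tensor_lift_pure[OF L]) simp_all
  have L_linear: "tensor_linear ?X 2 L" unfolding L_def by (rule tensor_lift_linear[OF L])
  interpret L: leibniz_bracket ?X 1 2 L "pure ?X [unit_vec]"
  proof
    show "L \<in> tensor_power ?X 2 \<rightarrow> tensor_power ?X 1"
      by (rule T.tensor_linear_into[OF L_linear])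
        (simp only: L_def tensor_lift_pure[OF L], simp add: pure_in_tensor_power)
    fix xs ys zs :: "('k \<times> 'l) list" assume "length xs = 1" "length ys = 1" "length zs = 1"
    then obtain x y z where l: "xs = [x]" "ys = [y]" "zs = [z]" by (auto simp: length_Suc_conv)
    \<comment> \<open>The Leibniz rule is instantiated at the given variables; as a general rewrite
      rule it would apply again to its own right-hand side.\<close>
    show "L (tensor_mult ?X (L (tensor_mult ?X (pure ?X xs) (pure ?X ys))) (pure ?X zs))
      = tensor_add ?X (L (tensor_mult ?X (L (tensor_mult ?X (pure ?X xs) (pure ?X zs))) (pure ?X ys)))
        (L (tensor_mult ?X (pure ?X xs) (L (tensor_mult ?X (pure ?X ys) (pure ?X zs)))))"
      by (simp add: l T.pure_mult L_pure X_bracket_leibniz[of x y z] T.pure_add_simps)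
  qed (auto simp: L_linear pure_in_tensor_power length_Suc_conv T.pure_mult L_pure X_bracket_unit
      T.pure_zero_simps)
  interpret L: braided_space ?X L.braiding
    by unfold_locales (use L.braiding_Aut L.braiding_braid[of 3] in simp_all)
  have braiding_pure: "L.braiding (pure ?X [x, y])
      = tensor_add ?X (pure ?X [y, x]) (pure ?X [unit_vec, X_bracket x y])" for x y
    using L.braiding_mult[of "pure ?X [x]" "pure ?X [y]"]
    by (simp add: pure_in_tensor_power T.pure_mult L_pure)
  have crossing_pure: "L.strand_crossing N i (pure ?X (us @ [x, y] @ ws))
      = tensor_add ?X (pure ?X (us @ [y, x] @ ws)) (pure ?X (us @ [unit_vec, X_bracket x y] @ ws))"
    if "length us = i" "length ws = N - 2 - i" for N i us ws x y
  proof -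
    have "L.strand_crossing N i (pure ?X (us @ [x, y] @ ws))
        = tensor_mult ?X (tensor_mult ?X (pure ?X us) (L.braiding (pure ?X [x, y]))) (pure ?X ws)"
      unfolding L.strand_crossing_def
      by (rule T.tensor_pad_pure[OF L.braiding_End that(1) _ that(2)]) simp
    then show ?thesis
      by (simp only: braiding_pure T.tensor_mult_add_left T.tensor_mult_add_right T.pure_range
          T.tensor_mult_range T.pure_mult append_assoc)
  qed
  have c4: "L.strand_crossing 4 0 (pure ?X [x, y, z, w])
      = tensor_add ?X (pure ?X [y, x, z, w]) (pure ?X [unit_vec, X_bracket x y, z, w])"
    "L.strand_crossing 4 1 (pure ?X [x, y, z, w])
      = tensor_add ?X (pure ?X [x, z, y, w]) (pure ?X [x, unit_vec, X_bracket y z, w])"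
    "L.strand_crossing 4 2 (pure ?X [x, y, z, w])
      = tensor_add ?X (pure ?X [x, y, w, z]) (pure ?X [x, y, unit_vec, X_bracket z w])" for x y z w
    using crossing_pure[of "[]" 0 "[z, w]" 4 x y] crossing_pure[of "[x]" 1 "[w]" 4 y z]
      crossing_pure[of "[x, y]" 2 "[]" 4 z w] by simp_all
  have A4: "L.strand_crossing 4 0 \<in> carrier (tensor_Aut ?X 4)" "L.strand_crossing 4 1 \<in> carrier (tensor_Aut ?X 4)"
    "L.strand_crossing 4 2 \<in> carrier (tensor_Aut ?X 4)"
    by (rule L.strand_crossing_Aut; simp)+
  note add4 = A4[THEN T.tensor_Aut_End, THEN T.tensor_EndD(3), THEN T.tensor_linear_add]
  interpret A4: group "tensor_Aut ?X 4" by (rule T.group_tensor_Aut)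
  have p4: "pure ?X [x, y, z, w] \<in> tensor_power ?X 4" for x y z w by (simp add: pure_in_tensor_power)
  have "R_map scale ?T = L.cable_crossing"
  proof (rule T.tensor_End_eq_pureI[OF T.R_map_End T.tensor_Aut_End[OF L.cable_crossing_Aut]])
    fix xs :: "('k \<times> 'l) list" assume "length xs = 4"
    then obtain x y z w where xs: "xs = [x, y, z, w]" by (auto simp: numeral_eq_Suc length_Suc_conv)
    have "L.cable_crossing (pure ?X [x, y, z, w])
      = L.strand_crossing 4 1 (L.strand_crossing 4 0 (L.strand_crossing 4 2 (L.strand_crossing 4 1 (pure ?X [x, y, z, w]))))"
      unfolding L.cable_crossing_def using A4 p4 A4[THEN T.tensor_Aut_End, THEN T.tensor_EndD(4)]
      by (simp add: T.tensor_Aut_apply)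
    \<comment> \<open>Four crossings, each splitting a term in two, could give sixteen terms. Those
      bracketing with \<open>unit_vec\<close> vanish, and the nine survivors are exactly the
      summands of \<open>R_pure\<close>.\<close>
    also have "\<dots> = T.R_pure x y z w"
      unfolding T.R_pure_def
      by (simp only: c4 add4 p4 tensor_add_in T_lie_eq X_bracket_unit T.pure_zero_simps T.tensor_add_zero
          T.pure_range T.tensor_add_range)
        (simp only: T.tensor_add_ac)
    finally show "R_map scale ?T (pure ?X xs) = L.cable_crossing (pure ?X xs)"
      by (simp add: xs T.R_map_pure)
  qed
  moreover have "theta_map scale ?T = L.full_twist"
  proof (rule T.tensor_End_eq_pureI[OF T.theta_map_End T.tensor_Aut_End[OF L.full_twist_Aut]])
    fix xs :: "('k \<times> 'l) list" assume "length xs = 2"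
    then obtain x y where xs: "xs = [x, y]" by (auto simp: numeral_eq_Suc length_Suc_conv)
    have p2: "pure ?X [x, y] \<in> tensor_power ?X 2" for x y by (simp add: pure_in_tensor_power)
    have "L.full_twist (pure ?X [x, y]) = L.braiding (L.braiding (pure ?X [x, y]))"
      unfolding L.full_twist_def by (rule T.tensor_Aut_apply[OF L.braiding_Aut L.braiding_Aut p2])
    \<comment> \<open>Both sides reduce to x (x) y + [x,y] (x) e + e (x) [y,x]: all other summands
      contain a bracket with \<open>unit_vec\<close>.\<close>
    also have "\<dots> = T.theta_pure x y"
      unfolding T.theta_pure_def
      by (simp only: braiding_pure T.tensor_linear_add[OF T.tensor_EndD(3)[OF L.braiding_End]] p2
          T_lie_eq X_bracket_unit X_bracket_zero T.pure_zero_simps T.tensor_add_zero T.pure_range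
          T.tensor_add_range rangeI)
        (simp only: T.tensor_add_ac)
    finally show "theta_map scale ?T (pure ?X xs) = L.full_twist (pure ?X xs)"
      by (simp add: xs T.theta_map_pure)
  qed
  ultimately show ?thesis using L.framed_braiding_cable by simp
qed

end

section \<open>3-Lie algebras: R as a braiding of pairs, with trivial twist\<close>

section \<open>3-Lie algebras\<close>

context three_lie_algebra
begin

lemmas bracket_add =
  module_hom.add[OF Vector_Spaces.linear.axioms(3)[OF linear_1]]
  module_hom.add[OF Vector_Spaces.linear.axioms(3)[OF linear_2]]
  module_hom.add[OF Vector_Spaces.linear.axioms(3)[OF linear_3]]
lemmas bracket_scale =
  module_hom.scale[OF Vector_Spaces.linear.axioms(3)[OF linear_1]]
  module_hom.scale[OF Vector_Spaces.linear.axioms(3)[OF linear_2]]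
  module_hom.scale[OF Vector_Spaces.linear.axioms(3)[OF linear_3]]
lemmas bracket_zero =
  module_hom.zero[OF Vector_Spaces.linear.axioms(3)[OF linear_1]]
  module_hom.zero[OF Vector_Spaces.linear.axioms(3)[OF linear_2]]
  module_hom.zero[OF Vector_Spaces.linear.axioms(3)[OF linear_3]]

lemma trilinear_operation_T_three_lie: "trilinear_operation scale (T_three_lie scale bracket)"
  by unfold_locales
    (simp_all add: T_three_lie_def X_scale_def unit_vec_def split_beta prod_eq_iff bracket_add bracket_scale
      bracket_zero algebra_simps scale_right_distrib scale_left_distrib)

definition X_bracket :: "'k \<times> 'l \<Rightarrow> 'k \<times> 'l \<Rightarrow> 'k \<times> 'l \<Rightarrow> 'k \<times> 'l" where
  "X_bracket x y z = (0, bracket (snd x) (snd y) (snd z))"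

lemma X_bracket_add: "X_bracket (x + x') y z = X_bracket x y z + X_bracket x' y z"
    "X_bracket x (y + y') z = X_bracket x y z + X_bracket x y' z"
    "X_bracket x y (z + z') = X_bracket x y z + X_bracket x y z'"
  by (simp_all add: X_bracket_def bracket_add)

lemma X_bracket_scale: "X_bracket (X_scale scale c x) y z = X_scale scale c (X_bracket x y z)"
    "X_bracket x (X_scale scale c y) z = X_scale scale c (X_bracket x y z)"
    "X_bracket x y (X_scale scale c z) = X_scale scale c (X_bracket x y z)"
  by (simp_all add: X_bracket_def X_scale_def split_beta bracket_scale)

lemma X_bracket_unit: "X_bracket unit_vec y z = 0" "X_bracket x unit_vec z = 0" "X_bracket x y unit_vec = 0"
  by (simp_all add: X_bracket_def unit_vec_def bracket_zero zero_prod_def)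

lemma X_bracket_fundamental_identity:
  "X_bracket (X_bracket x y z) u v
    = X_bracket (X_bracket x u v) y z + X_bracket x (X_bracket y u v) z + X_bracket x y (X_bracket z u v)"
  by (simp add: X_bracket_def fundamental_identity[of "snd x" "snd y" "snd z"])

text \<open>A single primitive argument kills T, in contrast to the Lie case. This removes most of
  the nine terms.\<close>

lemma T_three_lie_eq:
  "T_three_lie scale bracket x unit_vec unit_vec = x"
  "T_three_lie scale bracket x (primitive_part z) unit_vec = 0"
  "T_three_lie scale bracket x unit_vec (primitive_part w) = 0"
  "T_three_lie scale bracket x (primitive_part z) (primitive_part w) = X_bracket x z w"
  by (simp_all add: T_three_lie_def X_bracket_def primitive_part_def unit_vec_def split_beta bracket_zero zero_prod_def)

lemma framed_braiding_three_lie: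
  "framed_braiding (X_scale scale) (R_map scale (T_three_lie scale bracket)) (theta_map scale (T_three_lie scale bracket))"
proof -
  let ?T = "T_three_lie scale bracket"
  let ?X = "X_scale scale"
  interpret T: trilinear_operation scale ?T by (rule trilinear_operation_T_three_lie)
  \<comment> \<open>The Leibniz product on fundamental objects of a 3-Lie algebra: the pair in
    positions 2 and 3 acts on the pair in positions 0 and 1 as a derivation of the tensor product.
    It is extended by zero on scalar components.\<close>
  let ?\<phi> = "\<lambda>xs. tensor_add ?X (pure ?X [X_bracket (xs ! 0) (xs ! 2) (xs ! 3), xs ! 1])
    (pure ?X [xs ! 0, X_bracket (xs ! 1) (xs ! 2) (xs ! 3)])"
  define L where "L = tensor_lift ?X 4 ?\<phi>"
  have ml: "multilinear ?X 4 ?\<phi>"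
    by (rule T.multilinear4I)
      (simp_all add: X_bracket_add X_bracket_scale T.pure_add_simps T.pure_scale_simps T.tensor_scale_add
        T.pure_range T.tensor_add_ac)
  have in2: "?\<phi> xs \<in> tensor_power ?X 2" for xs
    by (intro tensor_add_in pure_in_tensor_power) simp_all
  note L = ml T.tensor_power_range[OF in2]
  have L_pure: "L (pure ?X [x, y, z, w])
      = tensor_add ?X (pure ?X [X_bracket x z w, y]) (pure ?X [x, X_bracket y z w])" for x y z w
    unfolding L_def by (subst tensor_lift_pure[OF L]) (simp_all add: numeral_eq_Suc)
  have L_linear: "tensor_linear ?X 4 L" unfolding L_def by (rule tensor_lift_linear[OF L])
  have p4: "pure ?X [x, y, z, w] \<in> tensor_power ?X 4" for x y z w by (simp add: pure_in_tensor_power)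
  have list2: "(\<exists>x y. xs = [x, y])" if "length xs = 2" for xs :: "('k \<times> 'l) list"
    using that by (auto simp: numeral_eq_Suc length_Suc_conv)
  interpret L: leibniz_bracket ?X 2 4 L "pure ?X [unit_vec, unit_vec]"
  proof
    show "L \<in> tensor_power ?X 4 \<rightarrow> tensor_power ?X 2"
      by (rule T.tensor_linear_into[OF L_linear]) (simp only: L_def tensor_lift_pure[OF L] in2)
    show "L (tensor_mult ?X (pure ?X [unit_vec, unit_vec]) (pure ?X xs)) = tensor_class ?X 0"
      if "length xs = 2" for xs
      using list2[OF that] by (auto simp: T.pure_mult L_pure X_bracket_unit T.pure_zero_simps T.tensor_add_zero)
    show "L (tensor_mult ?X (pure ?X xs) (pure ?X [unit_vec, unit_vec])) = tensor_class ?X 0"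
      if "length xs = 2" for xs
      using list2[OF that] by (auto simp: T.pure_mult L_pure X_bracket_unit T.pure_zero_simps T.tensor_add_zero)
    fix xs ys zs :: "('k \<times> 'l) list" assume "length xs = 2" "length ys = 2" "length zs = 2"
    then obtain x y z w u v where l: "xs = [x, y]" "ys = [z, w]" "zs = [u, v]" using list2 by metis
    \<comment> \<open>The mixed terms [x,z,w] (x) [y,u,v] and [x,u,v] (x) [y,z,w] occur on both
      sides. The others match by the fundamental identity in the left and in the right factor; its
      last four arguments are fixed to keep rewriting from looping.\<close>
    show "L (tensor_mult ?X (L (tensor_mult ?X (pure ?X xs) (pure ?X ys))) (pure ?X zs))
      = tensor_add ?X (L (tensor_mult ?X (L (tensor_mult ?X (pure ?X xs) (pure ?X zs))) (pure ?X ys)))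
        (L (tensor_mult ?X (pure ?X xs) (L (tensor_mult ?X (pure ?X ys) (pure ?X zs)))))"
      by (simp add: l T.pure_mult L_pure T.tensor_mult_add_left T.tensor_mult_add_right T.pure_range
          T.tensor_linear_add[OF L_linear] p4 X_bracket_fundamental_identity[of _ z w u v] T.pure_add_simps)
        (simp only: T.tensor_add_ac)
  qed (simp_all add: L_linear pure_in_tensor_power)
  \<comment> \<open>Three of the nine terms survive: the swapped tensor and the two in which both
    primitive parts act on the same factor, x or y. The latter make up E (x) L.\<close>
  have "R_map scale ?T = L.braiding"
  proof (rule T.tensor_End_eq_pureI[OF T.R_map_End L.braiding_End])
    fix xs :: "('k \<times> 'l) list" assume "length xs = 4"
    then obtain x y z w where xs: "xs = [x, y, z, w]" by (auto simp: numeral_eq_Suc length_Suc_conv)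
    show "R_map scale ?T (pure ?X xs) = L.braiding (pure ?X xs)"
      using L.braiding_mult[of "pure ?X [x, y]" "pure ?X [z, w]"]
      by (simp add: xs T.R_map_pure T.R_pure_def T_three_lie_eq T.pure_zero_simps T.tensor_add_zero T.pure_range
          T.tensor_add_range pure_in_tensor_power T.pure_mult L_pure T.tensor_mult_add_right T.tensor_add_ac)
  qed
  \<comment> \<open>Apart from x (x) y, every term of \<open>theta_pure\<close> has a single
    primitive argument somewhere, or a bracket whose first entry is \<open>unit_vec\<close>.\<close>
  moreover have "theta_map scale ?T = (\<lambda>u\<in>tensor_power ?X 2. u)"
  proof (rule T.tensor_End_eq_pureI[OF T.theta_map_End T.id_End])
    fix xs :: "('k \<times> 'l) list" assume "length xs = 2"
    then show "theta_map scale ?T (pure ?X xs) = (\<lambda>u\<in>tensor_power ?X 2. u) (pure ?X xs)"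
      using list2[of xs]
      by (auto simp: T.theta_map_pure T.theta_pure_def T_three_lie_eq X_bracket_unit T.pure_zero_simps
          T.tensor_add_zero T.pure_range T.tensor_add_range pure_in_tensor_power)
  qed
  moreover have "framed_braiding ?X L.braiding (\<lambda>u\<in>tensor_power ?X 2. u)"
  proof
    interpret A2: group "tensor_Aut ?X 2" by (rule T.group_tensor_Aut)
    interpret A4: group "tensor_Aut ?X 4" by (rule T.group_tensor_Aut)
    show "(\<lambda>u\<in>tensor_power ?X 2. u) \<in> carrier (tensor_Aut ?X 2)"
      using A2.one_closed by (simp only: T.tensor_Aut_one)
    \<comment> \<open>A padded identity is the unit of the automorphism group, so both twist
      relations reduce to R = R.\<close>
    have "tensor_pad ?X a 2 (\<lambda>u\<in>tensor_power ?X 2. u) b = \<one>\<^bsub>tensor_Aut ?X 4\<^esub>" if "4 = a + 2 + b" for a b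
      using that by (simp add: T.tensor_pad_id T.tensor_Aut_one)
    note id = this[of 0 2, simplified] this[of 2 0, simplified]
    show "L.braiding \<otimes>\<^bsub>tensor_Aut ?X 4\<^esub> tensor_pad ?X 0 2 (\<lambda>u\<in>tensor_power ?X 2. u) 2
      = tensor_pad ?X 2 2 (\<lambda>u\<in>tensor_power ?X 2. u) 0 \<otimes>\<^bsub>tensor_Aut ?X 4\<^esub> L.braiding"
      "L.braiding \<otimes>\<^bsub>tensor_Aut ?X 4\<^esub> tensor_pad ?X 2 2 (\<lambda>u\<in>tensor_power ?X 2. u) 0
      = tensor_pad ?X 0 2 (\<lambda>u\<in>tensor_power ?X 2. u) 2 \<otimes>\<^bsub>tensor_Aut ?X 4\<^esub> L.braiding"
      unfolding id using L.braiding_Aut by simp_all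
  qed (use L.braiding_Aut L.braiding_braid[of 6] in simp_all)
  ultimately show ?thesis by simp
qed

end

section \<open>The representation of the infinite framed braid group\<close>

theorem theorem5p4:
  fixes scale :: "'k::field \<Rightarrow> 'l::ab_group_add \<Rightarrow> 'l"
    and br2 :: "'l \<Rightarrow> 'l \<Rightarrow> 'l"
    and br3 :: "'l \<Rightarrow> 'l \<Rightarrow> 'l \<Rightarrow> 'l"
    and T :: "('k, 'l) trilinear"
  assumes "lie_algebra scale br2 \<and> T = T_lie scale br2 \<or>
           three_lie_algebra scale br3 \<and> T = T_three_lie scale br3"
  shows "(\<forall>n. (\<forall>i\<in>{1..<n}. sigma_image scale T n i \<in> carrier (Aut_X scale n)) \<and>
              (\<forall>i\<in>{1..n}. twist_image scale T n i \<in> carrier (Aut_X scale n))) \<and>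
    (\<exists>\<Phi>.
      (\<forall>n. group_hom (FB n) (Aut_X scale n) (\<Phi> n) \<and>
           (\<forall>i\<in>{1..<n}. \<Phi> n (fb_class n (sigma_word i)) = sigma_image scale T n i) \<and>
           (\<forall>i\<in>{1..n}. \<Phi> n (fb_class n (twist_word i)) = twist_image scale T n i)) \<and>
      (\<forall>n. \<forall>g\<in>carrier (FB n). \<Phi> (Suc n) (FB_incl n g) = Aut_incl scale n (\<Phi> n g)) \<and>
      (\<exists>\<Phi>_inf.
        group_hom FB_infinity (colimit_group (Aut_X scale) (Aut_incl scale)) \<Phi>_inf \<and>
        (\<forall>n. \<forall>g\<in>carrier (FB n).
          \<Phi>_inf (colimit_in FB FB_incl n g) = colimit_in (Aut_X scale) (Aut_incl scale) n (\<Phi> n g))))"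
proof -
  have "framed_braiding (X_scale scale) (R_map scale T) (theta_map scale T)"
    using assms lie_algebra.framed_braiding_lie three_lie_algebra.framed_braiding_three_lie by blast
  then interpret framed_braiding "X_scale scale" "R_map scale T" "theta_map scale T" .
  have images: "sigma_image scale T n i = crossing n i" "twist_image scale T n i = twist n i" for n i
    by (simp_all add: sigma_image_def crossing_def twist_image_def twist_def)
  \<comment> \<open>Equalities of whole families, since the colimit takes the sequence of groups and
    the sequence of maps as arguments.\<close>
  have Aut: "Aut_X scale = (\<lambda>n. tensor_Aut (X_scale scale) (2 * n))" "Aut_incl scale = stabilize"
    by (simp_all add: fun_eq_iff Aut_X_def Aut_incl_def)
  let ?G = "\<lambda>n. tensor_Aut (X_scale scale) (2 * n)"
  show ?thesis
    unfolding images Aut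
  proof (intro conjI exI[of _ representation] exI[of _ "colimit_map ?G stabilize representation"] allI ballI)
    fix n
    show "group_hom (FB n) (?G n) (representation n)" by (rule representation_hom)
    show "crossing n i \<in> carrier (?G n)" if "i \<in> {1..<n}" for i using that by (simp add: crossing_Aut)
    show "twist n i \<in> carrier (?G n)" if "i \<in> {1..n}" for i using that by (simp add: twist_Aut)
    show "representation n (fb_class n (sigma_word i)) = crossing n i" if "i \<in> {1..<n}" for i
      using that by (simp add: representation_sigma)
    show "representation n (fb_class n (twist_word i)) = twist n i" if "i \<in> {1..n}" for i
      using that by (simp add: representation_twist)
    fix g assume g: "g \<in> carrier (FB n)"
    show "representation (Suc n) (FB_incl n g) = stabilize n (representation n g)"
      by (rule representation_compatible[OF g])
    show "colimit_map ?G stabilize representation (colimit_in FB FB_incl n g)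
        = colimit_in ?G stabilize n (representation n g)"
      by (rule representation_colimit_in[OF g])
  qed (rule representation_colimit_hom)
qed

end
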